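(* Let $n\ge3$ be an integer and let $\zeta:\{s,c,e,q,o\}^*\to\mathcal{RP}_n$ be the monoid homomorphism determined by $s\mapsto\overline s_1$, $c\mapsto\overline s_1\overline s_2\cdots\overline s_{n-1}$, $e\mapsto\overline e_1$, $q\mapsto\overline q_1$, $o\mapsto\overline o_1$. Then the rook partition monoid $\mathcal{RP}_n$ has monoid presentation $\langle s,c,e,q,o:R\rangle$ via $\zeta$, where $R$ consists of the following relations: $c^n=(sc)^{n-1}=s^2=(c^isc^{n-i}s)^2=1$ for all $2\le i\le\frac n2$; $e^2=e=eqe=eoe=scec^{n-1}s=csc^{n-1}ecsc^{n-1}$; $q^2=q=qeq=qs=sq=c^2sc^{n-2}qc^2sc^{n-2}=c^{n-1}scsc^{n-1}qcsc^{n-1}sc$; $sese=eses=ese$; $qcqc^{n-1}=cqc^{n-1}q$; $qc^2qc^{n-2}=c^2qc^{n-2}q$; $qc^2ec^{n-2}=c^2ec^{n-2}q$; $o^2=o=oeo=scoc^{n-1}s=csc^{n-1}ocsc^{n-1}$; $soso=osos=oso=oq=qo$; $qc^2oc^{n-2}=c^2oc^{n-2}q$; $esos=sose$.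
   Context: Write $[n]=\{1,\dots,n\}$, $[n]'=\{1',\dots,n'\}$, $[n]''=\{1'',\dots,n''\}$. A rook partition of degree $n$ is a collection of pairwise disjoint non-empty subsets (called blocks) of $[n]\cup[n]'$; elements of $[n]\cup[n]'$ lying in no block are its rook dots. $\mathcal{RP}_n$ is the set of all rook partitions of degree $n$. Product: for $\alpha,\beta\in\mathcal{RP}_n$, relabel each $i'$ of $\alpha$ as $i''$ to get $\alpha_\vee$, and relabel each $i$ of $\beta$ as $i''$ to get $\beta^\wedge$. Let $\Gamma(\alpha,\beta)$ be the graph on $[n]\cup[n]'\cup[n]''$ in which two vertices are adjacent if they lie in a common block of $\alpha_\vee$ or a common block of $\beta^\wedge$; a vertex is white if it is a rook dot of $\alpha_\vee$ or of $\beta^\wedge$, and black otherwise. Then $\alpha\beta$ is the rook partition such that $x\in[n]\cup[n]'$ is a rook dot of $\alpha\beta$ iff $x$ is connected by a (possibly empty) path to a white vertex in $\Gamma(\alpha,\beta)$, and two elements of $[n]\cup[n]'$ that are not rook dots of $\alpha\beta$ are in the same block iff they are connected by a path in $\Gamma(\alpha,\beta)$. This makes $\mathcal{RP}_n$ a monoid with identity $\{\{1,1'\},\dots,\{n,n'\}\}$. Elements: $\overline s_i$ (for $1\le i\le n-1$) has blocks $\{i,(i+1)'\},\{i+1,i'\}$ and $\{j,j'\}$ for $j\notin\{i,i+1\}$; $\overline e_1$ has blocks $\{1\},\{1'\}$ and $\{j,j'\}$ for $j\ne 1$; $\overline q_1$ has blocks $\{1,2,1',2'\}$ and $\{j,j'\}$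 for $j\ge3$; $\overline o_1$ has blocks $\{j,j'\}$ for $j\neq 1$ and rook dots $1,1'$. $X^*$ is the free monoid on $X$, with empty word $1$. A monoid $M$ has monoid presentation $\langle X:R\rangle$ via $\phi$ if $\phi:X^*\to M$ is a surjective monoid homomorphism whose kernel $\{(u,v):u\phi=v\phi\}$ is the congruence on $X^*$ generated by $R$.
   Formalization: The relation q = c^2sc^{n-2}qc^2sc^{n-2} is imposed only for n ≥ 4: for n = 3 the word c^2sc maps to the transposition of 1 and 3, so the relation fails in RP_3; all other relations are kept for every n ≥ 3. *)

theory Defs
  imports HOL.Hull "HOL-Algebra.Group" "HOL-Library.Disjoint_Sets"
begin

section \<open>Monoid presentations\<close>

definition free_monoid :: "'x set \<Rightarrow> 'x list monoid" where
  "free_monoid X = \<lparr>carrier = lists X, monoid.mult = (@), one = []\<rparr>"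

definition monoid_hom :: "('a, 'c) monoid_scheme \<Rightarrow> ('b, 'd) monoid_scheme \<Rightarrow> ('a \<Rightarrow> 'b) set" where
  "monoid_hom M N = {\<phi> \<in> hom M N. \<phi> \<one>\<^bsub>M\<^esub> = \<one>\<^bsub>N\<^esub>}"

definition monoid_congruence :: "('a, 'c) monoid_scheme \<Rightarrow> ('a \<times> 'a) set \<Rightarrow> bool" where
  "monoid_congruence M r \<longleftrightarrow>
     equiv (carrier M) r \<and>
     (\<forall>a b a' b'. (a, b) \<in> r \<longrightarrow> (a', b') \<in> r \<longrightarrow> (a \<otimes>\<^bsub>M\<^esub> a', b \<otimes>\<^bsub>M\<^esub> b') \<in> r)"

definition monoid_kernel :: "('a, 'c) monoid_scheme \<Rightarrow> ('a \<Rightarrow> 'b) \<Rightarrow> ('a \<times> 'a) set" where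
  "monoid_kernel M \<phi> = {(u, v). u \<in> carrier M \<and> v \<in> carrier M \<and> \<phi> u = \<phi> v}"

definition has_monoid_presentation ::
  "('a, 'c) monoid_scheme \<Rightarrow> 'x set \<Rightarrow> ('x list \<times> 'x list) set \<Rightarrow> ('x list \<Rightarrow> 'a) \<Rightarrow> bool" where
  "has_monoid_presentation M X R \<phi> \<longleftrightarrow>
     monoid M \<and>
     R \<subseteq> lists X \<times> lists X \<and>
     \<phi> \<in> monoid_hom (free_monoid X) M \<and>
     \<phi> ` lists X = carrier M \<and>
     monoid_kernel (free_monoid X) \<phi> = monoid_congruence (free_monoid X) hull R"


section \<open>The rook partition monoid\<close>

text \<open>\<open>Upper i\<close>, \<open>Lower i\<close>, \<open>Middle i\<close> stand for $i$, $i'$, $i''$.\<close>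

datatype vertex = Upper nat | Lower nat | Middle nat

abbreviation uppers :: "nat \<Rightarrow> vertex set" where "uppers n \<equiv> Upper ` {1..n}"
abbreviation lowers :: "nat \<Rightarrow> vertex set" where "lowers n \<equiv> Lower ` {1..n}"
abbreviation middles :: "nat \<Rightarrow> vertex set" where "middles n \<equiv> Middle ` {1..n}"

definition rook_partitions :: "nat \<Rightarrow> vertex set set set" where
  "rook_partitions n = {\<alpha>. disjoint \<alpha> \<and> {} \<notin> \<alpha> \<and> \<Union>\<alpha> \<subseteq> uppers n \<union> lowers n}"

fun lower_to_middle :: "vertex \<Rightarrow> vertex" where
  "lower_to_middle (Lower i) = Middle i"
| "lower_to_middle v = v"

fun upper_to_middle :: "vertex \<Rightarrow> vertex" where
  "upper_to_middle (Upper i) = Middle i"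
| "upper_to_middle v = v"

definition relabel_down :: "vertex set set \<Rightarrow> vertex set set" where  (* alpha with index vee *)
  "relabel_down \<alpha> = (\<lambda>A. lower_to_middle ` A) ` \<alpha>"

definition relabel_up :: "vertex set set \<Rightarrow> vertex set set" where  (* beta with exponent wedge *)
  "relabel_up \<beta> = (\<lambda>B. upper_to_middle ` B) ` \<beta>"

text \<open>The adjacency relation of $\Gamma(\alpha,\beta)$; it also contains loops, which do not
  affect the existence of paths.\<close>

definition adjacent :: "vertex set set \<Rightarrow> vertex set set \<Rightarrow> (vertex \<times> vertex) set" where
  "adjacent \<alpha> \<beta> = {(x, y). \<exists>A \<in> relabel_down \<alpha> \<union> relabel_up \<beta>. x \<in> A \<and> y \<in> A}"

definition white :: "nat \<Rightarrow> vertex set set \<Rightarrow> vertex set set \<Rightarrow> vertex set" where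
  "white n \<alpha> \<beta> = ((uppers n \<union> middles n) - \<Union>(relabel_down \<alpha>))
               \<union> ((middles n \<union> lowers n) - \<Union>(relabel_up \<beta>))"

definition product_dots :: "nat \<Rightarrow> vertex set set \<Rightarrow> vertex set set \<Rightarrow> vertex set" where
  "product_dots n \<alpha> \<beta> =
     {x \<in> uppers n \<union> lowers n. \<exists>w \<in> white n \<alpha> \<beta>. (x, w) \<in> (adjacent \<alpha> \<beta>)\<^sup>*}"

definition rook_product :: "nat \<Rightarrow> vertex set set \<Rightarrow> vertex set set \<Rightarrow> vertex set set" where
  "rook_product n \<alpha> \<beta> =
     (let V = (uppers n \<union> lowers n) - product_dots n \<alpha> \<beta>
      in {{y \<in> V. (x, y) \<in> (adjacent \<alpha> \<beta>)\<^sup>*} | x. x \<in> V})"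

definition vertical_blocks :: "nat set \<Rightarrow> vertex set set" where
  "vertical_blocks J = {{Upper j, Lower j} | j. j \<in> J}"

definition rook_monoid :: "nat \<Rightarrow> vertex set set monoid" where
  "rook_monoid n = \<lparr>carrier = rook_partitions n, monoid.mult = rook_product n,
                    one = vertical_blocks {1..n}\<rparr>"

definition s_bar :: "nat \<Rightarrow> nat \<Rightarrow> vertex set set" where
  "s_bar n i = {{Upper i, Lower (i + 1)}, {Upper (i + 1), Lower i}}
               \<union> vertical_blocks ({1..n} - {i, i + 1})"

definition e_bar1 :: "nat \<Rightarrow> vertex set set" where
  "e_bar1 n = {{Upper 1}, {Lower 1}} \<union> vertical_blocks ({1..n} - {1})"

definition q_bar1 :: "nat \<Rightarrow> vertex set set" where
  "q_bar1 n = {{Upper 1, Upper 2, Lower 1, Lower 2}} \<union> vertical_blocks {3..n}"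

definition o_bar1 :: "nat \<Rightarrow> vertex set set" where
  "o_bar1 n = vertical_blocks ({1..n} - {1})"


section \<open>Generators and relations\<close>

datatype letter = Gs | Gc | Ge | Gq | Go

definition monoid_prod_list :: "('a, 'c) monoid_scheme \<Rightarrow> 'a list \<Rightarrow> 'a" where
  "monoid_prod_list M xs = foldr (\<lambda>x y. x \<otimes>\<^bsub>M\<^esub> y) xs \<one>\<^bsub>M\<^esub>"

fun letter_image :: "nat \<Rightarrow> letter \<Rightarrow> vertex set set" where
  "letter_image n Gs = s_bar n 1"
| "letter_image n Gc = monoid_prod_list (rook_monoid n) (map (s_bar n) [1..<n])"
| "letter_image n Ge = e_bar1 n"
| "letter_image n Gq = q_bar1 n"
| "letter_image n Go = o_bar1 n"

definition zeta :: "nat \<Rightarrow> letter list \<Rightarrow> vertex set set" where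
  "zeta n w = monoid_prod_list (rook_monoid n) (map (letter_image n) w)"

definition word_power :: "'x list \<Rightarrow> nat \<Rightarrow> 'x list"  (infixr "\<up>" 80) where
  "w \<up> k = concat (replicate k w)"

text \<open>The relations expressed by a chain of equalities $w_1 = w_2 = \cdots = w_k$.\<close>

definition rel_chain :: "'x list list \<Rightarrow> ('x list \<times> 'x list) set" where
  "rel_chain ws = set (zip ws (tl ws))"

text \<open>
  The relation $q = c^2sc^{n-2}qc^2sc^{n-2}$ expresses that $\overline q_1$ commutes with
  $\overline s_3$, which exists only for $n \ge 4$. The source lists it for all $n \ge 3$, but for
  $n = 3$ the word $c^2sc^{n-2}$ represents the transposition of 1 and 3, which does not commute
  with $\overline q_1$, and the relation fails in the rook partition monoid. It is therefore
  imposed only when $n \ge 4$; all other relations are imposed for every $n \ge 3$.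
  The letter $o$ is written \<open>r\<close>, since \<open>o\<close> is reserved for function composition.
\<close>

definition rook_relations :: "nat \<Rightarrow> (letter list \<times> letter list) set" where
  "rook_relations n =
    (let s = [Gs]; c = [Gc]; e = [Ge]; q = [Gq]; r = [Go] in
       rel_chain [c\<up>n, (s @ c)\<up>(n-1), s\<up>2, []]
     \<union> (\<Union>i \<in> {i. 2 \<le> i \<and> 2 * i \<le> n}. rel_chain [(c\<up>i @ s @ c\<up>(n-i) @ s)\<up>2, []])
     \<union> rel_chain [e\<up>2, e, e @ q @ e, e @ r @ e, s @ c @ e @ c\<up>(n-1) @ s,
                  c @ s @ c\<up>(n-1) @ e @ c @ s @ c\<up>(n-1)]
     \<union> rel_chain [q\<up>2, q, q @ e @ q, q @ s, s @ q,
                  c\<up>(n-1) @ s @ c @ s @ c\<up>(n-1) @ q @ c @ s @ c\<up>(n-1) @ s @ c]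
     \<union> (if n \<ge> 4 then rel_chain [q, c\<up>2 @ s @ c\<up>(n-2) @ q @ c\<up>2 @ s @ c\<up>(n-2)] else {})
     \<union> rel_chain [s @ e @ s @ e, e @ s @ e @ s, e @ s @ e]
     \<union> rel_chain [q @ c @ q @ c\<up>(n-1), c @ q @ c\<up>(n-1) @ q]
     \<union> rel_chain [q @ c\<up>2 @ q @ c\<up>(n-2), c\<up>2 @ q @ c\<up>(n-2) @ q]
     \<union> rel_chain [q @ c\<up>2 @ e @ c\<up>(n-2), c\<up>2 @ e @ c\<up>(n-2) @ q]
     \<union> rel_chain [r\<up>2, r, r @ e @ r, s @ c @ r @ c\<up>(n-1) @ s,
                  c @ s @ c\<up>(n-1) @ r @ c @ s @ c\<up>(n-1)]
     \<union> rel_chain [s @ r @ s @ r, r @ s @ r @ s, r @ s @ r, r @ q, q @ r]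
     \<union> rel_chain [q @ c\<up>2 @ r @ c\<up>(n-2), c\<up>2 @ r @ c\<up>(n-2) @ q]
     \<union> rel_chain [e @ s @ r @ s, s @ r @ s @ e])"

end

theory Submission
  imports Defs "HOL-Combinatorics.Permutations"
begin

text \<open>
  Let \<open>M\<close> be the monoid defined by the relations. The relations between \<open>s\<close> and \<open>c\<close> give the Coxeter
  relations, hence permutations \<open>P \<pi>\<close> in \<open>M\<close>; the elements \<open>e\<close>, \<open>q\<close>, \<open>o\<close> commute with the stabilisers
  of 1, of \<open>{1, 2}\<close> and of 1, so they have well-defined conjugates \<open>E x\<close>, \<open>K x y\<close> and \<open>K 0 x\<close>. Treating
  0 as a further point that is joined to all rook dots, the \<open>K x y\<close> are commuting idempotents whose
  products depend only on the equivalence relation generated by the pairs \<open>(x, y)\<close>. It follows that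
  every element of \<open>M\<close> is a product of an upper kernel, a partial permutation and a lower kernel,
  and that this product depends only on the two kernels and on the matching of their classes.
  These data can be read off the rook partition, which is seen by representing rook partitions
  faithfully as relations between two-colourings.
\<close>

section \<open>Transformation monoids\<close>

text \<open>A quotient of the free monoid is not a type, so all calculation in it takes place in a
  locale over an arbitrary \<open>monoid_mult\<close> whose elements satisfy the relations. The
  locale is instantiated at the end by letting words act on congruence classes, which is why
  self-maps form an instance of \<open>monoid_mult\<close>; the same type hosts the permutations
  with which words in \<open>s\<close> and \<open>c\<close> are compared. The point 0 makes joining
  two points (\<open>q\<close>) and erasing one (\<open>o\<close>) instances of a single family
  \<open>K\<close>. It is special in two ways: every permutation fixes it, and there is no
  \<open>E 0\<close>, so it is never cut from the domain. When a point is joined to 0, it is that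
  point whose strand disappears. The delicate generator is \<open>e\<close>: multiplying by
  \<open>E i\<close> must detach \<open>i\<close> from its lower kernel class, which is possible
  only after the strand arriving at \<open>i\<close> has been cleared. The size of the rook
  partition monoid is never computed. A normal form is also a word, so it can be evaluated both in
  the quotient and as a relation between colourings, and the relation determines the form.\<close>

datatype 'a endo = Endo (app: "'a \<Rightarrow> 'a")

text \<open>Transformations act from the right: \<open>f * g\<close> applies \<open>f\<close> first.\<close>

instantiation endo :: (type) monoid_mult
begin
definition "1 = Endo id"
definition "f * g = Endo (app g \<circ> app f)"
instance by standard (simp_all add: one_endo_def times_endo_def comp_assoc)
end

section \<open>The Coxeter presentation of the symmetric group\<close>

text \<open>Conjugating a transposition by an adjacent one stretches it by one step, so closure
  under composition reaches all transpositions, and these generate.\<close>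

lemma permutes_adjacent_induct [consumes 1, case_names id comp swap]:
  assumes "\<pi> permutes {a..b::nat}"
    and "Q id"
    and comp: "\<And>p q. Q p \<Longrightarrow> Q q \<Longrightarrow> Q (p \<circ> q)"
    and swap: "\<And>k. a \<le> k \<Longrightarrow> k < b \<Longrightarrow> Q (transpose k (Suc k))"
  shows "Q \<pi>"
proof -
  have less: "Q (transpose i (Suc (i + d)))" if "a \<le> i" "Suc (i + d) \<le> b" for i d
    using that
  proof (induction d)
    case 0
    then show ?case using swap[of i] by simp
  next
    case (Suc d)
    have "transpose i (Suc (i + Suc d)) = transpose (Suc (i + d)) (Suc (Suc (i + d))) \<circ>
        transpose i (Suc (i + d)) \<circ> transpose (Suc (i + d)) (Suc (Suc (i + d)))"
      by (auto simp: fun_eq_iff transpose_def)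
    moreover have "Q (transpose (Suc (i + d)) (Suc (Suc (i + d))))"
      using Suc.prems by (intro swap) auto
    moreover have "Q (transpose i (Suc (i + d)))" using Suc by simp
    ultimately show ?case by (metis comp)
  qed
  have tr: "Q (transpose i j)" if "i \<in> {a..b}" "j \<in> {a..b}" for i j
  proof (cases i j rule: linorder_cases)
    case less
    then show ?thesis using that \<open>\<And>i d. _ \<Longrightarrow> _ \<Longrightarrow> Q (transpose i (Suc (i + d)))\<close>[of i "j - i - 1"] by simp
  next
    case equal
    then show ?thesis using assms(2) by (simp add: id_def)
  next
    case greater
    then show ?thesis using that \<open>\<And>i d. _ \<Longrightarrow> _ \<Longrightarrow> Q (transpose i (Suc (i + d)))\<close>[of j "i - j - 1"]
      by (simp add: transpose_commute)
  qed
  have "finite {a..b}" by simp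
  with assms(1) show ?thesis
  proof (induction rule: permutes_induct)
    case id
    then show ?case by (rule assms)
  next
    case (swap i j p)
    then show ?case using comp tr by blast
  qed
qed

text \<open>The first letter acts first, as in the product of \<open>endo\<close>; this is the
  source of the reversed order in \<open>word_perm_append\<close> and \<open>P_comp\<close>.\<close>

primrec word_perm :: "nat list \<Rightarrow> nat \<Rightarrow> nat" where
  "word_perm [] = id"
| "word_perm (i # w) = word_perm w \<circ> transpose i (Suc i)"

lemma word_perm_append: "word_perm (u @ v) = word_perm v \<circ> word_perm u"
  by (induction u) (auto simp: fun_eq_iff)

lemma word_perm_permutes: "set w \<subseteq> {a..<b} \<Longrightarrow> word_perm w permutes {a..b}"
proof (induction w)
  case (Cons i w)
  then have "transpose i (Suc i) permutes {a..b}" by (intro permutes_swap_id) auto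
  with Cons show ?case unfolding word_perm.simps by (intro permutes_compose) auto
qed (simp add: permutes_id)

lemma word_perm_rev: "word_perm (rev w) \<circ> word_perm w = id"
  by (induction w) (auto simp: word_perm_append fun_eq_iff)

lemma ex_word_perm:
  assumes "\<pi> permutes {a..b}"
  shows "\<exists>w. set w \<subseteq> {a..<b} \<and> word_perm w = \<pi>"
  using assms
proof (induction rule: permutes_adjacent_induct)
  case id
  then show ?case by (intro exI[of _ "[]"]) auto
next
  case (comp p q)
  then obtain u v where "set u \<subseteq> {a..<b}" "word_perm u = p" "set v \<subseteq> {a..<b}" "word_perm v = q"
    by blast
  then show ?case by (intro exI[of _ "v @ u"]) (auto simp: word_perm_append)
next
  case (swap k)
  then show ?case by (intro exI[of _ "[k]"]) auto
qed

definition perm_word :: "nat \<Rightarrow> (nat \<Rightarrow> nat) \<Rightarrow> nat list" where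
  "perm_word n \<pi> = (SOME w. set w \<subseteq> {1..<n} \<and> word_perm w = \<pi>)"

lemma perm_word:
  assumes "\<pi> permutes {1..n}"
  shows "set (perm_word n \<pi>) \<subseteq> {1..<n}" "word_perm (perm_word n \<pi>) = \<pi>"
  using someI_ex[OF ex_word_perm[OF assms]] unfolding perm_word_def by auto

locale adjacent_transpositions =
  fixes T :: "nat \<Rightarrow> 'a::monoid_mult" and n :: nat
  assumes square: "1 \<le> i \<Longrightarrow> i < n \<Longrightarrow> T i * T i = 1"
    and braid: "1 \<le> i \<Longrightarrow> Suc i < n \<Longrightarrow> T i * T (Suc i) * T i = T (Suc i) * T i * T (Suc i)"
    and distant: "1 \<le> i \<Longrightarrow> i + 2 \<le> j \<Longrightarrow> j < n \<Longrightarrow> T i * T j = T j * T i"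
begin

definition prod :: "nat list \<Rightarrow> 'a" where "prod w = prod_list (map T w)"

lemma prod_simps [simp]: "prod [] = 1" "prod (i # w) = T i * prod w" "prod (u @ v) = prod u * prod v"
  by (simp_all add: prod_def)

text \<open>The coset representatives of the symmetric group on \<open>m - 1\<close> points in that on \<open>m\<close> points;
  \<open>desc m k\<close> maps \<open>m\<close> to \<open>k\<close>.\<close>

definition desc :: "nat \<Rightarrow> nat \<Rightarrow> 'a" where "desc m k = prod (rev [k..<m])"

lemma desc_refl: "desc m m = 1"
  by (simp add: desc_def)

lemma desc_right: "k < m \<Longrightarrow> desc m k = desc m (Suc k) * T k"
  by (simp add: desc_def upt_conv_Cons)

lemma desc_left: "k \<le> m \<Longrightarrow> desc (Suc m) k = T m * desc m k"
  by (simp add: desc_def)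

text \<open>\<open>desc m k\<close> is the descending run from \<open>T (m - 1)\<close> to
  \<open>T k\<close>; all its letters are at distance at least 2 from \<open>i\<close>.\<close>

lemma desc_commute_low:
  assumes "k \<le> m" "1 \<le> i" "i + 2 \<le> k" "m \<le> n"
  shows "desc m k * T i = T i * desc m k"
  using assms
proof (induction m rule: dec_induct)
  case base
  then show ?case by (simp add: desc_refl)
next
  case (step m)
  have "desc (Suc m) k * T i = T m * (desc m k * T i)" using step by (simp add: desc_left mult.assoc)
  also have "\<dots> = T m * T i * desc m k" using step by (simp add: mult.assoc)
  also have "\<dots> = T i * T m * desc m k" using step distant[of i m] by simp
  finally show ?case using step by (simp add: desc_left mult.assoc)
qed

lemma desc_commute_high:
  assumes "k \<le> m" "1 \<le> k" "m < i" "i < n"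
  shows "desc m k * T i = T i * desc m k"
  using assms
proof (induction m rule: dec_induct)
  case base
  then show ?case by (simp add: desc_refl)
next
  case (step m)
  have "desc (Suc m) k * T i = T m * (desc m k * T i)" using step by (simp add: desc_left mult.assoc)
  also have "\<dots> = T m * T i * desc m k" using step by (simp add: mult.assoc)
  also have "\<dots> = T i * T m * desc m k" using step distant[of m i] by simp
  finally show ?case using step by (simp add: desc_left mult.assoc)
qed

text \<open>Inside the run the letter meets its neighbours \<open>T (Suc j)\<close> and
  \<open>T j\<close>. One braid relation carries it past them with its index lowered by one, and the
  remaining letters commute with it.\<close>

lemma desc_shift:
  assumes "1 \<le> k" "k \<le> j" "Suc (Suc j) \<le> m" "m \<le> n"
  shows "desc m k * T (Suc j) = T j * desc m k"
  using assms(3,1,2,4)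
proof (induction m rule: dec_induct)
  case base
  have "desc (Suc (Suc j)) k * T (Suc j) = T (Suc j) * T j * (desc j k * T (Suc j))"
    using base by (simp add: desc_left mult.assoc)
  also have "\<dots> = T (Suc j) * T j * T (Suc j) * desc j k"
    using base by (simp add: desc_commute_high mult.assoc)
  also have "\<dots> = T j * T (Suc j) * T j * desc j k"
    using base braid[of j] by simp
  finally show ?case using base by (simp add: desc_left mult.assoc)
next
  case (step m)
  have "desc (Suc m) k * T (Suc j) = T m * (desc m k * T (Suc j))"
    using step by (simp add: desc_left mult.assoc)
  also have "\<dots> = T m * T j * desc m k" using step by (simp add: mult.assoc)
  also have "\<dots> = T j * T m * desc m k" using step distant[of j m] by simp
  finally show ?case using step by (simp add: desc_left mult.assoc)
qed

end

text \<open>The same coset decomposition is recorded for two families at once, so that it can be compared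
  with its image under \<^const>\<open>word_perm\<close>.\<close>

lemma coset_decomposition:
  assumes "adjacent_transpositions T n" "adjacent_transpositions T' n"
    and "set w \<subseteq> {1..<m}" "1 \<le> m" "m \<le> n"
  shows "\<exists>u k. set u \<subseteq> {1..<m - 1} \<and> 1 \<le> k \<and> k \<le> m \<and>
    adjacent_transpositions.prod T w =
      adjacent_transpositions.prod T u * adjacent_transpositions.desc T m k \<and>
    adjacent_transpositions.prod T' w =
      adjacent_transpositions.prod T' u * adjacent_transpositions.desc T' m k"
proof -
  interpret X: adjacent_transpositions T n by fact
  interpret Y: adjacent_transpositions T' n by fact
  show ?thesis using assms(3)
  proof (induction w rule: rev_induct)
    case Nil
    show ?case using assms(4) by (intro exI[of _ "[]"] exI[of _ m]) (simp add: X.desc_refl Y.desc_refl)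
  next
    case (snoc i w)
    then obtain u k where u: "set u \<subseteq> {1..<m - 1}" and k: "1 \<le> k" "k \<le> m"
      and X: "X.prod w = X.prod u * X.desc m k" and Y: "Y.prod w = Y.prod u * Y.desc m k"
      by auto
    have i: "1 \<le> i" "i < m" using snoc.prems by auto
    \<comment> \<open>The new letter, in this order: passes the run unchanged into \<open>u\<close>;
      lengthens the run; cancels its last letter; passes the run with lowered index.\<close>
    consider "i + 2 \<le> k" | "k = Suc i" | "k = i" | j where "k \<le> j" "i = Suc j"
      by (metis Suc_leI add_2_eq_Suc' le_neq_implies_less linorder_not_le not_less_eq_eq
          old.nat.exhaust less_Suc_eq_le not_less_zero)
    then show ?case
    proof cases
      case 1
      then show ?thesis using u k i X Y assms
        by (intro exI[of _ "u @ [i]"] exI[of _ k])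
          (auto simp: mult.assoc X.desc_commute_low Y.desc_commute_low)
    next
      case 2
      then show ?thesis using u k i X Y assms
        by (intro exI[of _ u] exI[of _ i]) (auto simp: mult.assoc X.desc_right Y.desc_right)
    next
      case 3
      then show ?thesis using u k i X Y assms
        by (intro exI[of _ u] exI[of _ "Suc k"])
          (auto simp: mult.assoc X.desc_right Y.desc_right X.square Y.square)
    next
      case 4
      then show ?thesis using u k i X Y assms
        by (intro exI[of _ "u @ [j]"] exI[of _ k])
          (auto simp: mult.assoc X.desc_shift Y.desc_shift)
    qed
  qed
qed

interpretation perm: adjacent_transpositions "\<lambda>i. Endo (transpose i (Suc i))" n
  by standard (auto simp: times_endo_def one_endo_def fun_eq_iff transpose_def)

lemma perm_prod: "perm.prod w = Endo (word_perm w)"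
  by (induction w) (auto simp: times_endo_def one_endo_def)

lemma perm_desc: "k \<le> m \<Longrightarrow> app (perm.desc m k) m = k"
proof (induction m rule: dec_induct)
  case base
  then show ?case by (simp add: perm.desc_refl one_endo_def)
next
  case (step m)
  then show ?case by (simp add: perm.desc_left[OF step.hyps(1)] times_endo_def)
qed

context adjacent_transpositions
begin

text \<open>Completeness of the Coxeter relations. As a permutation, \<open>u\<close> fixes
  \<open>Suc m\<close> and the run sends it to \<open>k\<close>; an identity word therefore forces
  \<open>k = Suc m\<close>. Then the run is empty also in the abstract monoid, and \<open>u\<close>
  involves one point less.\<close>

lemma prod_eq_1:
  assumes "set w \<subseteq> {1..<m}" "m \<le> n" "word_perm w = id"
  shows "prod w = 1"
  using assms
proof (induction m arbitrary: w)
  case 0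
  then show ?case by simp
next
  case (Suc m)
  from coset_decomposition[OF adjacent_transpositions_axioms perm.adjacent_transpositions_axioms
      Suc.prems(1) _ Suc.prems(2)]
  obtain u k where u: "set u \<subseteq> {1..<m}" and k: "k \<le> Suc m"
    and X: "prod w = prod u * desc (Suc m) k"
    and Y: "perm.prod w = perm.prod u * perm.desc (Suc m) k"
    by auto
  have "word_perm u permutes {1..m}" using u by (intro word_perm_permutes)
  then have "word_perm u (Suc m) = Suc m" by (auto simp: permutes_def)
  moreover have "word_perm w = app (perm.desc (Suc m) k) \<circ> word_perm u"
    using Y by (simp add: perm_prod times_endo_def)
  ultimately have km: "k = Suc m" using perm_desc[OF k] Suc.prems(3)
    by (metis comp_apply id_apply)
  then have "perm.prod u = perm.prod w" using Y by (simp add: perm.desc_refl)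
  then have "word_perm u = id" using Suc.prems(3) unfolding perm_prod by (metis endo.inject)
  then show ?case using Suc.IH[OF u] Suc.prems X km by (simp add: desc_refl)
qed

lemma prod_rev: "set w \<subseteq> {1..<n} \<Longrightarrow> prod w * prod (rev w) = 1"
proof (induction w)
  case (Cons i w)
  have "prod (i # w) * prod (rev (i # w)) = T i * (prod w * prod (rev w)) * T i"
    by (simp add: mult.assoc)
  also have "\<dots> = T i * T i" using Cons by (metis mult.right_neutral set_subset_Cons subset_trans)
  finally show ?case using Cons.prems by (simp add: square)
qed simp

lemma prod_cong:
  assumes "set u \<subseteq> {1..<n}" "set v \<subseteq> {1..<n}" "word_perm u = word_perm v"
  shows "prod u = prod v"
proof -
  have "prod (u @ rev v) = 1"
  proof (rule prod_eq_1)
    show "word_perm (u @ rev v) = id"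
      using word_perm_rev[of v] assms by (simp add: word_perm_append)
  qed (use assms in auto)
  then have "prod u * (prod (rev v) * prod v) = prod v" by (simp add: mult.assoc [symmetric])
  then show ?thesis using prod_rev[of "rev v"] assms by simp
qed

text \<open>Any word for \<open>\<pi>\<close> gives the same value, by
  \<open>prod_cong\<close>.\<close>

definition P :: "(nat \<Rightarrow> nat) \<Rightarrow> 'a" where "P \<pi> = prod (perm_word n \<pi>)"

lemma P_word_perm: "set w \<subseteq> {1..<n} \<Longrightarrow> P (word_perm w) = prod w"
  unfolding P_def using word_perm_permutes[of w 1 n] by (intro prod_cong perm_word) auto

lemma P_id [simp]: "P id = 1"
  using P_word_perm[of "[]"] by simp

lemma P_adjacent: "1 \<le> i \<Longrightarrow> i < n \<Longrightarrow> P (transpose i (Suc i)) = T i"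
  using P_word_perm[of "[i]"] by simp

lemma P_comp:
  assumes "\<pi> permutes {1..n}" "\<rho> permutes {1..n}"
  shows "P \<pi> * P \<rho> = P (\<rho> \<circ> \<pi>)"
proof -
  note words = perm_word[OF assms(1)] perm_word[OF assms(2)]
  have "P (word_perm (perm_word n \<pi> @ perm_word n \<rho>)) = P \<pi> * P \<rho>"
    using words by (subst P_word_perm) (auto simp: P_def)
  then show ?thesis using words by (simp only: word_perm_append)
qed

lemma P_inverse:
  assumes "\<pi> permutes {1..n}"
  shows "P \<pi> * P (inv_into UNIV \<pi>) = 1" "P (inv_into UNIV \<pi>) * P \<pi> = 1"
  using assms by (simp_all add: P_comp permutes_inv permutes_inv_o)

end

section \<open>Permutations with prescribed values, and the rotation\<close>

lemma extend_to_permutation: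
  assumes "finite S" "inj_on f A" "A \<subseteq> S" "f ` A \<subseteq> S"
  shows "\<exists>\<pi>. \<pi> permutes S \<and> (\<forall>x\<in>A. \<pi> x = f x)"
proof -
  have "card (S - A) = card (S - f ` A)"
    using assms by (simp add: card_Diff_subset finite_subset card_image)
  then obtain g where g: "bij_betw g (S - A) (S - f ` A)"
    using assms(1) by (metis finite_Diff finite_same_card_bij)
  define \<pi> where "\<pi> x = (if x \<in> A then f x else if x \<in> S then g x else x)" for x
  have "bij_betw \<pi> A (f ` A)" using assms(2) by (simp add: bij_betw_def inj_on_def \<pi>_def)
  moreover have "bij_betw \<pi> (S - A) (S - f ` A)"
    using g by (subst bij_betw_cong[where g = g]) (auto simp: \<pi>_def)
  ultimately have "bij_betw \<pi> (A \<union> (S - A)) (f ` A \<union> (S - f ` A))"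
    by (rule bij_betw_combine) auto
  then have "bij_betw \<pi> S S" using assms by (simp add: Un_absorb1)
  then have "\<pi> permutes S" using assms(3) by (intro bij_imp_permutes) (auto simp: \<pi>_def)
  then show ?thesis by (intro exI[of _ \<pi>]) (auto simp: \<pi>_def)
qed

lemma ex_permutation_list:
  assumes "finite S" "distinct xs" "distinct ys" "length xs = length ys" "set xs \<subseteq> S" "set ys \<subseteq> S"
  shows "\<exists>\<pi>. \<pi> permutes S \<and> map \<pi> xs = ys"
proof -
  define f where "f = the \<circ> map_of (zip xs ys)"
  have nth: "f (xs ! i) = ys ! i" if "i < length xs" for i
    using that assms by (simp add: f_def map_of_zip_nth)
  have "inj_on f (set xs)"
    using assms by (auto simp: inj_on_def in_set_conv_nth nth nth_eq_iff_index_eq)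
  moreover have "f ` set xs \<subseteq> S"
    using assms(4,6) by (force simp: in_set_conv_nth nth)
  ultimately obtain \<pi> where "\<pi> permutes S" "\<forall>x\<in>set xs. \<pi> x = f x"
    using extend_to_permutation[OF assms(1)] assms(5) by blast
  then show ?thesis using assms(4) by (intro exI[of _ \<pi>]) (auto intro!: nth_equalityI simp: nth)
qed

text \<open>The permutation by which \<open>c\<close> acts: 1 goes to \<open>n\<close> and every
  other point goes down by one.\<close>

definition rotation :: "nat \<Rightarrow> nat \<Rightarrow> nat" where
  "rotation n = word_perm [1..<n]"

lemma rotation_permutes: "rotation n permutes {1..n}"
  unfolding rotation_def by (intro word_perm_permutes) auto

lemma rotation_apply:
  "1 \<le> n \<Longrightarrow> rotation n x = (if x = 1 then n else if 1 < x \<and> x \<le> n then x - 1 else x)"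
proof (induction n rule: dec_induct)
  case base
  then show ?case by (simp add: rotation_def)
next
  case (step n)
  then have "rotation (Suc n) x = transpose n (Suc n) (rotation n x)"
    by (simp add: rotation_def word_perm_append)
  with step show ?case by (auto simp: transpose_def)
qed

section \<open>Consequences of the relations\<close>

locale rook_generators =
  fixes n :: nat and s c e q r :: "'a::monoid_mult"
  assumes n_ge: "3 \<le> n"
    and c_order: "c ^ n = 1"
    and sc_order: "(s * c) ^ (n - 1) = 1"
    and s_square: "s * s = 1"
    and s_distant: "2 \<le> i \<Longrightarrow> 2 * i \<le> n \<Longrightarrow> (c ^ i * s * c ^ (n - i) * s)\<^sup>2 = 1"
    and e_idem: "e * e = e"
    and e_q_e: "e * q * e = e"
    and e_r_e: "e * r * e = e"
    and e_sc: "s * c * e * c ^ (n - 1) * s = e"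
    and e_csc: "c * s * c ^ (n - 1) * e * c * s * c ^ (n - 1) = e"
    and q_idem: "q * q = q"
    and q_e_q: "q * e * q = q"
    and q_s: "q * s = q"
    and s_q: "s * q = q"
    and q_cscsc: "c ^ (n - 1) * s * c * s * c ^ (n - 1) * q * c * s * c ^ (n - 1) * s * c = q"
    and q_csc: "4 \<le> n \<Longrightarrow> c\<^sup>2 * s * c ^ (n - 2) * q * c\<^sup>2 * s * c ^ (n - 2) = q"
    and s_e_s_e: "s * e * s * e = e * s * e"
    and e_s_e_s: "e * s * e * s = e * s * e"
    and q_c_q: "q * c * q * c ^ (n - 1) = c * q * c ^ (n - 1) * q"
    and q_cc_q: "q * c\<^sup>2 * q * c ^ (n - 2) = c\<^sup>2 * q * c ^ (n - 2) * q"
    and q_cc_e: "q * c\<^sup>2 * e * c ^ (n - 2) = c\<^sup>2 * e * c ^ (n - 2) * q"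
    and r_idem: "r * r = r"
    and r_e_r: "r * e * r = r"
    and r_sc: "s * c * r * c ^ (n - 1) * s = r"
    and r_csc: "c * s * c ^ (n - 1) * r * c * s * c ^ (n - 1) = r"
    and s_r_s_r: "s * r * s * r = r * s * r"
    and r_s_r_s: "r * s * r * s = r * s * r"
    and r_q: "r * q = r * s * r"
    and q_r: "q * r = r * s * r"
    and q_cc_r: "q * c\<^sup>2 * r * c ^ (n - 2) = c\<^sup>2 * r * c ^ (n - 2) * q"
    and e_s_r_s: "e * s * r * s = s * r * s * e"
begin

section \<open>From the two generators s and c to the Coxeter relations\<close>

definition c' :: 'a where "c' = c ^ (n - 1)"

lemma c_c': "c * c' = 1" and c'_c: "c' * c = 1"
  using c_order n_ge unfolding c'_def
  by (metis One_nat_def Suc_pred' less_le_trans power_Suc power_Suc2 zero_less_numeral)+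

lemma c_c'_assoc [simp]: "c * (c' * x) = x" "c' * (c * x) = x"
  by (simp_all add: mult.assoc[symmetric] c_c' c'_c)

lemma s_s_assoc [simp]: "s * (s * x) = x"
  by (simp add: mult.assoc[symmetric] s_square)

lemma c_c'_power: "c ^ k * c' ^ k = 1"
  by (induction k) (simp_all add: power_Suc2[of c] mult.assoc del: power_Suc, simp add: mult.assoc)

lemma c'_c_power: "c' ^ k * c ^ k = 1"
  by (induction k) (simp_all add: power_Suc2[of c'] mult.assoc del: power_Suc, simp add: mult.assoc)

lemma c'_c_power_assoc [simp]: "c' ^ k * (c ^ k * x) = x" "c ^ k * (c' ^ k * x) = x"
  by (simp_all add: mult.assoc[symmetric] c_c'_power c'_c_power)

lemma c'_power: "k \<le> n \<Longrightarrow> c' ^ k = c ^ (n - k)"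
  by (metis c'_c_power_assoc(1) c_order le_add_diff_inverse mult.right_neutral power_add)

definition cj :: "nat \<Rightarrow> 'a \<Rightarrow> 'a" where "cj k x = c ^ k * x * c' ^ k"

lemma cj_mult: "cj k (x * y) = cj k x * cj k y"
  by (simp add: cj_def mult.assoc)

lemma cj_cj: "cj k (cj l x) = cj (k + l) x"
  by (simp add: cj_def mult.assoc power_add) (simp add: power_add[symmetric] add.commute)

lemma cj_n [simp]: "cj n x = x"
  using c'_power[of n] by (simp add: cj_def c_order)

text \<open>Stands for the transposition of \<open>k + 1\<close> and \<open>k + 2\<close>, read
  modulo \<open>n\<close>; \<open>t (n - 1)\<close> is the one that wraps around. The index is
  shifted by one against \<open>adj\<close>.\<close>

definition t :: "nat \<Rightarrow> 'a" where "t k = cj k s"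

lemma cj_t: "cj k (t l) = t (k + l)"
  by (simp add: t_def cj_cj)

lemma t_0: "t 0 = s"
  by (simp add: t_def cj_def)

lemma t_n: "t n = s"
  by (simp add: t_def)

lemma t_eq: "k \<le> n \<Longrightarrow> t k = c ^ k * s * c ^ (n - k)"
  by (simp add: t_def cj_def c'_power)

lemma t_square: "t k * t k = 1"
  by (simp add: t_def cj_mult[symmetric] s_square) (simp add: cj_def c_c'_power)

lemma t_square_assoc [simp]: "t k * (t k * x) = x"
  by (simp add: mult.assoc[symmetric] t_square)

lemma c_t: "c * t k = t (Suc k) * c"
  by (simp add: t_def cj_def power_Suc2[of c'] mult.assoc c'_c del: power_Suc)
    (simp add: mult.assoc)

text \<open>The relations cover only \<open>2 * k \<le> n\<close>: there \<open>t k * s\<close>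
  squares to 1, and so do both factors, whence they commute. For larger \<open>k\<close>,
  conjugating the case \<open>n - k\<close> by \<open>c ^ k\<close> exchanges the roles, because
  \<open>t n = s\<close>.\<close>

lemma s_t_commute:
  assumes "2 \<le> k" "k + 2 \<le> n"
  shows "t k * s = s * t k"
proof -
  have low: "t k * s = s * t k" if "2 \<le> k" "2 * k \<le> n" for k
  proof -
    have "t k * s * (t k * s) = 1"
      using s_distant[OF that] that by (simp add: t_eq power2_eq_square)
    then have "t k * (t k * (s * (t k * s))) * s = t k * s"
      by (simp add: mult.assoc)
    then show ?thesis by (simp add: mult.assoc s_square)
  qed
  show ?thesis
  proof (cases "2 * k \<le> n")
    case True
    then show ?thesis using low assms by blast
  next
    case False
    then have "t (n - k) * t 0 = t 0 * t (n - k)" using assms by (simp add: low t_0)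
    then have "cj k (t (n - k)) * cj k (t 0) = cj k (t 0) * cj k (t (n - k))"
      by (simp only: cj_mult[symmetric])
    then show ?thesis using assms by (simp add: cj_t t_n)
  qed
qed

lemma t_commute:
  assumes "i + 2 \<le> j" "j + 2 \<le> n + i"
  shows "t i * t j = t j * t i"
proof -
  have "t (j - i) * t 0 = t 0 * t (j - i)" using assms s_t_commute[of "j - i"] by (simp add: t_0)
  then have "cj i (t (j - i)) * cj i (t 0) = cj i (t 0) * cj i (t (j - i))"
    by (simp only: cj_mult[symmetric])
  then show ?thesis using assms by (simp add: cj_t)
qed

text \<open>Each \<open>s\<close> is conjugated by the powers of \<open>c\<close> to its left, so
  that these collect at the right end.\<close>

lemma sc_power: "(s * c) ^ k = prod_list (map t [0..<k]) * c ^ k"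
proof (induction k)
  case (Suc k)
  have "t k * c ^ k = c ^ k * s" by (simp add: t_def cj_def mult.assoc c'_c_power)
  then have "t k * (c ^ k * c) = c ^ k * (s * c)" by (simp add: mult.assoc[symmetric])
  then show ?case using Suc by (simp add: power_Suc2 mult.assoc del: power_Suc)
qed simp

text \<open>This is the content of the relation \<open>(s * c) ^ (n - 1) = 1\<close>: after
  telescoping it says that \<open>c' = c ^ (n - 1)\<close> is inverse to the product of the
  \<open>t k\<close>.\<close>

lemma c_eq: "c = prod_list (map t [0..<n - 1])"
proof -
  have "prod_list (map t [0..<n - 1]) * c' = 1"
    using sc_power[of "n - 1"] sc_order by (simp add: c'_def)
  then have "prod_list (map t [0..<n - 1]) * (c' * c) = c"
    by (simp add: mult.assoc[symmetric])
  then show ?thesis by (simp add: c'_c)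
qed

text \<open>No braid relation is among the defining ones. It is extracted from the factorisation
  \<open>c = t 0 * t 1 * M\<close>, where \<open>M\<close> commutes with \<open>t 0\<close>: the
  equation \<open>c * t 0 = t 1 * c\<close> becomes the braid relation multiplied by the invertible
  element \<open>M\<close>.\<close>

lemma braid_0: "t 0 * t 1 * t 0 = t 1 * t 0 * t 1"
proof -
  define M where "M = prod_list (map t [2..<n - 1])"
  have c: "c = t 0 * t 1 * M"
    using n_ge unfolding M_def by (subst c_eq) (simp add: upt_conv_Cons numeral_2_eq_2 mult.assoc)
  have comm: "M * t 0 = t 0 * M"
  proof -
    have "prod_list (map t ks) * t 0 = t 0 * prod_list (map t ks)" if "set ks \<subseteq> {2..<n - 1}" for ks
      using that
    proof (induction ks)
      case (Cons k ks)
      then show ?case using t_commute[of 0 k] by (auto simp: mult.assoc) (auto simp: mult.assoc[symmetric])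
    qed simp
    then show ?thesis unfolding M_def by simp
  qed
  have M: "M = t 1 * (t 0 * c)" using c by (metis mult.assoc t_square_assoc)
  have inverse: "M * (c' * t 0 * t 1) = 1"
    unfolding M by (simp add: mult.assoc) (simp add: t_square)
  have "t 0 * t 1 * t 0 * M = t 0 * t 1 * M * t 0" by (simp only: comm mult.assoc)
  also have "\<dots> = c * t 0" by (simp only: c[symmetric])
  also have "\<dots> = t 1 * c" using c_t[of 0] by simp
  also have "\<dots> = t 1 * t 0 * t 1 * M" using c by (metis mult.assoc)
  finally have "t 0 * t 1 * t 0 * (M * (c' * t 0 * t 1)) = t 1 * t 0 * t 1 * (M * (c' * t 0 * t 1))"
    by (simp add: mult.assoc[symmetric])
  then show ?thesis unfolding inverse by simp
qed

definition adj :: "nat \<Rightarrow> 'a" where "adj i = t (i - 1)"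

sublocale adjacent_transpositions adj n
proof (unfold_locales, unfold adj_def)
  fix i j :: nat
  show "t (i - 1) * t (i - 1) = 1" by (rule t_square)
  show "t (i - 1) * t (j - 1) = t (j - 1) * t (i - 1)" if "1 \<le> i" "i + 2 \<le> j" "j < n"
    using that by (intro t_commute) auto
  show "t (i - 1) * t (Suc i - 1) * t (i - 1) = t (Suc i - 1) * t (i - 1) * t (Suc i - 1)"
    if "1 \<le> i"
  proof -
    have "cj (i - 1) (t 0 * t 1 * t 0) = cj (i - 1) (t 1 * t 0 * t 1)" using braid_0 by (rule arg_cong)
    moreover have "cj (i - 1) (t 0) = t (i - 1)" "cj (i - 1) (t 1) = t (Suc i - 1)"
      using that by (simp_all add: cj_t)
    ultimately show ?thesis by (metis cj_mult)
  qed
qed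

lemma P_rotation: "P (rotation n) = c"
proof -
  have "P (rotation n) = prod_list (map adj [1..<n])"
    unfolding rotation_def by (subst P_word_perm) (auto simp: prod_def)
  also have "map adj [1..<n] = map t [0..<n - 1]"
    by (rule nth_equalityI) (auto simp: adj_def)
  also have "prod_list \<dots> = c" by (rule c_eq[symmetric])
  finally show ?thesis .
qed

lemma rotation_power_permutes: "(rotation n ^^ k) permutes {1..n}"
proof (induction k)
  case (Suc k)
  then show ?case unfolding funpow.simps by (intro permutes_compose rotation_permutes)
qed (simp add: permutes_id[unfolded id_def])

lemma P_rotation_power: "P (rotation n ^^ k) = c ^ k"
proof (induction k)
  case (Suc k)
  have "P (rotation n ^^ Suc k) = c ^ k * c"
    using P_comp[OF rotation_power_permutes rotation_permutes, of k] Suc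
    unfolding funpow.simps by (simp only: P_rotation)
  also have "\<dots> = c ^ Suc k" by (rule power_Suc2[symmetric])
  finally show ?case .
next
  case 0
  have "rotation n ^^ 0 = id" by (simp add: fun_eq_iff)
  then show ?case using P_id by (simp only: power_0)
qed

lemma P_inv_rotation_power:
  assumes "k \<le> n"
  shows "P (inv_into UNIV (rotation n ^^ k)) = c ^ (n - k)"
proof -
  have "P (inv_into UNIV (rotation n ^^ k)) * (c ^ k * c ^ (n - k)) = c ^ (n - k)"
    using P_inverse(2)[OF rotation_power_permutes, of k]
    unfolding P_rotation_power by (metis mult.assoc mult.left_neutral)
  then show ?thesis using assms by (simp add: power_add[symmetric] c_order)
qed

lemma P_inverse_assoc:
  assumes "\<pi> permutes {1..n}"
  shows "P \<pi> * (P (inv_into UNIV \<pi>) * x) = x" "P (inv_into UNIV \<pi>) * (P \<pi> * x) = x"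
  using P_inverse[OF assms] by (simp_all add: mult.assoc[symmetric])

section \<open>Elements that commute with the stabiliser of points\<close>

lemma P_commute_if_adjacent:
  assumes "\<And>k. a \<le> k \<Longrightarrow> k < n \<Longrightarrow> x * t (k - 1) = t (k - 1) * x"
    and "1 \<le> a" "\<pi> permutes {a..n}"
  shows "x * P \<pi> = P \<pi> * x"
proof -
  from assms(3) have "\<pi> permutes {1..n} \<and> x * P \<pi> = P \<pi> * x"
  proof (induction rule: permutes_adjacent_induct)
    case id
    show ?case unfolding P_id by (simp only: permutes_id mult.left_neutral mult.right_neutral simp_thms)
  next
    case (comp \<sigma> \<tau>)
    then have "P (\<sigma> \<circ> \<tau>) = P \<tau> * P \<sigma>" by (simp only: P_comp)
    moreover have "x * (P \<tau> * P \<sigma>) = P \<tau> * P \<sigma> * x"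
      using comp by (metis mult.assoc)
    ultimately show ?case using comp permutes_compose by metis
  next
    case (swap k)
    then have "P (transpose k (Suc k)) = t (k - 1)"
      using P_adjacent[of k] assms(2) by (simp only: adj_def[symmetric])
    then show ?case using swap assms by (simp add: permutes_swap_id)
  qed
  then show ?thesis by blast
qed

lemma t_1: "t 1 = c * s * c'"
  by (simp add: t_def cj_def)

text \<open>\<open>s * c\<close> is the rotation of \<open>{2..n}\<close>, so that together with the transposition of 2 and 3 it
  generates the stabiliser of 1.\<close>

lemma commutes_with_stabiliser:
  assumes "s * c * x * c ^ (n - 1) * s = x" "c * s * c ^ (n - 1) * x * c * s * c ^ (n - 1) = x"
    and "\<pi> permutes {1..n}" "\<pi> 1 = 1"
  shows "x * P \<pi> = P \<pi> * x"
proof -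
  have sc: "x * (s * c) = s * c * x"
  proof -
    have "x * (s * c) = s * c * x * c' * s * (s * c)" unfolding c'_def assms(1) ..
    also have "\<dots> = s * c * x" by (simp add: mult.assoc c'_c)
    finally show ?thesis .
  qed
  \<comment> \<open>The second hypothesis gives \<open>t 1\<close>. Conjugation by
    \<open>s * c\<close>, which commutes with \<open>x\<close>, carries \<open>t (Suc k)\<close> to
    \<open>t (Suc (Suc k))\<close>.\<close>
  have *: "x * t (Suc k) = t (Suc k) * x" if "k + 3 \<le> n" for k
    using that
  proof (induction k)
    case 0
    have "t 1 * x * t 1 = x" using assms(2) unfolding t_1 c'_def by (simp only: mult.assoc)
    then have "t 1 * (t 1 * x * t 1) = t 1 * x" by simp
    then show ?case by (simp add: mult.assoc)
  next
    case (Suc k)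
    have "s * t (Suc (Suc k)) = t (Suc (Suc k)) * s" using Suc.prems by (intro s_t_commute[symmetric]) auto
    then have eq: "s * c * t (Suc k) = t (Suc (Suc k)) * (s * c)"
      by (metis c_t mult.assoc)
    have "t (Suc (Suc k)) * x * (s * c) = t (Suc (Suc k)) * (s * c) * x"
      by (simp add: mult.assoc sc)
    also have "\<dots> = s * c * t (Suc k) * x" by (simp add: eq)
    also have "\<dots> = s * c * x * t (Suc k)" using Suc by (simp add: mult.assoc)
    also have "\<dots> = x * (s * c * t (Suc k))" unfolding sc[symmetric] by (simp only: mult.assoc)
    also have "\<dots> = x * t (Suc (Suc k)) * (s * c)" unfolding eq by (simp only: mult.assoc)
    finally have "t (Suc (Suc k)) * x * (s * c) * (c' * s) = x * t (Suc (Suc k)) * (s * c) * (c' * s)"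
      by simp
    then show ?case by (simp add: mult.assoc s_square)
  qed
  have "\<pi> permutes {2..n}"
  proof (rule permutes_superset[OF assms(3)])
    fix x assume "x \<in> {1..n} - {2..n}"
    then have "x = 1" by auto
    then show "\<pi> x = x" using assms(4) by simp
  qed
  then show ?thesis
  proof (rule P_commute_if_adjacent[rotated -1])
    fix k :: nat assume "2 \<le> k" "k < n"
    then have "Suc (k - 2) = k - 1" "k - 2 + 3 \<le> n" by simp_all
    then show "x * t (k - 1) = t (k - 1) * x" using *[of "k - 2"] by metis
  qed simp
qed

text \<open>The element \<open>h = t 1 * s * c\<close> fixes 1 and 2 and rotates
  \<open>{3..n}\<close>; the relation \<open>q_cscsc\<close> says that it commutes with
  \<open>q\<close>. For \<open>n \<ge> 4\<close>, \<open>q_csc\<close> gives the same for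
  \<open>t 2\<close>, the transposition of 3 and 4, and conjugation by \<open>h\<close> produces the
  other transpositions of neighbours in \<open>{3..n}\<close>.\<close>

lemma q_commutes_with_stabiliser:
  assumes "\<pi> permutes {1..n}" "\<pi> 1 = 1" "\<pi> 2 = 2"
  shows "q * P \<pi> = P \<pi> * q"
proof -
  define h where "h = c * s * c' * s * c"
  define h' where "h' = c' * s * c * s * c'"
  have hh: "h * h' = 1" "h' * h = 1" by (simp_all add: h_def h'_def mult.assoc c_c' c'_c)
  have "h' * q * h = q" using q_cscsc by (simp add: h_def h'_def c'_def mult.assoc)
  then have qh: "q * h = h * q" by (metis hh(1) mult.assoc mult.left_neutral)
  have *: "q * t (k + 2) = t (k + 2) * q" if "k + 4 \<le> n" for k
    using that
  proof (induction k)
    case 0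
    then have "t 2 * q * t 2 = q" using q_csc by (simp add: t_eq mult.assoc)
    then have "t 2 * (t 2 * q * t 2) = t 2 * q" by simp
    then show ?case by (simp add: mult.assoc numeral_2_eq_2)
  next
    case (Suc k)
    have c1: "s * t (k + 3) = t (k + 3) * s"
      using Suc.prems by (intro s_t_commute[symmetric]) auto
    have c2: "t 1 * t (k + 3) = t (k + 3) * t 1"
      using Suc.prems by (intro t_commute) auto
    have h: "h = t 1 * s * c" by (simp only: h_def t_1)
    have "c * t (k + 2) = t (k + 3) * c" using c_t[of "k + 2"] by (simp add: eval_nat_numeral)
    then have "h * t (k + 2) = t 1 * (s * t (k + 3)) * c" unfolding h by (metis mult.assoc)
    also have "\<dots> = t 1 * t (k + 3) * s * c" unfolding c1 by (simp add: mult.assoc)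
    also have "\<dots> = t (k + 3) * h" unfolding c2 by (simp add: h mult.assoc)
    finally have eq: "h * t (k + 2) = t (k + 3) * h" .
    have "t (k + 3) * q * h = t (k + 3) * h * q" by (simp add: mult.assoc qh)
    also have "\<dots> = h * t (k + 2) * q" by (simp only: eq)
    also have "\<dots> = h * q * t (k + 2)" using Suc.IH Suc.prems by (simp add: mult.assoc)
    also have "\<dots> = q * (h * t (k + 2))" by (simp only: qh[symmetric] mult.assoc)
    also have "\<dots> = q * t (k + 3) * h" unfolding eq by (simp only: mult.assoc)
    finally have "t (k + 3) * q * (h * h') = q * t (k + 3) * (h * h')"
      by (simp add: mult.assoc[symmetric])
    then show ?case by (simp add: hh eval_nat_numeral)
  qed
  have "\<pi> permutes {3..n}"
  proof (rule permutes_superset[OF assms(1)])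
    fix x assume "x \<in> {1..n} - {3..n}"
    then have "x = 1 \<or> x = 2" by auto
    then show "\<pi> x = x" using assms(2,3) by auto
  qed
  then show ?thesis
  proof (rule P_commute_if_adjacent[rotated -1])
    fix k :: nat assume "3 \<le> k" "k < n"
    then have "k - 3 + 2 = k - 1" "k - 3 + 4 \<le> n" by simp_all
    then show "q * t (k - 1) = t (k - 1) * q" using *[of "k - 3"] by metis
  qed simp
qed

end

section \<open>Conjugates of the generators and the action of permutations on them\<close>

definition pair_perm :: "nat \<Rightarrow> nat \<Rightarrow> nat \<Rightarrow> nat \<Rightarrow> nat" where
  "pair_perm n x y = (SOME \<pi>. \<pi> permutes {1..n} \<and> \<pi> 1 = x \<and> \<pi> 2 = y)"

lemma pair_perm:
  assumes "x \<in> {1..n}" "y \<in> {1..n}" "x \<noteq> y"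
  shows "pair_perm n x y permutes {1..n}" "pair_perm n x y 1 = x" "pair_perm n x y 2 = y"
proof -
  have "\<exists>\<pi>. \<pi> permutes {1..n} \<and> map \<pi> [1, 2] = [x, y]"
    using assms by (intro ex_permutation_list) auto
  then have "\<exists>\<pi>. \<pi> permutes {1..n} \<and> \<pi> 1 = x \<and> \<pi> 2 = y" by auto
  from someI_ex[OF this]
  show "pair_perm n x y permutes {1..n}" "pair_perm n x y 1 = x" "pair_perm n x y 2 = y"
    unfolding pair_perm_def by auto
qed

lemma permutes_0: "\<pi> permutes {1..n} \<Longrightarrow> \<pi> 0 = (0::nat)"
  by (auto simp: permutes_def)

context rook_generators
begin

definition conj :: "'a \<Rightarrow> (nat \<Rightarrow> nat) \<Rightarrow> 'a" where
  "conj x \<pi> = P (inv_into UNIV \<pi>) * x * P \<pi>"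

lemma conj_mult: "\<pi> permutes {1..n} \<Longrightarrow> conj (x * y) \<pi> = conj x \<pi> * conj y \<pi>"
  by (simp add: conj_def mult.assoc P_inverse_assoc)

lemma conj_1: "\<pi> permutes {1..n} \<Longrightarrow> conj 1 \<pi> = 1"
  by (simp add: conj_def P_inverse)

lemma conj_id: "conj x id = x"
  by (simp add: conj_def del: id_apply)

lemma conj_conj:
  assumes "\<pi> permutes {1..n}" "\<rho> permutes {1..n}"
  shows "conj (conj x \<rho>) \<pi> = conj x (\<pi> \<circ> \<rho>)"
proof -
  have "inv_into UNIV (\<pi> \<circ> \<rho>) = inv_into UNIV \<rho> \<circ> inv_into UNIV \<pi>"
    using assms by (intro o_inv_distrib permutes_bij)
  then have "P (inv_into UNIV (\<pi> \<circ> \<rho>)) = P (inv_into UNIV \<pi>) * P (inv_into UNIV \<rho>)"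
    using P_comp[OF permutes_inv permutes_inv, OF assms] by (simp only:)
  then show ?thesis using P_comp[OF assms(2,1)] by (simp add: conj_def mult.assoc)
qed

lemma conj_P: "\<pi> permutes {1..n} \<Longrightarrow> P \<pi> * conj x \<pi> = x * P \<pi>"
  by (simp add: conj_def mult.assoc P_inverse_assoc)

text \<open>Two permutations that agree on \<open>F\<close> differ by one that fixes
  \<open>F\<close> pointwise, and this commutes with \<open>x\<close>. With \<open>F\<close> equal
  to \<open>{1}\<close> or \<open>{1, 2}\<close> it makes \<open>E\<close> and \<open>K\<close>
  independent of the permutation chosen.\<close>

lemma conj_cong:
  assumes "\<pi> permutes {1..n}" "\<sigma> permutes {1..n}"
    and "\<And>\<rho>. \<rho> permutes {1..n} \<Longrightarrow> (\<And>i. i \<in> F \<Longrightarrow> \<rho> i = i) \<Longrightarrow> x * P \<rho> = P \<rho> * x"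
    and "\<And>i. i \<in> F \<Longrightarrow> \<pi> i = \<sigma> i"
  shows "conj x \<pi> = conj x \<sigma>"
proof -
  define \<rho> where "\<rho> = inv_into UNIV \<sigma> \<circ> \<pi>"
  have P: "P \<rho> = P \<pi> * P (inv_into UNIV \<sigma>)"
    unfolding \<rho>_def using assms by (intro P_comp[symmetric] permutes_inv)
  have "x * P \<rho> = P \<rho> * x"
  proof (rule assms(3))
    show "\<rho> permutes {1..n}"
      unfolding \<rho>_def using assms by (intro permutes_compose permutes_inv)
    show "\<rho> i = i" if "i \<in> F" for i
      using assms(2,4) that by (simp add: \<rho>_def permutes_inverses)
  qed
  then have "P (inv_into UNIV \<pi>) * (x * P \<rho>) * P \<sigma> = P (inv_into UNIV \<pi>) * (P \<rho> * x) * P \<sigma>"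
    by simp
  then show ?thesis using assms by (simp add: P conj_def mult.assoc P_inverse_assoc P_inverse)
qed

definition E :: "nat \<Rightarrow> 'a" where "E x = conj e (transpose 1 x)"

definition K :: "nat \<Rightarrow> nat \<Rightarrow> 'a" where
  "K x y = (if x = y then 1 else if x = 0 then conj r (transpose 1 y)
     else if y = 0 then conj r (transpose 1 x) else conj q (pair_perm n x y))"

lemma swap_1_permutes: "x \<in> {1..n} \<Longrightarrow> transpose 1 x permutes {1..n}"
  using n_ge by (intro permutes_swap_id) auto

lemma E_eq:
  assumes "\<pi> permutes {1..n}" "\<pi> 1 = x"
  shows "E x = conj e \<pi>"
proof -
  have "x \<in> {1..n}" using assms n_ge permutes_in_image[OF assms(1), of 1] by simp
  then show ?thesis unfolding E_def using assms e_sc e_csc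
    by (intro conj_cong[where F = "{1}"] swap_1_permutes commutes_with_stabiliser) auto
qed

lemma K_0_eq:
  assumes "\<pi> permutes {1..n}" "\<pi> 1 = x"
  shows "K 0 x = conj r \<pi>"
proof -
  have x: "x \<in> {1..n}" using assms n_ge permutes_in_image[OF assms(1), of 1] by simp
  then have "K 0 x = conj r (transpose 1 x)" by (simp add: K_def)
  also have "\<dots> = conj r \<pi>" using x assms r_sc r_csc
    by (intro conj_cong[where F = "{1}"] swap_1_permutes commutes_with_stabiliser) auto
  finally show ?thesis .
qed

lemma K_eq:
  assumes "\<pi> permutes {1..n}" "\<pi> 1 = x" "\<pi> 2 = y"
  shows "K x y = conj q \<pi>"
proof -
  have xy: "x \<in> {1..n}" "y \<in> {1..n}" "x \<noteq> y"
    using assms(2,3) n_ge permutes_in_image[OF assms(1), of 1] permutes_in_image[OF assms(1), of 2]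
      inj_eq[OF permutes_inj[OF assms(1)], of 1 2] by simp_all
  then have "K x y = conj q (pair_perm n x y)" by (simp add: K_def)
  also have "\<dots> = conj q \<pi>" using pair_perm[OF xy] assms
    by (intro conj_cong[where F = "{1, 2}"] q_commutes_with_stabiliser) auto
  finally show ?thesis .
qed

lemma P_swap_12: "P (transpose 1 2) = s"
proof -
  have "P (transpose 1 (Suc 1)) = adj 1" using n_ge by (intro P_adjacent) auto
  moreover have "adj 1 = s" by (simp add: adj_def t_0)
  moreover have "Suc 1 = 2" by simp
  ultimately show ?thesis by (simp only:)
qed

lemma conj_swap_12: "conj x (transpose 1 2) = s * x * s"
  unfolding conj_def inv_transpose_eq P_swap_12 ..

lemma K_refl [simp]: "K x x = 1"
  by (simp add: K_def)

lemma K_commute: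
  assumes "x \<le> n" "y \<le> n"
  shows "K x y = K y x"
proof (cases "x = 0 \<or> y = 0 \<or> x = y")
  case True
  then show ?thesis by (auto simp: K_def)
next
  case False
  then have xy: "x \<in> {1..n}" "y \<in> {1..n}" "x \<noteq> y" using assms by auto
  define \<pi> where "\<pi> = pair_perm n x y"
  have swap: "transpose 1 2 permutes {1..n}" using n_ge by (intro swap_1_permutes) auto
  have "K y x = conj q (\<pi> \<circ> transpose 1 2)"
    unfolding \<pi>_def using pair_perm[OF xy] swap by (intro K_eq permutes_compose) auto
  also have "\<dots> = conj (conj q (transpose 1 2)) \<pi>"
    unfolding \<pi>_def using pair_perm[OF xy] swap by (intro conj_conj[symmetric])
  also have "conj q (transpose 1 2) = q" unfolding conj_swap_12 by (simp add: s_q q_s)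
  finally show ?thesis unfolding \<pi>_def using K_eq[OF pair_perm[OF xy]] by simp
qed

lemma conj_E:
  assumes "\<pi> permutes {1..n}" "x \<in> {1..n}"
  shows "conj (E x) \<pi> = E (\<pi> x)"
proof -
  have "E (\<pi> x) = conj e (\<pi> \<circ> transpose 1 x)"
    using assms swap_1_permutes[of x] by (intro E_eq permutes_compose) auto
  then show ?thesis unfolding E_def using assms swap_1_permutes[of x] by (simp only: conj_conj)
qed

lemma conj_K:
  assumes "\<pi> permutes {1..n}" "x \<le> n" "y \<le> n"
  shows "conj (K x y) \<pi> = K (\<pi> x) (\<pi> y)"
proof -
  have zero: "conj (K 0 y) \<pi> = K 0 (\<pi> y)" if "y \<in> {1..n}" for y
  proof -
    have "K 0 (\<pi> y) = conj r (\<pi> \<circ> transpose 1 y)"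
      using assms swap_1_permutes[OF that] by (intro K_0_eq permutes_compose) auto
    moreover have "K 0 y = conj r (transpose 1 y)"
      using that by (intro K_0_eq swap_1_permutes) auto
    ultimately show ?thesis using assms swap_1_permutes[OF that] by (simp only: conj_conj)
  qed
  have \<pi>: "\<pi> 0 = 0" "\<pi> z \<le> n" if "z \<le> n" for z
    using assms(1) that permutes_in_image[OF assms(1), of z] permutes_0[OF assms(1)]
    by (cases "z = 0"; auto)+
  consider "x = y" | "x \<noteq> y" "x = 0" | "x \<noteq> y" "y = 0" | "x \<noteq> y" "x \<noteq> 0" "y \<noteq> 0" by blast
  then show ?thesis
  proof cases
    case 1
    then show ?thesis using assms by (simp add: conj_1)
  next
    case 2
    then show ?thesis using assms zero[of y] \<pi> by simp
  next
    case 3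
    then show ?thesis using assms zero[of x] \<pi> K_commute by simp
  next
    case 4
    then have xy: "x \<in> {1..n}" "y \<in> {1..n}" using assms by auto
    note pp = pair_perm[OF xy 4(1)]
    have "K (\<pi> x) (\<pi> y) = conj q (\<pi> \<circ> pair_perm n x y)"
      using assms pp by (intro K_eq permutes_compose) auto
    moreover have "K x y = conj q (pair_perm n x y)" using pp by (intro K_eq) auto
    ultimately show ?thesis using assms pp by (simp only: conj_conj)
  qed
qed

lemma E_1: "E 1 = e"
  using E_eq[OF permutes_id id_apply] by (simp only: conj_id)

lemma K_0_1: "K 0 1 = r"
  using K_0_eq[OF permutes_id id_apply] by (simp only: conj_id)

lemma K_1_2: "K 1 2 = q"
  using K_eq[OF permutes_id id_apply id_apply] by (simp only: conj_id)

text \<open>Conjugates occur in the relations in the shape \<open>c ^ k * x * c ^ (n - k)\<close>.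
  Since \<open>c\<close> lowers points, this is conjugation by the inverse rotation, which raises 1
  to \<open>k + 1\<close> for \<open>k < n\<close>.\<close>

lemma conj_inv_rotation_power:
  assumes "k \<le> n"
  shows "conj x (inv_into UNIV (rotation n ^^ k)) = c ^ k * x * c ^ (n - k)"
proof -
  have "inv_into UNIV (inv_into UNIV (rotation n ^^ k)) = rotation n ^^ k"
    by (rule permutes_inv_inv[OF rotation_power_permutes])
  then show ?thesis
    unfolding conj_def by (simp only: P_rotation_power P_inv_rotation_power[OF assms])
qed

lemma inv_rotation_power_eq:
  assumes "(rotation n ^^ k) y = x"
  shows "inv_into UNIV (rotation n ^^ k) x = y"
  using assms rotation_power_permutes[of k] by (metis permutes_inverses(2))

lemma rotation_values:
  "(rotation n ^^ 1) 2 = 1" "(rotation n ^^ 1) 3 = 2" "(rotation n ^^ 2) 3 = 1"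
  "4 \<le> n \<Longrightarrow> (rotation n ^^ 2) 4 = 2" "n = 3 \<Longrightarrow> (rotation n ^^ 2) 1 = 2"
  using n_ge by (auto simp: rotation_apply eval_nat_numeral)

lemma swap_12_permutes: "transpose 1 2 permutes {1..n}"
  using n_ge by (intro swap_1_permutes) auto

lemma E_2: "s * e * s = E 2"
  using conj_E[OF swap_12_permutes, of 1] n_ge
  unfolding E_1 conj_swap_12 transpose_apply_first by simp

lemma K_0_2: "s * r * s = K 0 2"
  using conj_K[OF swap_12_permutes, of 0 1] n_ge
  unfolding K_0_1 conj_swap_12 transpose_apply_first permutes_0[OF swap_12_permutes] by simp

lemma conj_c:
  assumes "k \<le> n"
  shows "c ^ k * x * c ^ (n - k) = conj x (inv_into UNIV (rotation n ^^ k))"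
    "inv_into UNIV (rotation n ^^ k) permutes {1..n}"
  using conj_inv_rotation_power[OF assms] rotation_power_permutes by (auto intro: permutes_inv)

lemma K_2_3: "c * q * c ^ (n - 1) = K 2 3"
proof -
  have "c * q * c ^ (n - 1) = conj (K 1 2) (inv_into UNIV (rotation n ^^ 1))"
    using conj_c(1)[of 1 q] n_ge unfolding K_1_2 by (simp only: power_one_right)
  also have "\<dots> = K (inv_into UNIV (rotation n ^^ 1) 1) (inv_into UNIV (rotation n ^^ 1) 2)"
    using n_ge by (intro conj_K conj_c(2)) auto
  finally show ?thesis
    using rotation_values inv_rotation_power_eq by (simp only:)
qed

lemma E_3: "c\<^sup>2 * e * c ^ (n - 2) = E 3"
proof -
  have "c\<^sup>2 * e * c ^ (n - 2) = conj (E 1) (inv_into UNIV (rotation n ^^ 2))"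
    using conj_c(1)[of 2 e] n_ge unfolding E_1 by auto
  also have "\<dots> = E (inv_into UNIV (rotation n ^^ 2) 1)"
    using n_ge by (intro conj_E conj_c(2)) auto
  finally show ?thesis using rotation_values inv_rotation_power_eq by (simp only:)
qed

lemma K_0_3: "c\<^sup>2 * r * c ^ (n - 2) = K 0 3"
proof -
  have "c\<^sup>2 * r * c ^ (n - 2) = conj (K 0 1) (inv_into UNIV (rotation n ^^ 2))"
    using conj_c(1)[of 2 r] n_ge unfolding K_0_1 by auto
  also have "\<dots> = K (inv_into UNIV (rotation n ^^ 2) 0) (inv_into UNIV (rotation n ^^ 2) 1)"
    using n_ge by (intro conj_K conj_c(2)) auto
  also have "inv_into UNIV (rotation n ^^ 2) 0 = 0"
    using n_ge by (intro permutes_0[OF conj_c(2)]) auto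
  finally show ?thesis using rotation_values inv_rotation_power_eq by (simp only:)
qed

lemma K_3_4:
  assumes "4 \<le> n"
  shows "c\<^sup>2 * q * c ^ (n - 2) = K 3 4"
proof -
  have "c\<^sup>2 * q * c ^ (n - 2) = conj (K 1 2) (inv_into UNIV (rotation n ^^ 2))"
    using conj_c(1)[of 2 q] n_ge unfolding K_1_2 by auto
  also have "\<dots> = K (inv_into UNIV (rotation n ^^ 2) 1) (inv_into UNIV (rotation n ^^ 2) 2)"
    using n_ge by (intro conj_K conj_c(2)) auto
  finally show ?thesis
    using rotation_values(3) rotation_values(4)[OF assms] inv_rotation_power_eq by (simp only:)
qed

lemma transpose_conj:
  assumes "\<pi> permutes {1..n}" "\<rho> permutes {1..n}"
  shows "conj (P \<rho>) \<pi> = P (\<pi> \<circ> \<rho> \<circ> inv_into UNIV \<pi>)"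
proof -
  have "P (inv_into UNIV \<pi>) * P \<rho> = P (\<rho> \<circ> inv_into UNIV \<pi>)"
    using assms by (intro P_comp permutes_inv)
  moreover have "P (\<rho> \<circ> inv_into UNIV \<pi>) * P \<pi> = P (\<pi> \<circ> (\<rho> \<circ> inv_into UNIV \<pi>))"
    using assms by (intro P_comp permutes_inv permutes_compose)
  ultimately show ?thesis unfolding conj_def comp_assoc by (simp only:)
qed

lemma conj_swap:
  assumes "\<pi> permutes {1..n}" "x \<in> {1..n}" "y \<in> {1..n}"
  shows "conj (P (transpose x y)) \<pi> = P (transpose (\<pi> x) (\<pi> y))"
proof -
  have "\<pi> \<circ> transpose x y \<circ> inv_into UNIV \<pi> = transpose (\<pi> x) (\<pi> y)"
  proof
    fix z
    obtain w where w: "z = \<pi> w" using permutes_surj[OF assms(1)] by auto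
    show "(\<pi> \<circ> transpose x y \<circ> inv_into UNIV \<pi>) z = transpose (\<pi> x) (\<pi> y) z"
      unfolding w using inj_eq[OF permutes_inj[OF assms(1)]]
      by (simp add: permutes_inverses(2)[OF assms(1)] transpose_def)
  qed
  then show ?thesis
    using transpose_conj[OF assms(1) permutes_swap_id[OF assms(2,3)]] by (simp only:)
qed

lemma P_K:
  assumes "\<pi> permutes {1..n}" "x \<le> n" "y \<le> n"
  shows "P \<pi> * K (\<pi> x) (\<pi> y) = K x y * P \<pi>"
  using conj_P[OF assms(1), of "K x y"] unfolding conj_K[OF assms] .

lemma P_E:
  assumes "\<pi> permutes {1..n}" "x \<in> {1..n}"
  shows "P \<pi> * E (\<pi> x) = E x * P \<pi>"
  using conj_P[OF assms(1), of "E x"] unfolding conj_E[OF assms] .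

lemma point_perm:
  assumes "x \<in> {1..n}"
  obtains \<pi> where "\<pi> permutes {1..n}" "\<pi> 1 = x"
  using that swap_1_permutes[OF assms] transpose_apply_first by metis

lemma triple_perm:
  assumes "x \<in> {1..n}" "y \<in> {1..n}" "z \<in> {1..n}" "distinct [x, y, z]"
  obtains \<pi> where "\<pi> permutes {1..n}" "\<pi> 1 = x" "\<pi> 2 = y" "\<pi> 3 = z"
proof -
  have "\<exists>\<pi>. \<pi> permutes {1..n} \<and> map \<pi> [1, 2, 3] = [x, y, z]"
    using assms n_ge by (intro ex_permutation_list) auto
  then show ?thesis using that by auto
qed

lemma quadruple_perm:
  assumes "x \<in> {1..n}" "y \<in> {1..n}" "z \<in> {1..n}" "w \<in> {1..n}" "distinct [x, y, z, w]"
  obtains \<pi> where "\<pi> permutes {1..n}" "\<pi> 1 = x" "\<pi> 2 = y" "\<pi> 3 = z" "\<pi> 4 = w" "4 \<le> n"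
proof -
  have "card {x, y, z, w} \<le> card {1..n}" using assms by (intro card_mono) auto
  then have n: "4 \<le> n" using assms(5) by simp
  then have "\<exists>\<pi>. \<pi> permutes {1..n} \<and> map \<pi> [1, 2, 3, 4] = [x, y, z, w]"
    using assms by (intro ex_permutation_list) auto
  then show ?thesis using that n by auto
qed

text \<open>The defining relations, read as statements about \<open>E\<close> and \<open>K\<close>
  at the points 0, 1, 2, 3. The laws at arbitrary points arise from these and \<open>base_K\<close>
  by conjugation with a suitable permutation.\<close>

lemma base_E:
  "E 1 * E 1 = E 1" "E 1 * E 2 = E 2 * E 1" "E 1 * E 2 * P (transpose 1 2) = E 1 * E 2"
  "E 3 * K 1 2 = K 1 2 * E 3" "E 1 * K 0 2 = K 0 2 * E 1"
  "E 1 * K 1 2 * E 1 = E 1" "E 1 * K 0 1 * E 1 = E 1"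
  "K 1 2 * E 1 * K 1 2 = K 1 2" "K 0 1 * E 1 * K 0 1 = K 0 1"
  unfolding E_1 E_2[symmetric] E_3[symmetric] K_1_2 K_0_1 K_0_2[symmetric] P_swap_12
  using e_idem s_e_s_e e_s_e_s q_cc_e e_s_r_s e_q_e e_r_e q_e_q r_e_r
  by (simp_all add: mult.assoc s_square)

lemma base_K:
  "K 1 2 * K 1 2 = K 1 2" "K 0 1 * K 0 1 = K 0 1" "K 1 2 * P (transpose 1 2) = K 1 2"
  "K 0 1 * K 1 2 = K 0 1 * K 0 2" "K 1 2 * K 0 1 = K 0 1 * K 0 2" "K 0 2 * K 0 1 = K 0 1 * K 0 2"
  "K 1 2 * K 0 2 = K 0 1 * K 0 2" "K 1 2 * K 2 3 = K 2 3 * K 1 2"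
  "K 1 2 * K 0 3 = K 0 3 * K 1 2"
  unfolding K_1_2 K_0_1 K_0_2[symmetric] K_2_3[symmetric] K_0_3[symmetric] P_swap_12
proof -
  show "q * q = q" "r * r = r" "q * s = q" by (rule q_idem r_idem q_s)+
  have rsrs: "r * (s * r * s) = r * s * r" using r_s_r_s by (simp add: mult.assoc)
  show "r * q = r * (s * r * s)" unfolding rsrs by (rule r_q)
  show "q * r = r * (s * r * s)" unfolding rsrs by (rule q_r)
  show "s * r * s * r = r * (s * r * s)" unfolding rsrs by (rule s_r_s_r)
  have "q * (s * r * s) = q * s * r * s" by (simp add: mult.assoc)
  also have "\<dots> = r * s * r * s" by (simp only: q_s q_r)
  finally show "q * (s * r * s) = r * (s * r * s)" by (simp add: mult.assoc)
  show "q * (c * q * c ^ (n - 1)) = c * q * c ^ (n - 1) * q" using q_c_q by (simp only: mult.assoc)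
  show "q * (c\<^sup>2 * r * c ^ (n - 2)) = c\<^sup>2 * r * c ^ (n - 2) * q"
    using q_cc_r by (simp only: mult.assoc)
qed

lemma base_K_3_4: "4 \<le> n \<Longrightarrow> K 1 2 * K 3 4 = K 3 4 * K 1 2"
  using q_cc_q unfolding K_1_2 K_3_4[symmetric] by (simp only: mult.assoc)

section \<open>The laws for E and K at arbitrary points\<close>

lemma pair_0_laws:
  assumes "x \<in> {1..n}" "y \<in> {1..n}" "x \<noteq> y"
  shows "K 0 x * K x y = K 0 x * K 0 y" "K x y * K 0 x = K 0 x * K 0 y"
    "K 0 y * K 0 x = K 0 x * K 0 y" "K x y * K 0 y = K 0 x * K 0 y"
proof -
  note pp = pair_perm[OF assms]
  have eqs: "K 0 x = conj (K 0 1) (pair_perm n x y)" "K 0 y = conj (K 0 2) (pair_perm n x y)"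
    "K x y = conj (K 1 2) (pair_perm n x y)"
    using pp n_ge by (simp_all add: conj_K permutes_0[OF pp(1)])
  show "K 0 x * K x y = K 0 x * K 0 y" "K x y * K 0 x = K 0 x * K 0 y"
    "K 0 y * K 0 x = K 0 x * K 0 y" "K x y * K 0 y = K 0 x * K 0 y"
    unfolding eqs conj_mult[OF pp(1), symmetric] base_K(4-7) by (rule refl)+
qed

lemma K_idem:
  assumes "x \<le> n" "y \<le> n"
  shows "K x y * K x y = K x y"
proof -
  have zero: "K 0 x * K 0 x = K 0 x" if x: "x \<in> {1..n}" for x
  proof -
    obtain \<pi> where \<pi>: "\<pi> permutes {1..n}" "\<pi> 1 = x" using point_perm[OF x] .
    have eq: "K 0 x = conj (K 0 1) \<pi>" using \<pi> n_ge by (simp add: conj_K permutes_0[OF \<pi>(1)])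
    show ?thesis unfolding eq conj_mult[OF \<pi>(1), symmetric] base_K(2) ..
  qed
  consider "x = y" | "x \<noteq> y" "x = 0" | "x \<noteq> y" "y = 0" | "x \<noteq> y" "x \<noteq> 0" "y \<noteq> 0" by blast
  then show ?thesis
  proof cases
    case 2
    then show ?thesis using assms zero[of y] by simp
  next
    case 3
    then show ?thesis using assms zero[of x] K_commute by simp
  next
    case 4
    then have "x \<in> {1..n}" "y \<in> {1..n}" using assms by auto
    note pp = pair_perm[OF this 4(1)]
    have eq: "K x y = conj (K 1 2) (pair_perm n x y)" using pp n_ge by (simp add: conj_K)
    show ?thesis unfolding eq conj_mult[OF pp(1), symmetric] base_K(1) ..
  qed simp
qed

lemma triple_laws:
  assumes "x \<in> {1..n}" "y \<in> {1..n}" "z \<in> {1..n}" "distinct [x, y, z]"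
  shows "K x y * K y z = K y z * K x y" "K x y * K 0 z = K 0 z * K x y" "E z * K x y = K x y * E z"
proof -
  obtain \<pi> where \<pi>: "\<pi> permutes {1..n}" "\<pi> 1 = x" "\<pi> 2 = y" "\<pi> 3 = z"
    using triple_perm[OF assms] .
  have eqs: "K x y = conj (K 1 2) \<pi>" "K y z = conj (K 2 3) \<pi>" "K 0 z = conj (K 0 3) \<pi>"
    "E z = conj (E 3) \<pi>"
    using \<pi> n_ge by (simp_all add: conj_K conj_E permutes_0[OF \<pi>(1)])
  show "K x y * K y z = K y z * K x y" "K x y * K 0 z = K 0 z * K x y" "E z * K x y = K x y * E z"
    unfolding eqs conj_mult[OF \<pi>(1), symmetric] base_K(8,9) base_E(4) by (rule refl)+
qed

lemma quadruple_law:
  assumes "x \<in> {1..n}" "y \<in> {1..n}" "z \<in> {1..n}" "w \<in> {1..n}" "distinct [x, y, z, w]"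
  shows "K x y * K z w = K z w * K x y"
proof -
  obtain \<pi> where \<pi>: "\<pi> permutes {1..n}" "\<pi> 1 = x" "\<pi> 2 = y" "\<pi> 3 = z" "\<pi> 4 = w" "4 \<le> n"
    using quadruple_perm[OF assms] .
  have eqs: "K x y = conj (K 1 2) \<pi>" "K z w = conj (K 3 4) \<pi>"
    using \<pi> by (simp_all add: conj_K)
  show ?thesis unfolding eqs conj_mult[OF \<pi>(1), symmetric] base_K_3_4[OF \<pi>(6)] ..
qed

lemma K_cases:
  assumes "x \<le> n" "y \<le> n"
  obtains "x = y" | u where "u \<in> {1..n}" "K x y = K 0 u"
  | "x \<in> {1..n}" "y \<in> {1..n}" "x \<noteq> y"
proof -
  consider "x = y" | "x \<noteq> y" "x = 0" | "x \<noteq> y" "y = 0" | "x \<noteq> y" "x \<noteq> 0" "y \<noteq> 0" by blast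
  then show ?thesis
  proof cases
    case 1
    then show ?thesis using that by blast
  next
    case 2
    then show ?thesis using that(2)[of y] assms by simp
  next
    case 3
    then show ?thesis using that(2)[of x] assms K_commute by simp
  next
    case 4
    then show ?thesis using that(3) assms by simp
  qed
qed

lemma K_K_commute:
  assumes "x \<le> n" "y \<le> n" "z \<le> n" "w \<le> n"
  shows "K x y * K z w = K z w * K x y"
proof -
  have zero_zero: "K 0 u * K 0 v = K 0 v * K 0 u" if "u \<in> {1..n}" "v \<in> {1..n}" for u v
    using that pair_0_laws(3) by metis
  have zero: "K 0 u * K x y = K x y * K 0 u"
    if "u \<in> {1..n}" "x \<in> {1..n}" "y \<in> {1..n}" "x \<noteq> y" for u x y
  proof -
    have le: "x \<le> n" "y \<le> n" using that by auto
    have "K 0 x * K x y = K x y * K 0 x" if "x \<in> {1..n}" "y \<in> {1..n}" "x \<noteq> y" for x y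
      using that pair_0_laws by metis
    then show ?thesis using that triple_laws(2)[of x y u] K_commute[OF le]
      by (cases "u = x"; cases "u = y") (metis, metis, metis, force)
  qed
  from assms(1,2) show ?thesis
  proof (cases rule: K_cases)
    case 1
    then show ?thesis by simp
  next
    case xy: (2 u)
    from assms(3,4) show ?thesis
    proof (cases rule: K_cases)
      case 1
      then show ?thesis by simp
    next
      case (2 v)
      then show ?thesis using xy zero_zero by simp
    next
      case 3
      then show ?thesis using xy zero by simp
    qed
  next
    case xy: 3
    from assms(3,4) show ?thesis
    proof (cases rule: K_cases)
      case 1
      then show ?thesis by simp
    next
      case (2 v)
      then show ?thesis using xy zero by simp
    next
      case zw: 3
      consider "{x, y} = {z, w}" | "x = z" "y \<noteq> w" | "x = w" "y \<noteq> z" | "y = z" "x \<noteq> w"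
        | "y = w" "x \<noteq> z" | "distinct [x, y, z, w]"
        using xy(3) zw(3) by fastforce
      then show ?thesis
      proof cases
        case 1
        then have "K x y = K z w" using K_commute[OF assms(1,2)] by (auto simp: doubleton_eq_iff)
        then show ?thesis by simp
      next
        case 2
        then show ?thesis using triple_laws(1)[of y x w] xy zw K_commute[OF assms(1,2)] by auto
      next
        case 3
        then show ?thesis using triple_laws(1)[of y x z] xy zw K_commute[OF assms(1,2)]
            K_commute[OF assms(3,4)] by auto
      next
        case 4
        then show ?thesis using triple_laws(1)[of x y w] xy zw by auto
      next
        case 5
        then show ?thesis using triple_laws(1)[of x y z] xy zw K_commute[OF assms(3,4)] by auto
      next
        case 6
        then show ?thesis using quadruple_law xy zw by blast
      qed
    qed
  qed
qed

lemma K_swap: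
  assumes "x \<in> {1..n}" "y \<in> {1..n}"
  shows "K x y * P (transpose x y) = K x y"
proof (cases "x = y")
  case True
  then show ?thesis using P_id by (simp add: id_def)
next
  case False
  note pp = pair_perm[OF assms False]
  have eqs: "P (transpose x y) = conj (P (transpose 1 2)) (pair_perm n x y)"
    "K x y = conj (K 1 2) (pair_perm n x y)"
    using conj_swap[OF pp(1), of 1 2] pp n_ge by (simp_all add: conj_K)
  show ?thesis unfolding eqs conj_mult[OF pp(1), symmetric] base_K(3) ..
qed

text \<open>With 0 involved this is \<open>pair_0_laws\<close>. For three other points it comes from
  absorption: \<open>K x y\<close> swallows the transposition of \<open>x\<close> and
  \<open>y\<close>, which on its way turns \<open>K y z\<close> into \<open>K x z\<close>.\<close>

lemma K_triangle:
  assumes "x \<le> n" "y \<le> n" "z \<le> n"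
  shows "K x y * K y z = K x y * K x z"
proof -
  consider "x = y" | "y = z" | "x = z" | "x = 0" "y \<in> {1..n}" "z \<in> {1..n}" "y \<noteq> z"
    | "y = 0" "x \<in> {1..n}" "z \<in> {1..n}" "x \<noteq> z" | "z = 0" "x \<in> {1..n}" "y \<in> {1..n}" "x \<noteq> y"
    | "x \<in> {1..n}" "y \<in> {1..n}" "z \<in> {1..n}" "distinct [x, y, z]"
    using assms by (cases "x = 0"; cases "y = 0"; cases "z = 0") auto
  then show ?thesis
  proof cases
    case 1
    then show ?thesis by simp
  next
    case 2
    then show ?thesis using assms K_idem by simp
  next
    case 3
    then show ?thesis using assms K_idem K_commute by simp
  next
    case 4
    then show ?thesis using pair_0_laws by metis
  next
    case 5
    then have "K x 0 = K 0 x" using assms K_commute by blast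
    then show ?thesis using 5 pair_0_laws[of x z] by simp
  next
    case 6
    then have "K x 0 = K 0 x" "K y 0 = K 0 y" using assms K_commute by blast+
    then show ?thesis using 6 pair_0_laws[of x y] by simp
  next
    case 7
    have sw: "transpose x y permutes {1..n}" using 7 by (intro permutes_swap_id)
    have eq: "P (transpose x y) * K y z = K x z * P (transpose x y)"
      using P_K[OF sw, of x z] 7 by (simp add: transpose_def)
    have "K x y * K y z = K x y * (P (transpose x y) * K y z)"
      using K_swap[of x y] 7 by (simp add: mult.assoc[symmetric])
    also have "\<dots> = K x y * K x z * P (transpose x y)" by (simp only: eq mult.assoc)
    also have "\<dots> = K x z * (K x y * P (transpose x y))"
      using K_K_commute[OF assms(1,2,1,3)] by (simp add: mult.assoc)
    also have "\<dots> = K x y * K x z" using K_swap[of x y] 7 K_K_commute[OF assms(1,2,1,3)] by simp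
    finally show ?thesis .
  qed
qed

lemma E_idem:
  assumes "x \<in> {1..n}"
  shows "E x * E x = E x"
proof -
  obtain \<pi> where \<pi>: "\<pi> permutes {1..n}" "\<pi> 1 = x" using point_perm[OF assms] .
  have eq: "E x = conj (E 1) \<pi>" using \<pi> n_ge by (simp add: conj_E)
  show ?thesis unfolding eq conj_mult[OF \<pi>(1), symmetric] base_E(1) ..
qed

lemma E_E_commute:
  assumes "x \<in> {1..n}" "y \<in> {1..n}"
  shows "E x * E y = E y * E x"
proof (cases "x = y")
  case False
  note pp = pair_perm[OF assms False]
  have eqs: "E x = conj (E 1) (pair_perm n x y)" "E y = conj (E 2) (pair_perm n x y)"
    using pp n_ge by (simp_all add: conj_E)
  show ?thesis unfolding eqs conj_mult[OF pp(1), symmetric] base_E(2) ..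
qed simp

lemma E_E_swap:
  assumes "x \<in> {1..n}" "y \<in> {1..n}"
  shows "E x * E y * P (transpose x y) = E x * E y"
proof (cases "x = y")
  case True
  then show ?thesis using P_id by (simp add: id_def)
next
  case False
  note pp = pair_perm[OF assms False]
  have eqs: "P (transpose x y) = conj (P (transpose 1 2)) (pair_perm n x y)"
    "E x = conj (E 1) (pair_perm n x y)" "E y = conj (E 2) (pair_perm n x y)"
    using conj_swap[OF pp(1), of 1 2] pp n_ge by (simp_all add: conj_E)
  show ?thesis unfolding eqs conj_mult[OF pp(1), symmetric] base_E(3) ..
qed

lemma E_K_commute:
  assumes "x \<in> {1..n}" "y \<le> n" "z \<le> n" "x \<noteq> y" "x \<noteq> z"
  shows "E x * K y z = K y z * E x"
proof -
  have zero: "E x * K 0 u = K 0 u * E x" if "u \<in> {1..n}" "x \<noteq> u" for u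
  proof -
    note pp = pair_perm[OF assms(1) that]
    have eqs: "E x = conj (E 1) (pair_perm n x u)" "K 0 u = conj (K 0 2) (pair_perm n x u)"
      using pp n_ge by (simp_all add: conj_E conj_K permutes_0[OF pp(1)])
    show ?thesis unfolding eqs conj_mult[OF pp(1), symmetric] base_E(5) ..
  qed
  consider "y = z" | "y = 0" "z \<in> {1..n}" | "z = 0" "y \<in> {1..n}"
    | "y \<in> {1..n}" "z \<in> {1..n}" "y \<noteq> z"
    using assms by (cases "y = 0"; cases "z = 0") auto
  then show ?thesis
  proof cases
    case 3
    then show ?thesis using zero[of y] K_commute[OF assms(2,3)] assms by simp
  next
    case 4
    then show ?thesis using triple_laws(3)[of y z x] assms by simp
  qed (use zero assms in simp_all)
qed

lemma E_K_E_and_K_E_K: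
  assumes "x \<in> {1..n}" "y \<le> n" "x \<noteq> y"
  shows "E x * K x y * E x = E x \<and> K x y * E x * K x y = K x y"
proof (cases "y = 0")
  case True
  obtain \<pi> where \<pi>: "\<pi> permutes {1..n}" "\<pi> 1 = x" using point_perm[OF assms(1)] .
  have "K x y = K 0 x" using True K_commute[of x y] assms by simp
  moreover have "K 0 x = conj (K 0 1) \<pi>" using \<pi> n_ge by (simp add: conj_K permutes_0[OF \<pi>(1)])
  ultimately have eqs: "E x = conj (E 1) \<pi>" "K x y = conj (K 0 1) \<pi>"
    using \<pi> n_ge by (simp_all add: conj_E)
  show ?thesis unfolding eqs conj_mult[OF \<pi>(1), symmetric] base_E(7,9) by simp
next
  case False
  then have y: "y \<in> {1..n}" using assms by simp
  note pp = pair_perm[OF assms(1) y assms(3)]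
  have eqs: "E x = conj (E 1) (pair_perm n x y)" "K x y = conj (K 1 2) (pair_perm n x y)"
    using pp n_ge by (simp_all add: conj_E conj_K)
  show ?thesis unfolding eqs conj_mult[OF pp(1), symmetric] base_E(6,8) by simp
qed

lemmas E_K_E = E_K_E_and_K_E_K[THEN conjunct1] and K_E_K = E_K_E_and_K_E_K[THEN conjunct2]

end

section \<open>Normal forms\<close>

locale commuting_idempotents =
  fixes f :: "'i \<Rightarrow> 'a::monoid_mult" and S :: "'i set"
  assumes finite_index: "finite S"
    and idem: "i \<in> S \<Longrightarrow> f i * f i = f i"
    and commute: "i \<in> S \<Longrightarrow> j \<in> S \<Longrightarrow> f i * f j = f j * f i"
begin

abbreviation list_product :: "'i list \<Rightarrow> 'a" where "list_product xs \<equiv> prod_list (map f xs)"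

lemma list_commute: "x \<in> S \<Longrightarrow> set xs \<subseteq> S \<Longrightarrow> f x * list_product xs = list_product xs * f x"
proof (induction xs)
  case (Cons y xs)
  have "f x * (f y * list_product xs) = f y * (f x * list_product xs)"
    using Cons.prems commute[of x y] by (simp add: mult.assoc[symmetric])
  then show ?case using Cons by (simp add: mult.assoc)
qed simp

lemma list_absorb: "x \<in> set xs \<Longrightarrow> set xs \<subseteq> S \<Longrightarrow> f x * list_product xs = list_product xs"
proof (induction xs)
  case (Cons y xs)
  show ?case
  proof (cases "x = y")
    case True
    then show ?thesis using Cons.prems by (simp add: mult.assoc[symmetric] idem)
  next
    case False
    have "x \<in> S" "y \<in> S" using Cons.prems by auto
    then have "f x * (f y * list_product xs) = f y * (f x * list_product xs)"
      using commute[of x y] by (simp add: mult.assoc[symmetric])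
    then show ?thesis using Cons False by simp
  qed
qed simp

lemma list_absorb_list:
  "set ys \<subseteq> set xs \<Longrightarrow> set xs \<subseteq> S \<Longrightarrow> list_product ys * list_product xs = list_product xs"
  by (induction ys) (auto simp: mult.assoc list_absorb)

lemma list_commute_list:
  "set ys \<subseteq> S \<Longrightarrow> set xs \<subseteq> S \<Longrightarrow> list_product ys * list_product xs = list_product xs * list_product ys"
proof (induction ys)
  case (Cons y ys)
  then have "list_product (y # ys) * list_product xs = f y * list_product xs * list_product ys"
    by (simp add: mult.assoc)
  also have "f y * list_product xs = list_product xs * f y"
    using Cons.prems by (intro list_commute) auto
  finally show ?case by (simp add: mult.assoc)
qed simp

lemma list_cong:
  assumes "set xs = set ys" "set xs \<subseteq> S"
  shows "list_product xs = list_product ys"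
proof -
  have "list_product xs = list_product ys * list_product xs"
    using assms by (intro list_absorb_list[symmetric]) auto
  also have "\<dots> = list_product xs * list_product ys"
    using assms by (intro list_commute_list) auto
  also have "\<dots> = list_product ys"
    using assms by (intro list_absorb_list) auto
  finally show ?thesis .
qed

text \<open>The chosen list may have repetitions; idempotence makes them harmless and commutativity
  removes the dependence on the order.\<close>

definition big :: "'i set \<Rightarrow> 'a" where "big A = list_product (SOME xs. set xs = A)"

lemma big_set:
  assumes "set xs \<subseteq> S"
  shows "big (set xs) = list_product xs"
proof -
  have "set (SOME ys. set ys = set xs) = set xs" by (rule someI_ex) blast
  then show ?thesis unfolding big_def using assms by (intro list_cong) auto
qed

lemma listE:
  assumes "A \<subseteq> S"
  obtains xs where "A = set xs" "set xs \<subseteq> S" "big A = list_product xs"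
proof -
  have "finite A" using assms finite_index finite_subset by blast
  then obtain xs where "set xs = A" using finite_list by blast
  then show ?thesis using that[of xs] big_set[of xs] assms by simp
qed

lemma big_empty: "big {} = 1"
  using big_set[of "[]"] by simp

lemma big_insert:
  assumes "A \<subseteq> S" "x \<in> S"
  shows "big (insert x A) = f x * big A"
proof -
  obtain xs where "A = set xs" "set xs \<subseteq> S" "big A = list_product xs" using listE[OF assms(1)] .
  then show ?thesis using big_set[of "x # xs"] assms by simp
qed

lemma big_absorb:
  assumes "A \<subseteq> S" "x \<in> A"
  shows "f x * big A = big A"
proof -
  obtain xs where "A = set xs" "set xs \<subseteq> S" "big A = list_product xs" using listE[OF assms(1)] .
  then show ?thesis using list_absorb assms(2) by simp
qed

lemma big_commute:
  assumes "A \<subseteq> S" "x \<in> S"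
  shows "f x * big A = big A * f x"
proof -
  obtain xs where "A = set xs" "set xs \<subseteq> S" "big A = list_product xs" using listE[OF assms(1)] .
  then show ?thesis using list_commute assms(2) by simp
qed

lemma big_commute_big:
  assumes "A \<subseteq> S" "B \<subseteq> S"
  shows "big A * big B = big B * big A"
proof -
  obtain xs where "set xs \<subseteq> S" "big A = list_product xs" using listE[OF assms(1)] .
  moreover obtain ys where "set ys \<subseteq> S" "big B = list_product ys" using listE[OF assms(2)] .
  ultimately show ?thesis using list_commute_list by simp
qed

lemma big_induct [consumes 1, case_names empty insert]:
  assumes "A \<subseteq> S" "Q {} 1"
    and "\<And>x A. x \<in> S \<Longrightarrow> A \<subseteq> S \<Longrightarrow> Q A (big A) \<Longrightarrow> Q (insert x A) (f x * big A)"
  shows "Q A (big A)"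
proof -
  have "finite A" using assms(1) finite_index finite_subset by blast
  then show ?thesis using assms(1)
  proof (induction A rule: finite_induct)
    case empty
    then show ?case using assms(2) by (simp add: big_empty)
  next
    case (insert x A)
    then show ?case using assms(3)[of x A] by (simp add: big_insert)
  qed
qed

end

section \<open>Equivalences generated by pairs, and the data of normal forms\<close>

definition cl :: "(nat \<times> nat) set \<Rightarrow> (nat \<times> nat) set" where "cl r = (r \<union> r\<inverse>)\<^sup>*"

lemma cl_refl [simp]: "(x, x) \<in> cl r"
  by (simp add: cl_def)

lemma cl_sym: "(x, y) \<in> cl r \<Longrightarrow> (y, x) \<in> cl r"
  unfolding cl_def by (metis converse_Un converse_converse rtrancl_converseD sup_commute)

lemma cl_trans: "(x, y) \<in> cl r \<Longrightarrow> (y, z) \<in> cl r \<Longrightarrow> (x, z) \<in> cl r"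
  unfolding cl_def by (rule rtrancl_trans)

lemma cl_base: "(x, y) \<in> r \<Longrightarrow> (x, y) \<in> cl r"
  unfolding cl_def by auto

lemma cl_least:
  assumes "r \<subseteq> s" "\<And>x. (x, x) \<in> s" "\<And>x y. (x, y) \<in> s \<Longrightarrow> (y, x) \<in> s"
    "\<And>x y z. (x, y) \<in> s \<Longrightarrow> (y, z) \<in> s \<Longrightarrow> (x, z) \<in> s"
  shows "cl r \<subseteq> s"
proof -
  have "(x, y) \<in> s" if "(x, y) \<in> (r \<union> r\<inverse>)\<^sup>*" for x y
    using that by (induction rule: rtrancl_induct) (use assms in blast)+
  then show ?thesis unfolding cl_def by auto
qed

lemma cl_subset_cl: "r \<subseteq> cl s \<Longrightarrow> cl r \<subseteq> cl s"
  by (rule cl_least) (auto intro: cl_sym cl_trans)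

lemma cl_mono: "r \<subseteq> s \<Longrightarrow> cl r \<subseteq> cl s"
  by (rule cl_subset_cl) (auto intro: cl_base)

lemma cl_outside:
  assumes "r \<subseteq> V \<times> V"
  shows "(x, y) \<in> cl r \<Longrightarrow> x = y \<or> x \<in> V \<and> y \<in> V"
proof -
  have "cl r \<subseteq> {(x, y). x = y \<or> x \<in> V \<and> y \<in> V}" using assms by (intro cl_least) auto
  then show "(x, y) \<in> cl r \<Longrightarrow> x = y \<or> x \<in> V \<and> y \<in> V" by auto
qed

text \<open>A normal form consists of the upper kernel \<open>R\<close>, the lower kernel \<open>R'\<close> (each given by
  generating pairs, where 0 marks the rook dots) and the partial permutation obtained from \<open>\<pi>\<close> by
  deleting \<open>A\<close> from its domain.\<close>

definition nf_ok :: "nat \<Rightarrow> (nat \<times> nat) set \<Rightarrow> nat set \<Rightarrow> (nat \<Rightarrow> nat) \<Rightarrow> (nat \<times> nat) set \<Rightarrow> bool" where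
  "nf_ok n R A \<pi> R' \<longleftrightarrow> R \<subseteq> {..n} \<times> {..n} \<and> A \<subseteq> {1..n} \<and> \<pi> permutes {1..n} \<and> R' \<subseteq> {..n} \<times> {..n}"

text \<open>Each kernel class, above or below, meets at most one strand. The domain is the
  complement of \<open>A\<close> in all naturals and so contains 0; hence a class containing 0
  carries no strand besides that of 0.\<close>

definition proper :: "nat \<Rightarrow> (nat \<times> nat) set \<Rightarrow> nat set \<Rightarrow> (nat \<Rightarrow> nat) \<Rightarrow> (nat \<times> nat) set \<Rightarrow> bool" where
  "proper n R A \<pi> R' \<longleftrightarrow> nf_ok n R A \<pi> R' \<and>
     (\<forall>x y. x \<notin> A \<longrightarrow> y \<notin> A \<longrightarrow> (x, y) \<in> cl R \<or> (\<pi> x, \<pi> y) \<in> cl R' \<longrightarrow> x = y)"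

text \<open>Relates whole classes, so that it does not depend on the representatives which a strand
  happens to use.\<close>

definition matching :: "(nat \<times> nat) set \<Rightarrow> nat set \<Rightarrow> (nat \<Rightarrow> nat) \<Rightarrow> (nat \<times> nat) set \<Rightarrow> (nat \<times> nat) set" where
  "matching R A \<pi> R' = {(a, b). \<exists>x. x \<notin> A \<and> (a, x) \<in> cl R \<and> (\<pi> x, b) \<in> cl R'}"

context rook_generators
begin

sublocale KK: commuting_idempotents "\<lambda>(x, y). K x y" "{..n} \<times> {..n}"
  by standard (auto simp: K_idem K_K_commute)

sublocale EE: commuting_idempotents E "{1..n}"
  by standard (auto simp: E_idem E_E_commute)

text \<open>Induction along a path of generating pairs: the triangle law trades
  \<open>K x y * K y z\<close> for \<open>K x z * K x y\<close>, and \<open>K x y\<close> is already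
  absorbed.\<close>

lemma KK_absorb_cl:
  assumes "R \<subseteq> {..n} \<times> {..n}" "(x, y) \<in> cl R" "x \<le> n"
  shows "K x y * KK.big R = KK.big R"
proof -
  from assms(2) have "(x, y) \<in> (R \<union> R\<inverse>)\<^sup>*" by (simp add: cl_def)
  then have "y \<le> n \<and> K x y * KK.big R = KK.big R"
  proof (induction rule: rtrancl_induct)
    case base
    then show ?case using assms(3) by simp
  next
    case (step y z)
    then have y: "y \<le> n" and z: "z \<le> n" using assms(1) by auto
    have yz: "K y z * KK.big R = KK.big R"
      using step(2) KK.big_absorb[OF assms(1), of "(y, z)"] KK.big_absorb[OF assms(1), of "(z, y)"]
        K_commute[OF y z] by auto
    have "KK.big R = K x y * (K y z * KK.big R)" using step yz by simp
    also have "\<dots> = K x y * K y z * KK.big R" by (simp add: mult.assoc)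
    also have "K x y * K y z = K x z * K x y"
      using K_triangle[OF assms(3) y z] K_K_commute[OF assms(3) y assms(3) z] by simp
    also have "K x z * K x y * KK.big R = K x z * KK.big R" using step by (simp add: mult.assoc)
    finally have eq: "KK.big R = K x z * KK.big R" .
    show ?case using z eq[symmetric] by blast
  qed
  then show ?thesis by simp
qed

lemma KK_absorb_cl_right:
  assumes "R \<subseteq> {..n} \<times> {..n}" "(x, y) \<in> cl R" "x \<le> n" "y \<le> n"
  shows "KK.big R * K x y = KK.big R"
  using KK_absorb_cl[OF assms(1-3)] KK.big_commute[OF assms(1), of "(x, y)"] assms by simp

lemma KK_absorb_KK:
  assumes "Q \<subseteq> {..n} \<times> {..n}" "R \<subseteq> {..n} \<times> {..n}" "Q \<subseteq> cl R"
  shows "KK.big Q * KK.big R = KK.big R"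
  using assms(1,3)
proof (induction rule: KK.big_induct)
  case (insert x Q)
  then show ?case using KK_absorb_cl[OF assms(2), of "fst x" "snd x"]
    by (auto simp: mult.assoc split: prod.splits)
qed simp

lemma KK_cong:
  assumes "Q \<subseteq> {..n} \<times> {..n}" "R \<subseteq> {..n} \<times> {..n}" "cl Q = cl R"
  shows "KK.big Q = KK.big R"
proof -
  have "Q \<subseteq> cl R" "R \<subseteq> cl Q" using assms(3) by (auto intro: cl_base)
  then show ?thesis
    using KK_absorb_KK[OF assms(1,2)] KK_absorb_KK[OF assms(2,1)] KK.big_commute_big[OF assms(1,2)]
    by simp
qed

lemma KK_insert:
  assumes "R \<subseteq> {..n} \<times> {..n}" "x \<le> n" "y \<le> n"
  shows "KK.big (insert (x, y) R) = KK.big R * K x y"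
  using KK.big_insert[OF assms(1), of "(x, y)"] KK.big_commute[OF assms(1), of "(x, y)"] assms by simp

lemma permutes_le: "\<pi> permutes {1..n} \<Longrightarrow> x \<le> n \<Longrightarrow> \<pi> x \<le> n"
  using permutes_in_image[of \<pi> "{1..n}" x] permutes_0[of \<pi> n] by (cases "x = 0") auto

lemma map_pairs_subset:
  "\<pi> permutes {1..n} \<Longrightarrow> R \<subseteq> {..n} \<times> {..n} \<Longrightarrow> map_prod \<pi> \<pi> ` R \<subseteq> {..n} \<times> {..n}"
  using permutes_le by fastforce

lemma P_KK:
  assumes "\<pi> permutes {1..n}" "R \<subseteq> {..n} \<times> {..n}"
  shows "P \<pi> * KK.big (map_prod \<pi> \<pi> ` R) = KK.big R * P \<pi>"
  using assms(2)
proof (induction rule: KK.big_induct)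
  case empty
  then show ?case by (simp add: KK.big_empty)
next
  case (insert p Q)
  obtain x y where p: "p = (x, y)" by fastforce
  have xy: "x \<le> n" "y \<le> n" using insert p by auto
  have "P \<pi> * KK.big (map_prod \<pi> \<pi> ` insert p Q) = P \<pi> * (K (\<pi> x) (\<pi> y) * KK.big (map_prod \<pi> \<pi> ` Q))"
    using map_pairs_subset[OF assms(1) insert(2)] permutes_le[OF assms(1)] xy
    by (simp add: KK.big_insert p)
  also have "\<dots> = K x y * P \<pi> * KK.big (map_prod \<pi> \<pi> ` Q)"
    using P_K[OF assms(1) xy] by (simp add: mult.assoc[symmetric])
  also have "\<dots> = K x y * (KK.big Q * P \<pi>)" using insert by (simp add: mult.assoc)
  finally show ?case by (simp add: p mult.assoc)
qed

lemma P_EE: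
  assumes "\<pi> permutes {1..n}" "A \<subseteq> {1..n}"
  shows "P \<pi> * EE.big (\<pi> ` A) = EE.big A * P \<pi>"
  using assms(2)
proof (induction rule: EE.big_induct)
  case empty
  then show ?case by (simp add: EE.big_empty)
next
  case (insert x Q)
  have sub: "\<pi> ` Q \<subseteq> {1..n}" "\<pi> x \<in> {1..n}"
    using permutes_in_image[OF assms(1)] insert(1,2) by blast+
  have "P \<pi> * EE.big (\<pi> ` insert x Q) = P \<pi> * (E (\<pi> x) * EE.big (\<pi> ` Q))"
    using EE.big_insert[OF sub] by simp
  also have "\<dots> = E x * P \<pi> * EE.big (\<pi> ` Q)"
    using P_E[OF assms(1) insert(1)] by (simp add: mult.assoc[symmetric])
  also have "\<dots> = E x * (EE.big Q * P \<pi>)" using insert by (simp add: mult.assoc)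
  finally show ?case by (simp add: mult.assoc)
qed

lemma EE_K_commute:
  assumes "A \<subseteq> {1..n}" "x \<le> n" "y \<le> n" "x \<notin> A" "y \<notin> A"
  shows "EE.big A * K x y = K x y * EE.big A"
  using assms(1,4,5)
proof (induction rule: EE.big_induct)
  case (insert z A)
  have "E z * EE.big A * K x y = E z * K x y * EE.big A" using insert by (simp add: mult.assoc)
  also have "E z * K x y = K x y * E z" using insert assms by (intro E_K_commute) auto
  finally show ?case by (simp add: mult.assoc)
qed simp

text \<open>Strands in \<open>A\<close> are cut, so permuting their ends is invisible; for a
  transposition this is \<open>E_E_swap\<close>. Consequently only the values of
  \<open>\<pi>\<close> outside \<open>A\<close> matter.\<close>

lemma EE_permutes:
  assumes "A \<subseteq> {1..n}" "\<pi> permutes A"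
  shows "EE.big A * P \<pi> = EE.big A"
proof -
  have "finite A" using assms(1) finite_subset by blast
  with assms(2) show ?thesis
  proof (induction rule: permutes_induct)
    case id
    then show ?case unfolding P_id by simp
  next
    case (swap a b p)
    have ab: "a \<in> {1..n}" "b \<in> {1..n}" using swap assms by auto
    have p: "p permutes {1..n}" using permutes_subset[OF \<open>p permutes A\<close> assms(1)] .
    have absorb: "EE.big A * E z = EE.big A" if "z \<in> A" for z
    proof -
      have "z \<in> {1..n}" using that assms by auto
      then show ?thesis
        using EE.big_absorb[OF assms(1) that] EE.big_commute[OF assms(1), of z] by simp
    qed
    have EE: "EE.big A = EE.big A * (E a * E b)"
      using absorb[of a] absorb[of b] swap(1,2) by (simp add: mult.assoc[symmetric])
    have "EE.big A * P (transpose a b) = EE.big A * (E a * E b) * P (transpose a b)"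
      by (subst EE) (rule refl)
    also have "\<dots> = EE.big A * (E a * E b)" using E_E_swap[OF ab] by (simp only: mult.assoc)
    also have "\<dots> = EE.big A" by (rule EE[symmetric])
    finally have "EE.big A * P p * P (transpose a b) = EE.big A" using swap by simp
    then show ?case using P_comp[OF p permutes_swap_id[OF ab]] by (simp only: mult.assoc)
  qed
qed

lemma KK_swap:
  assumes "R \<subseteq> {..n} \<times> {..n}" "(x, y) \<in> cl R" "x \<in> {1..n}" "y \<in> {1..n}"
  shows "KK.big R * P (transpose x y) = KK.big R" "P (transpose x y) * KK.big R = KK.big R"
proof -
  have le: "x \<le> n" "y \<le> n" using assms by auto
  have sw: "transpose x y permutes {1..n}" using assms by (intro permutes_swap_id)
  have "KK.big R * P (transpose x y) = KK.big R * (K x y * P (transpose x y))"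
    using KK_absorb_cl_right[OF assms(1,2) le] by (simp add: mult.assoc[symmetric])
  then show "KK.big R * P (transpose x y) = KK.big R"
    using K_swap[OF assms(3,4)] KK_absorb_cl_right[OF assms(1,2) le] by simp
  have "P (transpose x y) * K x y = K x y"
    using P_K[OF sw le(2,1)] K_swap[OF assms(3,4)] K_commute[OF le] by simp
  then have "P (transpose x y) * (K x y * KK.big R) = K x y * KK.big R"
    by (simp add: mult.assoc[symmetric])
  then show "P (transpose x y) * KK.big R = KK.big R"
    using KK_absorb_cl[OF assms(1,2) le(1)] by simp
qed

definition N :: "(nat \<times> nat) set \<Rightarrow> nat set \<Rightarrow> (nat \<Rightarrow> nat) \<Rightarrow> (nat \<times> nat) set \<Rightarrow> 'a" where
  "N R A \<pi> R' = KK.big R * EE.big A * P \<pi> * KK.big R'"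

text \<open>If two points of the domain share a kernel class above or below, one of them is
  redundant, because \<open>K x y * E y * K x y = K x y\<close>.\<close>

lemma N_drop:
  assumes "nf_ok n R A \<pi> R'" "x \<le> n" "x \<notin> A" "y \<in> {1..n}" "y \<notin> A" "x \<noteq> y"
    and "(x, y) \<in> cl R \<or> (\<pi> x, \<pi> y) \<in> cl R'"
  shows "N R A \<pi> R' = N (insert (x, y) R) (insert y A) \<pi> (insert (\<pi> x, \<pi> y) R')"
proof -
  from assms(1) have R: "R \<subseteq> {..n} \<times> {..n}" and A: "A \<subseteq> {1..n}" and \<pi>: "\<pi> permutes {1..n}"
    and R': "R' \<subseteq> {..n} \<times> {..n}"
    by (auto simp: nf_ok_def)
  have y: "y \<le> n" using assms by simp
  have \<pi>xy: "\<pi> x \<le> n" "\<pi> y \<le> n" using permutes_le[OF \<pi>] assms by auto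
  define M where "M = EE.big A * P \<pi>"
  define k where "k = K x y"
  define k' where "k' = K (\<pi> x) (\<pi> y)"
  have kM: "M * k' = k * M"
  proof -
    have "M * k' = EE.big A * (P \<pi> * k')" by (simp only: M_def mult.assoc)
    also have "\<dots> = EE.big A * k * P \<pi>" unfolding k_def k'_def P_K[OF \<pi> assms(2) y] by (simp only: mult.assoc)
    also have "EE.big A * k = k * EE.big A"
      unfolding k_def by (rule EE_K_commute[OF A assms(2) y assms(3,5)])
    finally show ?thesis by (simp only: M_def mult.assoc)
  qed
  have kEk: "k * E y * k = k"
    using K_E_K[OF assms(4,2)] assms(6) K_commute[OF assms(2) y] by (simp add: k_def)
  \<comment> \<open>Whichever kernel relates the two points can emit the link: \<open>R\<close>
    directly as \<open>k\<close>, and \<open>R'\<close> as \<open>k'\<close>, which passes through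
    \<open>M\<close> and becomes \<open>k\<close>.\<close>
  have "KK.big R * M * KK.big R' = KK.big R * k * M * KK.big R'"
    using assms(7)
  proof
    assume "(x, y) \<in> cl R"
    then have "KK.big R * k = KK.big R"
      using KK_absorb_cl_right[OF R] assms(2) y by (simp add: k_def)
    then show ?thesis by simp
  next
    assume "(\<pi> x, \<pi> y) \<in> cl R'"
    then have k': "k' * KK.big R' = KK.big R'"
      using KK_absorb_cl[OF R'] \<pi>xy by (simp add: k'_def)
    have "KK.big R * M * KK.big R' = KK.big R * (M * k') * KK.big R'"
      by (simp only: mult.assoc k')
    then show ?thesis unfolding kM by (simp only: mult.assoc)
  qed
  also have "\<dots> = KK.big R * (k * E y * k) * M * KK.big R'" by (simp only: kEk)
  also have "\<dots> = KK.big R * k * E y * (k * M) * KK.big R'" by (simp only: mult.assoc)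
  also have "\<dots> = (KK.big R * k) * (E y * EE.big A) * P \<pi> * (k' * KK.big R')"
    unfolding kM[symmetric] by (simp only: mult.assoc M_def)
  also have "KK.big R * k = KK.big (insert (x, y) R)"
    using KK_insert[OF R assms(2) y] by (simp add: k_def)
  also have "E y * EE.big A = EE.big (insert y A)"
    using EE.big_insert[OF A assms(4)] by simp
  also have "k' * KK.big R' = KK.big (insert (\<pi> x, \<pi> y) R')"
    using KK.big_insert[OF R', of "(\<pi> x, \<pi> y)"] \<pi>xy by (simp add: k'_def)
  finally show ?thesis by (simp only: N_def M_def mult.assoc)
qed

lemma nf_ok_drop:
  assumes "nf_ok n R A \<pi> R'" "x \<le> n" "y \<in> {1..n}"
  shows "nf_ok n (insert (x, y) R) (insert y A) \<pi> (insert (\<pi> x, \<pi> y) R')"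
  using assms permutes_le[of \<pi>] by (auto simp: nf_ok_def)

text \<open>As long as two strands meet the same class, \<open>N_drop\<close> cuts one of them. Each
  cut enlarges \<open>A\<close> inside \<open>{1..n}\<close>, so the process ends.\<close>

lemma N_proper:
  assumes "nf_ok n R A \<pi> R'"
  shows "\<exists>R2 A2 R2'. proper n R2 A2 \<pi> R2' \<and> N R A \<pi> R' = N R2 A2 \<pi> R2'"
  using assms
proof (induction "card ({1..n} - A)" arbitrary: R A R' rule: less_induct)
  case less
  show ?case
  proof (cases "proper n R A \<pi> R'")
    case True
    then show ?thesis by blast
  next
    case False
    have \<pi>: "\<pi> permutes {1..n}" using less.prems by (simp add: nf_ok_def)
    obtain x y where xy: "x \<notin> A" "y \<notin> A" "x \<noteq> y" "(x, y) \<in> cl R \<or> (\<pi> x, \<pi> y) \<in> cl R'"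
      using False less.prems unfolding proper_def by metis
    have "x \<le> n \<and> y \<le> n"
      using xy(4)
    proof
      assume "(x, y) \<in> cl R"
      then show ?thesis using cl_outside[of R "{..n}" x y] less.prems xy by (auto simp: nf_ok_def)
    next
      assume "(\<pi> x, \<pi> y) \<in> cl R'"
      moreover have "\<pi> x \<noteq> \<pi> y" using xy(3) inj_eq[OF permutes_inj[OF \<pi>]] by simp
      ultimately have "\<pi> x \<le> n" "\<pi> y \<le> n"
        using cl_outside[of R' "{..n}" "\<pi> x" "\<pi> y"] less.prems by (auto simp: nf_ok_def)
      moreover have "z \<le> n" if "\<pi> z \<le> n" for z
        using that permutes_not_in[OF \<pi>, of z] by (cases "z \<in> {1..n}") auto
      ultimately show ?thesis by blast
    qed
    \<comment> \<open>The point \<open>v\<close> to be cut must not be 0. At most one of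
      \<open>x\<close>, \<open>y\<close> is 0, so symmetry allows the other to be chosen.\<close>
    then obtain u v where uv: "u \<le> n" "v \<in> {1..n}" "u \<notin> A" "v \<notin> A" "u \<noteq> v"
      "(u, v) \<in> cl R \<or> (\<pi> u, \<pi> v) \<in> cl R'"
    proof (cases "y = 0")
      case True
      then have "y \<le> n" "x \<in> {1..n}" "y \<noteq> x" using xy(3) \<open>x \<le> n \<and> y \<le> n\<close> by auto
      moreover have "(y, x) \<in> cl R \<or> (\<pi> y, \<pi> x) \<in> cl R'" using xy(4) cl_sym[of x y R] cl_sym[of "\<pi> x" "\<pi> y" R'] by argo
      ultimately show ?thesis by (intro that[of y x] xy)
    next
      case False
      then have "x \<le> n" "y \<in> {1..n}" using \<open>x \<le> n \<and> y \<le> n\<close> by auto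
      then show ?thesis by (intro that[of x y] xy)
    qed
    have "{1..n} - insert v A = {1..n} - A - {v}" by blast
    moreover have "card ({1..n} - A - {v}) < card ({1..n} - A)"
      using uv(2,4) by (intro card_Diff1_less) auto
    ultimately have "card ({1..n} - insert v A) < card ({1..n} - A)" by simp
    from less.hyps[OF this nf_ok_drop[OF less.prems uv(1,2)]] show ?thesis
      unfolding N_drop[OF less.prems uv(1,3,2,4-6)] .
  qed
qed

end

section \<open>Normal forms are closed under multiplication by the generators\<close>

context rook_generators
begin

definition is_normal :: "'a \<Rightarrow> bool" where
  "is_normal x \<longleftrightarrow> (\<exists>R A \<pi> R'. nf_ok n R A \<pi> R' \<and> x = N R A \<pi> R')"

lemma is_normal_1: "is_normal 1"
proof -
  have "1 = N {} {} id {}" unfolding N_def KK.big_empty EE.big_empty P_id by simp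
  moreover have "nf_ok n {} {} id {}" unfolding nf_ok_def by (simp add: permutes_id del: id_apply)
  ultimately show ?thesis unfolding is_normal_def by blast
qed

lemma is_normal_P:
  assumes "is_normal x" "\<rho> permutes {1..n}"
  shows "is_normal (x * P \<rho>)"
proof -
  obtain R A \<pi> R' where ok: "nf_ok n R A \<pi> R'" and x: "x = N R A \<pi> R'"
    using assms(1) by (auto simp: is_normal_def)
  then have \<pi>: "\<pi> permutes {1..n}" and R': "R' \<subseteq> {..n} \<times> {..n}" by (auto simp: nf_ok_def)
  have "x * P \<rho> = KK.big R * EE.big A * (P \<pi> * P \<rho>) * KK.big (map_prod \<rho> \<rho> ` R')"
    unfolding x N_def using P_KK[OF assms(2) R'] by (simp add: mult.assoc)
  then have "x * P \<rho> = N R A (\<rho> \<circ> \<pi>) (map_prod \<rho> \<rho> ` R')"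
    unfolding N_def P_comp[OF \<pi> assms(2)] .
  moreover have "nf_ok n R A (\<rho> \<circ> \<pi>) (map_prod \<rho> \<rho> ` R')"
    using ok map_pairs_subset[OF assms(2) R'] permutes_compose[OF \<pi> assms(2)]
    by (simp add: nf_ok_def)
  ultimately show ?thesis unfolding is_normal_def by blast
qed

lemma is_normal_K:
  assumes "is_normal w" "x \<le> n" "y \<le> n"
  shows "is_normal (w * K x y)"
proof -
  obtain R A \<pi> R' where ok: "nf_ok n R A \<pi> R'" and w: "w = N R A \<pi> R'"
    using assms(1) by (auto simp: is_normal_def)
  then have R': "R' \<subseteq> {..n} \<times> {..n}" by (auto simp: nf_ok_def)
  have "w * K x y = N R A \<pi> (insert (x, y) R')"
    unfolding w N_def KK_insert[OF R' assms(2,3)] by (simp only: mult.assoc)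
  moreover have "nf_ok n R A \<pi> (insert (x, y) R')" using ok assms by (simp add: nf_ok_def)
  ultimately show ?thesis unfolding is_normal_def by blast
qed

lemma KK_E_commute:
  assumes "R \<subseteq> {..n} \<times> {..n}" "i \<in> {1..n}"
    and "\<And>a b. (a, b) \<in> R \<Longrightarrow> a = b \<or> a \<noteq> i \<and> b \<noteq> i"
  shows "KK.big R * E i = E i * KK.big R"
  using assms(1,3)
proof (induction rule: KK.big_induct)
  case (insert p Q)
  obtain a b where p: "p = (a, b)" by fastforce
  have ab: "a \<le> n" "b \<le> n" using insert(1) p by auto
  have "a = b \<or> a \<noteq> i \<and> b \<noteq> i" using insert(4)[of a b] p by simp
  then have K: "K a b * E i = E i * K a b"
    using E_K_commute[OF assms(2) ab] by auto
  have "KK.big Q * E i = E i * KK.big Q" using insert by blast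
  then have "K a b * KK.big Q * E i = K a b * E i * KK.big Q" by (simp only: mult.assoc)
  then show ?case unfolding p K by (simp only: mult.assoc prod.case)
qed simp

lemma EE_P_E:
  assumes "A \<subseteq> {1..n}" "\<pi> permutes {1..n}" "x \<in> {1..n}"
  shows "EE.big A * P \<pi> * E (\<pi> x) = EE.big (insert x A) * P \<pi>"
proof -
  have "EE.big A * P \<pi> * E (\<pi> x) = EE.big A * (P \<pi> * E (\<pi> x))" by (simp only: mult.assoc)
  also have "\<dots> = EE.big A * E x * P \<pi>" unfolding P_E[OF assms(2,3)] by (simp only: mult.assoc)
  also have "EE.big A * E x = EE.big (insert x A)"
    using EE.big_insert[OF assms(1,3)] EE.big_commute[OF assms(1,3)] by simp
  finally show ?thesis .
qed

text \<open>A point of the range that is related below to another point can be removed from the range.\<close>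

lemma N_avoid:
  assumes "nf_ok n R A \<pi> R'" "x \<in> {1..n}" "(\<pi> x, j) \<in> cl R'" "j \<noteq> \<pi> x"
  shows "\<exists>R1 A1 \<pi>1 R1' x1. nf_ok n R1 A1 \<pi>1 R1' \<and> N R A \<pi> R' = N R1 A1 \<pi>1 R1' \<and>
    x1 \<in> A1 \<and> \<pi>1 x1 = \<pi> x \<and> (\<pi> x, j) \<in> cl R1'"
proof (cases "x \<in> A")
  case True
  then show ?thesis using assms by blast
next
  case False
  have \<pi>: "\<pi> permutes {1..n}" and R': "R' \<subseteq> {..n} \<times> {..n}" using assms(1) by (auto simp: nf_ok_def)
  have j: "j \<le> n" using cl_outside[OF R' assms(3)] assms(4) by auto
  \<comment> \<open>\<open>y\<close> is the upper end of the strand at \<open>j\<close>. If it is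
    cut, \<open>R'\<close> absorbs the swap of the two lower ends, after which the cut strand ends
    at \<open>\<pi> x\<close>. If not, two strands meet one lower class and the one at
    \<open>x\<close> may be dropped.\<close>
  obtain y where y: "j = \<pi> y" using permutes_surj[OF \<pi>] by auto
  have yn: "y \<le> n" using y j permutes_not_in[OF \<pi>, of y] by (cases "y \<in> {1..n}") auto
  show ?thesis
  proof (cases "y \<in> A")
    case True
    then have y1: "y \<in> {1..n}" using assms(1) by (auto simp: nf_ok_def)
    have in1: "\<pi> x \<in> {1..n}" "\<pi> y \<in> {1..n}" using permutes_in_image[OF \<pi>] assms(2) y1 by blast+
    define \<tau> where "\<tau> = transpose (\<pi> x) (\<pi> y)"
    have \<tau>: "\<tau> permutes {1..n}" unfolding \<tau>_def by (rule permutes_swap_id[OF in1])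
    have "P \<tau> * KK.big R' = KK.big R'"
      unfolding \<tau>_def using assms(3) y by (intro KK_swap(2)[OF R' _ in1]) simp
    then have "N R A \<pi> R' = KK.big R * EE.big A * (P \<pi> * P \<tau>) * KK.big R'"
      unfolding N_def by (simp add: mult.assoc)
    then have "N R A \<pi> R' = N R A (\<tau> \<circ> \<pi>) R'" unfolding P_comp[OF \<pi> \<tau>] N_def .
    moreover have "nf_ok n R A (\<tau> \<circ> \<pi>) R'"
      using assms(1) permutes_compose[OF \<pi> \<tau>] by (simp add: nf_ok_def)
    moreover have "(\<tau> \<circ> \<pi>) y = \<pi> x" by (simp add: \<tau>_def)
    ultimately show ?thesis using True assms(3) by blast
  next
    case False': False
    have "y \<noteq> x" using assms(4) y by auto
    moreover have "(\<pi> y, \<pi> x) \<in> cl R'" using cl_sym[OF assms(3)] y by simp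
    ultimately have "N R A \<pi> R' = N (insert (y, x) R) (insert x A) \<pi> (insert (\<pi> y, \<pi> x) R')"
      using yn by (intro N_drop[OF assms(1) _ False' assms(2) False]) auto
    moreover have "nf_ok n (insert (y, x) R) (insert x A) \<pi> (insert (\<pi> y, \<pi> x) R')"
      by (rule nf_ok_drop[OF assms(1) yn assms(2)])
    moreover have "(\<pi> x, j) \<in> cl (insert (\<pi> y, \<pi> x) R')"
      using assms(3) cl_mono[of R' "insert (\<pi> y, \<pi> x) R'"] by blast
    ultimately show ?thesis by blast
  qed
qed

text \<open>If \<open>i\<close> is alone in its lower class, \<open>E i\<close> passes the lower
  kernel and cuts the strand ending at \<open>i\<close>. Otherwise \<open>N_avoid\<close> arranges
  that this strand is cut already, which supplies a factor \<open>E i\<close> to the left of the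
  lower kernel. That kernel is split into a part avoiding \<open>i\<close> and one link
  \<open>K i j\<close>, and \<open>E i * K i j * E i = E i\<close> deletes the link.\<close>

lemma is_normal_E:
  assumes "is_normal w" "i \<in> {1..n}"
  shows "is_normal (w * E i)"
proof -
  obtain R A \<pi> R' where ok: "nf_ok n R A \<pi> R'" and w: "w = N R A \<pi> R'"
    using assms(1) by (auto simp: is_normal_def)
  then have \<pi>: "\<pi> permutes {1..n}" and R': "R' \<subseteq> {..n} \<times> {..n}" and A: "A \<subseteq> {1..n}"
    by (auto simp: nf_ok_def)
  obtain x where x: "i = \<pi> x" using permutes_surj[OF \<pi>] by auto
  have xn: "x \<in> {1..n}" using permutes_in_image[OF \<pi>] assms(2) x by blast
  show ?thesis
  proof (cases "\<exists>j. j \<noteq> i \<and> (i, j) \<in> cl R'")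
    case False
    have "a = b \<or> a \<noteq> i \<and> b \<noteq> i" if "(a, b) \<in> R'" for a b
      using False cl_base[OF that] cl_sym[OF cl_base[OF that]] by metis
    then have comm: "KK.big R' * E i = E i * KK.big R'" by (rule KK_E_commute[OF R' assms(2)])
    have "w * E i = KK.big R * (EE.big A * P \<pi> * E (\<pi> x)) * KK.big R'"
      using comm unfolding w N_def x by (simp only: mult.assoc)
    then have "w * E i = N R (insert x A) \<pi> R'"
      unfolding EE_P_E[OF A \<pi> xn] N_def by (simp only: mult.assoc)
    moreover have "nf_ok n R (insert x A) \<pi> R'" using ok xn by (simp add: nf_ok_def)
    ultimately show ?thesis unfolding is_normal_def by blast
  next
    case True
    then obtain j where j: "j \<noteq> i" "(i, j) \<in> cl R'" by blast
    then obtain R1 A1 \<pi>1 R1' x1 where ok1: "nf_ok n R1 A1 \<pi>1 R1'" and w1: "w = N R1 A1 \<pi>1 R1'"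
      and x1: "x1 \<in> A1" "\<pi>1 x1 = i" and ij: "(i, j) \<in> cl R1'"
      using N_avoid[OF ok xn, of j] w x by auto
    have \<pi>1: "\<pi>1 permutes {1..n}" and R1': "R1' \<subseteq> {..n} \<times> {..n}" and A1: "A1 \<subseteq> {1..n}"
      using ok1 by (auto simp: nf_ok_def)
    have jn: "j \<le> n" and i: "i \<le> n" using cl_outside[OF R1' ij] j assms by auto
    \<comment> \<open>The closure, not \<open>R1'\<close> itself, is restricted: points connected
      only through \<open>i\<close> must stay connected after \<open>i\<close> is removed.\<close>
    define Q where "Q = {(a, b) \<in> cl R1'. a \<le> n \<and> b \<le> n \<and> a \<noteq> i \<and> b \<noteq> i}"
    have Q: "Q \<subseteq> {..n} \<times> {..n}" by (auto simp: Q_def)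
    have "R1' \<subseteq> cl (insert (i, j) Q)"
    proof
      fix p assume p: "p \<in> R1'"
      obtain a b where ab: "p = (a, b)" by fastforce
      \<comment> \<open>Replacing \<open>i\<close> by \<open>j\<close> sends a pair of
        \<open>R1'\<close> into \<open>Q\<close>; the link between \<open>i\<close> and
        \<open>j\<close> restores the original pair.\<close>
      define h where "h z = (if z = i then j else z)" for z
      have h: "(z, h z) \<in> cl (insert (i, j) Q)" "(h z, z) \<in> cl R1'" for z
        using cl_base[of i j "insert (i, j) Q"] cl_sym[OF ij] by (auto simp: h_def)
      have abn: "a \<le> n" "b \<le> n" using p ab R1' by auto
      have "(a, b) \<in> cl R1'" using p ab cl_base by simp
      then have "(h a, h b) \<in> cl R1'"
        using cl_trans[OF h(2)[of a]] cl_trans[OF _ cl_sym[OF h(2)[of b]]] by blast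
      then have "(h a, h b) \<in> Q" using abn jn j by (auto simp: Q_def h_def)
      then have "(h a, h b) \<in> cl (insert (i, j) Q)" by (intro cl_base) simp
      then show "p \<in> cl (insert (i, j) Q)"
        unfolding ab using cl_trans[OF h(1)[of a]] cl_trans[OF _ cl_sym[OF h(1)[of b]]] by blast
    qed
    moreover have "insert (i, j) Q \<subseteq> cl R1'" using ij by (auto simp: Q_def)
    ultimately have "cl R1' = cl (insert (i, j) Q)" using cl_subset_cl by blast
    then have "KK.big R1' = KK.big (insert (i, j) Q)"
      using R1' Q i jn by (intro KK_cong) auto
    also have "\<dots> = KK.big Q * K i j" by (rule KK_insert[OF Q i jn])
    finally have KK: "KK.big R1' = KK.big Q * K i j" .
    have x1n: "x1 \<in> {1..n}" using x1(1) A1 by blast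
    have absorb: "EE.big A1 * P \<pi>1 = EE.big A1 * P \<pi>1 * E i"
      using EE_P_E[OF A1 \<pi>1 x1n] unfolding x1(2) insert_absorb[OF x1(1)] by (rule sym)
    have comm: "KK.big Q * E i = E i * KK.big Q"
      by (rule KK_E_commute[OF Q assms(2)]) (auto simp: Q_def)
    have "w * E i = KK.big R1 * (EE.big A1 * P \<pi>1 * E i) * (KK.big Q * K i j) * E i"
      unfolding w1 N_def KK absorb[symmetric] by (simp only: mult.assoc)
    also have "\<dots> = KK.big R1 * (EE.big A1 * P \<pi>1) * (E i * KK.big Q) * K i j * E i"
      by (simp only: mult.assoc)
    also have "\<dots> = KK.big R1 * (EE.big A1 * P \<pi>1) * KK.big Q * (E i * K i j * E i)"
      unfolding comm[symmetric] by (simp only: mult.assoc)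
    also have "E i * K i j * E i = E i" using j by (intro E_K_E[OF assms(2) jn]) auto
    also have "KK.big R1 * (EE.big A1 * P \<pi>1) * KK.big Q * E i =
        KK.big R1 * (EE.big A1 * P \<pi>1 * E i) * KK.big Q"
      using comm by (simp only: mult.assoc)
    also have "\<dots> = N R1 A1 \<pi>1 Q" unfolding absorb[symmetric] N_def by (simp only: mult.assoc)
    finally have "w * E i = N R1 A1 \<pi>1 Q" .
    moreover have "nf_ok n R1 A1 \<pi>1 Q" using ok1 Q by (simp add: nf_ok_def)
    ultimately show ?thesis unfolding is_normal_def by blast
  qed
qed

lemma is_normal_generators:
  assumes "is_normal x"
  shows "is_normal (x * s)" "is_normal (x * c)" "is_normal (x * e)" "is_normal (x * q)" "is_normal (x * r)"
proof -
  show "is_normal (x * s)" using is_normal_P[OF assms swap_12_permutes] unfolding P_swap_12 .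
  show "is_normal (x * c)" using is_normal_P[OF assms rotation_permutes] unfolding P_rotation .
  show "is_normal (x * e)" using is_normal_E[OF assms, of 1] n_ge unfolding E_1 by simp
  show "is_normal (x * q)" using is_normal_K[OF assms, of 1 2] n_ge unfolding K_1_2 by simp
  show "is_normal (x * r)" using is_normal_K[OF assms, of 0 1] n_ge unfolding K_0_1 by simp
qed

section \<open>A proper normal form is determined by its kernels and its matching\<close>

lemma EE_P_cong:
  assumes "A \<subseteq> {1..n}" "\<pi> permutes {1..n}" "\<rho> permutes {1..n}" "\<And>x. x \<notin> A \<Longrightarrow> \<pi> x = \<rho> x"
  shows "EE.big A * P \<pi> = EE.big A * P \<rho>"
proof -
  define \<sigma> where "\<sigma> = inv_into UNIV \<rho> \<circ> \<pi>"
  have \<sigma>: "\<sigma> permutes {1..n}"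
    unfolding \<sigma>_def by (intro permutes_compose permutes_inv assms)
  have "\<sigma> permutes A"
  proof (rule permutes_superset[OF \<sigma>])
    fix x assume "x \<in> {1..n} - A"
    then show "\<sigma> x = x" using assms(4) permutes_inverses(2)[OF assms(3)] by (simp add: \<sigma>_def)
  qed
  then have "EE.big A * P \<rho> = EE.big A * P \<sigma> * P \<rho>" using EE_permutes[OF assms(1)] by simp
  also have "\<dots> = EE.big A * P (\<rho> \<circ> \<sigma>)"
    unfolding P_comp[OF \<sigma> assms(3), symmetric] by (simp only: mult.assoc)
  also have "\<rho> \<circ> \<sigma> = \<pi>"
    unfolding \<sigma>_def o_assoc permutes_inv_o(1)[OF assms(3)] id_o ..
  finally show ?thesis ..
qed

text \<open>Each kernel absorbs transpositions of related points, so a strand may change both of its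
  ends within their classes.\<close>

lemma N_reroute:
  assumes "nf_ok n R A \<pi> R'" "x \<in> {1..n}" "y \<in> {1..n}" "(x, y) \<in> cl R"
    and "x' \<in> {1..n}" "y' \<in> {1..n}" "(x', y') \<in> cl R'"
  shows "N R (transpose x y ` A) (transpose x' y' \<circ> \<pi> \<circ> transpose x y) R' = N R A \<pi> R'"
    and "nf_ok n R (transpose x y ` A) (transpose x' y' \<circ> \<pi> \<circ> transpose x y) R'"
proof -
  have R: "R \<subseteq> {..n} \<times> {..n}" and A: "A \<subseteq> {1..n}" and \<pi>: "\<pi> permutes {1..n}"
    and R': "R' \<subseteq> {..n} \<times> {..n}"
    using assms(1) by (auto simp: nf_ok_def)
  define \<tau> \<tau>' where "\<tau> = transpose x y" and "\<tau>' = transpose x' y'"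
  have \<tau>: "\<tau> permutes {1..n}" "\<tau>' permutes {1..n}"
    unfolding \<tau>_def \<tau>'_def using assms by (intro permutes_swap_id; simp)+
  have \<tau>A: "\<tau> ` A \<subseteq> {1..n}" using A permutes_image[OF \<tau>(1)] by blast
  have \<pi>\<tau>: "\<pi> \<circ> \<tau> permutes {1..n}" by (rule permutes_compose[OF \<tau>(1) \<pi>])
  have "\<tau> ` \<tau> ` A = A" by (simp add: \<tau>_def image_image)
  then have EE: "EE.big (\<tau> ` A) * P \<tau> = P \<tau> * EE.big A" using P_EE[OF \<tau>(1) \<tau>A] by simp
  have KK: "KK.big R * P \<tau> = KK.big R" "P \<tau>' * KK.big R' = KK.big R'"
    unfolding \<tau>_def \<tau>'_def by (rule KK_swap(1)[OF R assms(4,2,3)] KK_swap(2)[OF R' assms(7,5,6)])+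
  have PP: "P (\<tau>' \<circ> \<pi> \<circ> \<tau>) = P \<tau> * P \<pi> * P \<tau>'"
    unfolding P_comp[OF \<tau>(1) \<pi>] P_comp[OF \<pi>\<tau> \<tau>(2)] comp_assoc ..
  have "N R (\<tau> ` A) (\<tau>' \<circ> \<pi> \<circ> \<tau>) R' =
      KK.big R * (EE.big (\<tau> ` A) * P \<tau>) * P \<pi> * (P \<tau>' * KK.big R')"
    unfolding N_def PP by (simp only: mult.assoc)
  also have "\<dots> = KK.big R * P \<tau> * EE.big A * P \<pi> * KK.big R'"
    unfolding EE KK(2) by (simp only: mult.assoc)
  also have "\<dots> = N R A \<pi> R'" unfolding KK(1) N_def ..
  finally show "N R (transpose x y ` A) (transpose x' y' \<circ> \<pi> \<circ> transpose x y) R' = N R A \<pi> R'"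
    unfolding \<tau>_def \<tau>'_def .
  have "\<tau>' \<circ> \<pi> \<circ> \<tau> permutes {1..n}"
    unfolding comp_assoc by (rule permutes_compose[OF \<pi>\<tau> \<tau>(2)])
  then show "nf_ok n R (transpose x y ` A) (transpose x' y' \<circ> \<pi> \<circ> transpose x y) R'"
    using assms(1) \<tau>A unfolding \<tau>_def \<tau>'_def nf_ok_def by simp
qed

end

lemma transpose_cl:
  assumes "(x, y) \<in> cl R"
  shows "(z, transpose x y z) \<in> cl R"
  using assms cl_sym[OF assms] by (auto simp: transpose_def)

lemma cl_cong_iff:
  assumes "(x, x') \<in> cl R" "(y, y') \<in> cl R"
  shows "(x, y) \<in> cl R \<longleftrightarrow> (x', y') \<in> cl R"
proof
  assume "(x, y) \<in> cl R"
  then show "(x', y') \<in> cl R"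
    by (rule cl_trans[OF cl_sym[OF assms(1)] cl_trans[OF _ assms(2)]])
next
  assume "(x', y') \<in> cl R"
  then show "(x, y) \<in> cl R"
    by (rule cl_trans[OF assms(1) cl_trans[OF _ cl_sym[OF assms(2)]]])
qed

lemma proper_inj:
  assumes "proper n R A \<pi> R'" "x \<notin> A" "y \<notin> A" "(x, y) \<in> cl R \<or> (\<pi> x, \<pi> y) \<in> cl R'"
  shows "x = y"
  using assms unfolding proper_def by blast

lemma
  fixes A :: "nat set" and \<pi> :: "nat \<Rightarrow> nat"
  assumes "(x, y) \<in> cl R" "(x', y') \<in> cl R'"
  defines "B \<equiv> transpose x y ` A" and "\<rho> \<equiv> transpose x' y' \<circ> \<pi> \<circ> transpose x y"
  shows proper_reroute: "proper n R A \<pi> R' \<Longrightarrow> nf_ok n R B \<rho> R' \<Longrightarrow> proper n R B \<rho> R'"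
    and matching_reroute: "matching R B \<rho> R' = matching R A \<pi> R'"
proof -
  have B: "z \<in> B \<longleftrightarrow> transpose x y z \<in> A" for z
    unfolding B_def by (metis image_iff transpose_involutory)
  have R: "(z, transpose x y z) \<in> cl R" for z by (rule transpose_cl[OF assms(1)])
  have R': "(\<rho> z, \<pi> (transpose x y z)) \<in> cl R'" for z
    unfolding \<rho>_def comp_def by (rule cl_sym[OF transpose_cl[OF assms(2)]])
  show "proper n R B \<rho> R'" if proper: "proper n R A \<pi> R'" and ok: "nf_ok n R B \<rho> R'"
    unfolding proper_def
  proof (intro conjI ok allI impI)
    fix z w assume "z \<notin> B" "w \<notin> B" "(z, w) \<in> cl R \<or> (\<rho> z, \<rho> w) \<in> cl R'"
    then have "transpose x y z = transpose x y w"
      using cl_cong_iff[OF R[of z] R[of w]] cl_cong_iff[OF R'[of z] R'[of w]]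
      by (intro proper_inj[OF proper]) (simp_all add: B)
    then show "z = w" by (metis transpose_involutory)
  qed
  have step: "(a, b) \<in> matching R B \<rho> R' \<longleftrightarrow> (\<exists>z. transpose x y z \<notin> A \<and> (a, transpose x y z) \<in> cl R \<and>
      (\<pi> (transpose x y z), b) \<in> cl R')" for a b
    using cl_cong_iff[OF cl_refl R] cl_cong_iff[OF R' cl_refl] by (simp add: matching_def B)
  have "(a, b) \<in> matching R B \<rho> R' \<longleftrightarrow> (a, b) \<in> matching R A \<pi> R'" for a b
    unfolding step unfolding matching_def mem_Collect_eq prod.case by (metis transpose_involutory)
  then show "matching R B \<rho> R' = matching R A \<pi> R'" by auto
qed

context rook_generators
begin

text \<open>Rerouting within kernel classes increases the agreement of the two partial permutations step
  by step.\<close>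

lemma N_unique_aux:
  assumes "proper n R B \<rho> R'" "proper n R A \<pi> R'" "matching R A \<pi> R' = matching R B \<rho> R'"
  shows "N R A \<pi> R' = N R B \<rho> R'"
  using assms(2,3)
proof (induction "card {x \<in> {1..n} - A. x \<in> B \<or> \<rho> x \<noteq> \<pi> x}" arbitrary: A \<pi> rule: less_induct)
  case less
  let ?bad = "\<lambda>A \<pi>. {x \<in> {1..n} - A. x \<in> B \<or> \<rho> x \<noteq> \<pi> x}"
  have okA: "nf_ok n R A \<pi> R'" and okB: "nf_ok n R B \<rho> R'"
    using less.prems(1) assms(1) by (simp_all add: proper_def)
  then have R: "R \<subseteq> {..n} \<times> {..n}" and R': "R' \<subseteq> {..n} \<times> {..n}" and A: "A \<subseteq> {1..n}"
    and B: "B \<subseteq> {1..n}" and \<pi>: "\<pi> permutes {1..n}" and \<rho>: "\<rho> permutes {1..n}"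
    by (simp_all add: nf_ok_def)
  show ?case
  proof (cases "?bad A \<pi> = {}")
    case True
    have agree: "x \<notin> B \<and> \<rho> x = \<pi> x" if "x \<notin> A" for x
    proof (cases "x \<in> {1..n}")
      case True
      then show ?thesis using \<open>?bad A \<pi> = {}\<close> that by blast
    next
      case False
      then show ?thesis using permutes_not_in[OF \<pi>] permutes_not_in[OF \<rho>] B by auto
    qed
    \<comment> \<open>Agreement gives only one inclusion between \<open>A\<close> and
      \<open>B\<close>. For the other, the equal matchings provide an uncut point in the class of
      \<open>x\<close>, and properness identifies it with \<open>x\<close>.\<close>
    have "x \<notin> A" if "x \<notin> B" for x
    proof -
      have "(x, \<rho> x) \<in> matching R A \<pi> R'"
        unfolding less.prems(2) using that by (auto simp: matching_def)
      then obtain z where "z \<notin> A" "(x, z) \<in> cl R" by (auto simp: matching_def)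
      then show ?thesis using proper_inj[OF assms(1) that, of z] agree by blast
    qed
    then have "B = A" using agree by blast
    have "EE.big A * P \<pi> = EE.big A * P \<rho>" using agree by (intro EE_P_cong[OF A \<pi> \<rho>]) simp
    then have "KK.big R * (EE.big A * P \<pi>) * KK.big R' = KK.big R * (EE.big A * P \<rho>) * KK.big R'"
      by (simp only:)
    then show ?thesis unfolding N_def \<open>B = A\<close> by (simp only: mult.assoc)
  next
    case False
    then obtain x where x: "x \<in> {1..n}" "x \<notin> A" "x \<in> B \<or> \<rho> x \<noteq> \<pi> x" by blast
    have "(x, \<pi> x) \<in> matching R A \<pi> R'" using x(2) by (auto simp: matching_def)
    then obtain y where y: "y \<notin> B" "(x, y) \<in> cl R" "(\<rho> y, \<pi> x) \<in> cl R'"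
      unfolding less.prems(2) by (auto simp: matching_def)
    have "y \<noteq> 0"
    proof
      assume "y = 0"
      moreover have "0 \<notin> A" using A by auto
      ultimately have "x = 0" using y(2) x(2) by (intro proper_inj[OF less.prems(1)]) auto
      then show False using x by simp
    qed
    then have yn: "y \<in> {1..n}" using cl_outside[OF R y(2)] x(1) by auto
    have im: "\<pi> x \<in> {1..n}" "\<rho> y \<in> {1..n}"
      using permutes_in_image[OF \<pi>] permutes_in_image[OF \<rho>] x(1) yn by blast+
    have rel': "(\<pi> x, \<rho> y) \<in> cl R'" by (rule cl_sym[OF y(3)])
    \<comment> \<open>The strand of \<open>\<pi>\<close> at \<open>x\<close> and that of
      \<open>\<rho>\<close> at \<open>y\<close> join the same two classes. After rerouting,
      \<open>\<pi>2 y = \<rho> y\<close>; the bad point \<open>x\<close> disappears and no new one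
      arises.\<close>
    define A2 \<pi>2 where "A2 = transpose x y ` A"
      and "\<pi>2 = transpose (\<pi> x) (\<rho> y) \<circ> \<pi> \<circ> transpose x y"
    note reroute = N_reroute[OF okA x(1) yn y(2) im rel', folded A2_def \<pi>2_def]
    have proper2: "proper n R A2 \<pi>2 R'"
      using proper_reroute[OF y(2) rel' less.prems(1)] reroute(2) unfolding A2_def \<pi>2_def by blast
    have match2: "matching R A2 \<pi>2 R' = matching R B \<rho> R'"
      using matching_reroute[OF y(2) rel'] less.prems(2) unfolding A2_def \<pi>2_def by (rule trans)
    have A2: "z \<in> A2 \<longleftrightarrow> transpose x y z \<in> A" for z
      unfolding A2_def by (metis image_iff transpose_involutory)
    have "z \<in> ?bad A \<pi> - {x}" if z: "z \<in> ?bad A2 \<pi>2" for z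
    proof -
      have zA: "transpose x y z \<notin> A" using z A2 by blast
      have zy: "z \<noteq> y" using z y(1) by (auto simp: \<pi>2_def)
      have zx: "z \<noteq> x"
      proof
        assume "z = x"
        then have "y \<notin> A" using zA by simp
        then have "y = x" using proper_inj[OF less.prems(1) x(2) _] y(2) by blast
        then show False using zy \<open>z = x\<close> by simp
      qed
      have tz: "transpose x y z = z" using zx zy by simp
      have "\<pi> z \<noteq> \<pi> x" using zx inj_eq[OF permutes_inj[OF \<pi>]] by simp
      moreover have "\<pi> z \<noteq> \<rho> y"
      proof
        assume "\<pi> z = \<rho> y"
        then have "z = x" using y(3) zA tz x(2) by (intro proper_inj[OF less.prems(1)]) auto
        then show False using zx by simp
      qed
      ultimately have "\<pi>2 z = \<pi> z" by (simp add: \<pi>2_def tz)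
      then show ?thesis using z zA zx unfolding tz by simp
    qed
    then have "?bad A2 \<pi>2 \<subseteq> ?bad A \<pi> - {x}" by blast
    then have "card (?bad A2 \<pi>2) \<le> card (?bad A \<pi> - {x})" by (intro card_mono) auto
    also have "\<dots> < card (?bad A \<pi>)" using x by (intro card_Diff1_less) auto
    finally have "N R A2 \<pi>2 R' = N R B \<rho> R'" by (rule less.hyps[OF _ proper2 match2])
    then show ?thesis unfolding reroute(1) .
  qed
qed

lemma N_unique:
  assumes "proper n R A \<pi> R'" "proper n Q B \<rho> Q'" "cl R = cl Q" "cl R' = cl Q'"
    and "matching R A \<pi> R' = matching Q B \<rho> Q'"
  shows "N R A \<pi> R' = N Q B \<rho> Q'"
proof -
  have sub: "R \<subseteq> {..n} \<times> {..n}" "R' \<subseteq> {..n} \<times> {..n}" "Q \<subseteq> {..n} \<times> {..n}" "Q' \<subseteq> {..n} \<times> {..n}"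
    using assms(1,2) by (simp_all add: proper_def nf_ok_def)
  have "N Q B \<rho> Q' = N R B \<rho> R'"
    unfolding N_def KK_cong[OF sub(1,3) assms(3)] KK_cong[OF sub(2,4) assms(4)] ..
  moreover have "proper n R B \<rho> R'"
    using assms(2) sub unfolding proper_def nf_ok_def assms(3,4) by simp
  moreover have "matching R A \<pi> R' = matching R B \<rho> R'"
    using assms(5) unfolding matching_def assms(3,4) .
  ultimately show ?thesis using N_unique_aux assms(1) by metis
qed

end

section \<open>Rook partitions as relations between colourings\<close>

text \<open>A rook partition is represented by the pairs of colourings of the upper and of the lower points
  that are constant on blocks and give the rook dots the colour of the additional point 0.
  Two colours suffice to recover the partition, and the product becomes relational composition.\<close>

primrec colour :: "(nat \<Rightarrow> bool) \<Rightarrow> (nat \<Rightarrow> bool) \<Rightarrow> (nat \<Rightarrow> bool) \<Rightarrow> vertex \<Rightarrow> bool" where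
  "colour F M G (Upper i) = F i"
| "colour F M G (Middle i) = M i"
| "colour F M G (Lower i) = G i"

definition compatible :: "nat \<Rightarrow> (vertex \<Rightarrow> bool) \<Rightarrow> bool \<Rightarrow> vertex set set \<Rightarrow> bool" where
  "compatible n \<chi> z \<alpha> \<longleftrightarrow> (\<forall>A\<in>\<alpha>. \<forall>u\<in>A. \<forall>v\<in>A. \<chi> u = \<chi> v) \<and>
     (\<forall>u \<in> (uppers n \<union> lowers n) - \<Union>\<alpha>. \<chi> u = z)"

text \<open>The middle colouring is a dummy. Requiring agreement off \<open>{1..n}\<close> gives 0
  the same colour above and below and makes the identity partition correspond exactly to
  \<open>Id\<close>.\<close>

definition colourings :: "nat \<Rightarrow> vertex set set \<Rightarrow> ((nat \<Rightarrow> bool) \<times> (nat \<Rightarrow> bool)) set" where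
  "colourings n \<alpha> = {(F, G). compatible n (colour F (\<lambda>_. False) G) (F 0) \<alpha> \<and> (\<forall>x. x \<notin> {1..n} \<longrightarrow> F x = G x)}"

lemma rook_partitionsD:
  assumes "\<alpha> \<in> rook_partitions n"
  shows "\<Union>\<alpha> \<subseteq> uppers n \<union> lowers n" "{} \<notin> \<alpha>"
    "A \<in> \<alpha> \<Longrightarrow> B \<in> \<alpha> \<Longrightarrow> v \<in> A \<Longrightarrow> v \<in> B \<Longrightarrow> A = B"
proof -
  show "\<Union>\<alpha> \<subseteq> uppers n \<union> lowers n" "{} \<notin> \<alpha>"
    using assms by (simp_all add: rook_partitions_def)
  show "A = B" if "A \<in> \<alpha>" "B \<in> \<alpha>" "v \<in> A" "v \<in> B"
  proof (rule ccontr)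
    assume "A \<noteq> B"
    then have "A \<inter> B = {}" using assms that(1,2) by (intro disjointD) (simp_all add: rook_partitions_def)
    then show False using that(3,4) by blast
  qed
qed

lemma colouringsI_of_vertex_colouring:
  assumes \<alpha>: "\<alpha> \<in> rook_partitions n" and "compatible n \<chi> z \<alpha>"
  defines "F \<equiv> \<lambda>i. if i \<in> {1..n} then \<chi> (Upper i) else z"
    and "G \<equiv> \<lambda>i. if i \<in> {1..n} then \<chi> (Lower i) else z"
  shows "(F, G) \<in> colourings n \<alpha>"
proof -
  have eq: "colour F (\<lambda>_. False) G v = \<chi> v" if "v \<in> uppers n \<union> lowers n" for v
    using that by (auto simp: F_def G_def)
  have vertex: "v \<in> uppers n \<union> lowers n" if "v \<in> A" "A \<in> \<alpha>" for v A
    using rook_partitionsD(1)[OF \<alpha>] that by blast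
  have "compatible n (colour F (\<lambda>_. False) G) z \<alpha>"
    unfolding compatible_def
  proof (intro conjI ballI)
    fix A u v assume A: "A \<in> \<alpha>" "u \<in> A" "v \<in> A"
    then have "\<chi> u = \<chi> v" using assms(2) unfolding compatible_def by blast
    then show "colour F (\<lambda>_. False) G u = colour F (\<lambda>_. False) G v"
      unfolding eq[OF vertex[OF A(2,1)]] eq[OF vertex[OF A(3,1)]] .
  next
    fix u assume u: "u \<in> uppers n \<union> lowers n - \<Union>\<alpha>"
    then have "\<chi> u = z" using assms(2) unfolding compatible_def by blast
    then show "colour F (\<lambda>_. False) G u = z" using eq[of u] u by simp
  qed
  moreover have "F 0 = z" by (simp add: F_def)
  ultimately show ?thesis by (simp add: colourings_def) (simp add: F_def G_def)
qed

lemma colour_of_vertex_colouring: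
  assumes "v \<in> uppers n \<union> lowers n"
  shows "colour (\<lambda>i. if i \<in> {1..n} then \<chi> (Upper i) else z) M
    (\<lambda>i. if i \<in> {1..n} then \<chi> (Lower i) else z) v = \<chi> v"
  using assms by auto

lemma colourings_sameD:
  assumes "(F, G) \<in> colourings n \<alpha>" "A \<in> \<alpha>" "u \<in> A" "v \<in> A"
  shows "colour F (\<lambda>_. False) G u = colour F (\<lambda>_. False) G v"
  using assms unfolding colourings_def compatible_def mem_Collect_eq prod.case by blast

lemma colourings_dotD:
  assumes "(F, G) \<in> colourings n \<alpha>" "u \<in> uppers n \<union> lowers n" "u \<notin> \<Union>\<alpha>"
  shows "colour F (\<lambda>_. False) G u = F 0"
  using assms unfolding colourings_def compatible_def mem_Collect_eq prod.case by blast

lemma block_colouring: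
  assumes "\<alpha> \<in> rook_partitions n" "A \<in> \<alpha>"
  obtains F G where "(F, G) \<in> colourings n \<alpha>" "\<not> F 0"
    "\<And>v. v \<in> uppers n \<union> lowers n \<Longrightarrow> colour F (\<lambda>_. False) G v \<longleftrightarrow> v \<in> A"
proof -
  have "compatible n (\<lambda>v. v \<in> A) False \<alpha>"
    using rook_partitionsD(3)[OF assms(1)] assms(2) unfolding compatible_def by blast
  from colouringsI_of_vertex_colouring[OF assms(1) this]
  show ?thesis
    by (rule that) (simp, rule colour_of_vertex_colouring[where \<chi> = "\<lambda>v. v \<in> A"])
qed

text \<open>The indicator function of a block is a colouring with 0 coloured \<open>False\<close>:
  it separates the block from the dots and from all other blocks. A vertex that is ever coloured
  differently from 0 is no dot.\<close>

lemma block_iff_colourings: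
  assumes "\<alpha> \<in> rook_partitions n" "u \<in> uppers n \<union> lowers n" "v \<in> uppers n \<union> lowers n"
  shows "(\<exists>A\<in>\<alpha>. u \<in> A \<and> v \<in> A) \<longleftrightarrow>
    (\<exists>(F, G) \<in> colourings n \<alpha>. colour F (\<lambda>_. False) G u \<noteq> F 0) \<and>
    (\<forall>(F, G) \<in> colourings n \<alpha>. colour F (\<lambda>_. False) G u = colour F (\<lambda>_. False) G v)"
    (is "?L \<longleftrightarrow> ?M \<and> ?R")
proof
  assume ?L
  then obtain A where A: "A \<in> \<alpha>" "u \<in> A" "v \<in> A" by blast
  obtain F G where "(F, G) \<in> colourings n \<alpha>" "\<not> F 0"
    "\<And>v. v \<in> uppers n \<union> lowers n \<Longrightarrow> colour F (\<lambda>_. False) G v \<longleftrightarrow> v \<in> A"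
    using block_colouring[OF assms(1) A(1)] by metis
  then have ?M using A(2) assms(2) by blast
  moreover have ?R using colourings_sameD A by blast
  ultimately show "?M \<and> ?R" by blast
next
  assume MR: "?M \<and> ?R"
  then obtain A where A: "A \<in> \<alpha>" "u \<in> A" using colourings_dotD[OF _ assms(2)] by blast
  obtain F G where FG: "(F, G) \<in> colourings n \<alpha>"
    "\<And>v. v \<in> uppers n \<union> lowers n \<Longrightarrow> colour F (\<lambda>_. False) G v \<longleftrightarrow> v \<in> A"
    using block_colouring[OF assms(1) A(1)] by metis
  then have "v \<in> A" using MR A(2) assms(2,3) by blast
  then show ?L using A by blast
qed

lemma colourings_inj:
  assumes "\<alpha> \<in> rook_partitions n" "\<beta> \<in> rook_partitions n" "colourings n \<alpha> = colourings n \<beta>"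
  shows "\<alpha> = \<beta>"
proof -
  have sub: "\<alpha> \<subseteq> \<beta>" if \<alpha>: "\<alpha> \<in> rook_partitions n" and \<beta>: "\<beta> \<in> rook_partitions n"
    and eq: "colourings n \<alpha> = colourings n \<beta>" for \<alpha> \<beta>
  proof
    fix A assume A: "A \<in> \<alpha>"
    have same: "(\<exists>A\<in>\<alpha>. u \<in> A \<and> v \<in> A) \<longleftrightarrow> (\<exists>A\<in>\<beta>. u \<in> A \<and> v \<in> A)"
      if "u \<in> uppers n \<union> lowers n" "v \<in> uppers n \<union> lowers n" for u v
      unfolding block_iff_colourings[OF \<alpha> that] block_iff_colourings[OF \<beta> that] eq ..
    have in_\<alpha>: "w \<in> uppers n \<union> lowers n" if "w \<in> C" "C \<in> \<alpha>" for w C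
      using rook_partitionsD(1)[OF \<alpha>] that by blast
    have in_\<beta>: "w \<in> uppers n \<union> lowers n" if "w \<in> C" "C \<in> \<beta>" for w C
      using rook_partitionsD(1)[OF \<beta>] that by blast
    obtain u where u: "u \<in> A" using rook_partitionsD(2)[OF \<alpha>] A by (metis ex_in_conv)
    then obtain B where B: "B \<in> \<beta>" "u \<in> B" using same[of u u] in_\<alpha>[OF u A] A by blast
    have "A = B"
    proof (intro equalityI subsetI)
      fix v assume v: "v \<in> A"
      then obtain C where "C \<in> \<beta>" "u \<in> C" "v \<in> C" using same[of u v] in_\<alpha>[OF _ A] A u by blast
      then show "v \<in> B" using rook_partitionsD(3)[OF \<beta> B(1)] B(2) by blast
    next
      fix v assume v: "v \<in> B"
      then obtain C where "C \<in> \<alpha>" "u \<in> C" "v \<in> C"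
        using same[of u v] in_\<alpha>[OF u A] in_\<beta>[OF v B(1)] B by blast
      then show "v \<in> A" using rook_partitionsD(3)[OF \<alpha> A] u by blast
    qed
    then show "A \<in> \<beta>" using B by simp
  qed
  show ?thesis using sub[OF assms] sub[OF assms(2,1) assms(3)[symmetric]] by blast
qed

section \<open>The product of rook partitions as relational composition\<close>

lemma adjacent_sym: "(x, y) \<in> adjacent \<alpha> \<beta> \<Longrightarrow> (y, x) \<in> adjacent \<alpha> \<beta>"
  by (auto simp: adjacent_def)

lemma connected_sym: "(x, y) \<in> (adjacent \<alpha> \<beta>)\<^sup>* \<Longrightarrow> (y, x) \<in> (adjacent \<alpha> \<beta>)\<^sup>*"
  by (rule symD[OF sym_rtrancl[OF symI[OF adjacent_sym]]])

lemma rook_product_closed: "rook_product n \<alpha> \<beta> \<in> rook_partitions n"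
proof -
  define V where "V = (uppers n \<union> lowers n) - product_dots n \<alpha> \<beta>"
  have eq: "rook_product n \<alpha> \<beta> = {{y \<in> V. (x, y) \<in> (adjacent \<alpha> \<beta>)\<^sup>*} | x. x \<in> V}"
    by (simp add: rook_product_def V_def)
  have "A = B" if "A \<in> rook_product n \<alpha> \<beta>" "B \<in> rook_product n \<alpha> \<beta>" "v \<in> A" "v \<in> B" for A B v
  proof -
    obtain x where A: "A = {y \<in> V. (x, y) \<in> (adjacent \<alpha> \<beta>)\<^sup>*}" using \<open>A \<in> _\<close> eq by blast
    obtain x' where B: "B = {y \<in> V. (x', y) \<in> (adjacent \<alpha> \<beta>)\<^sup>*}" using \<open>B \<in> _\<close> eq by blast
    have "(x, v) \<in> (adjacent \<alpha> \<beta>)\<^sup>*" "(x', v) \<in> (adjacent \<alpha> \<beta>)\<^sup>*"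
      using that(3,4) unfolding A B by simp_all
    then have xx': "(x, x') \<in> (adjacent \<alpha> \<beta>)\<^sup>*" by (rule rtrancl_trans[OF _ connected_sym])
    have "(x, y) \<in> (adjacent \<alpha> \<beta>)\<^sup>* \<longleftrightarrow> (x', y) \<in> (adjacent \<alpha> \<beta>)\<^sup>*" for y
      using rtrancl_trans[OF xx'] rtrancl_trans[OF connected_sym[OF xx']] by blast
    then show ?thesis unfolding A B by simp
  qed
  then have "disjoint (rook_product n \<alpha> \<beta>)" unfolding disjoint_def by blast
  moreover have "{} \<notin> rook_product n \<alpha> \<beta>" unfolding eq by auto
  moreover have "\<Union>(rook_product n \<alpha> \<beta>) \<subseteq> uppers n \<union> lowers n" unfolding eq V_def by auto
  ultimately show ?thesis by (simp add: rook_partitions_def)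
qed

lemma colourings_relabel_down:
  assumes "\<alpha> \<in> rook_partitions n" "(F, M) \<in> colourings n \<alpha>"
  shows "A \<in> relabel_down \<alpha> \<Longrightarrow> u \<in> A \<Longrightarrow> v \<in> A \<Longrightarrow> colour F M G u = colour F M G v"
    and "u \<in> uppers n \<union> middles n \<Longrightarrow> u \<notin> \<Union>(relabel_down \<alpha>) \<Longrightarrow> colour F M G u = F 0"
proof -
  have eq: "colour F M G (lower_to_middle v) = colour F (\<lambda>_. False) M v"
    if "v \<in> uppers n \<union> lowers n" for v
    using that by auto
  have in_\<alpha>: "w \<in> uppers n \<union> lowers n" if "w \<in> C" "C \<in> \<alpha>" for w C
    using rook_partitionsD(1)[OF assms(1)] that by blast
  show "colour F M G u = colour F M G v" if A: "A \<in> relabel_down \<alpha>" and uv: "u \<in> A" "v \<in> A"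
  proof -
    obtain B where B: "B \<in> \<alpha>" "A = lower_to_middle ` B" using A by (auto simp: relabel_down_def)
    then obtain u' v' where u'v': "u' \<in> B" "v' \<in> B" and "u = lower_to_middle u'" "v = lower_to_middle v'"
      using uv by blast
    then show ?thesis
      using eq[OF in_\<alpha>[OF u'v'(1) B(1)]] eq[OF in_\<alpha>[OF u'v'(2) B(1)]]
        colourings_sameD[OF assms(2) B(1) u'v'] by simp
  qed
  show "colour F M G u = F 0" if u: "u \<in> uppers n \<union> middles n" "u \<notin> \<Union>(relabel_down \<alpha>)"
  proof -
    have "uppers n \<union> middles n = lower_to_middle ` (uppers n \<union> lowers n)"
      by (simp add: image_Un image_image)
    then obtain u' where u': "u' \<in> uppers n \<union> lowers n" "u = lower_to_middle u'"
      using u(1) by blast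
    then have "u' \<notin> \<Union>\<alpha>" using u(2) by (auto simp: relabel_down_def)
    then show ?thesis using eq[OF u'(1)] colourings_dotD[OF assms(2) u'(1)] u'(2) by simp
  qed
qed

lemma colourings_relabel_up:
  assumes "\<beta> \<in> rook_partitions n" "(M, G) \<in> colourings n \<beta>"
  shows "A \<in> relabel_up \<beta> \<Longrightarrow> u \<in> A \<Longrightarrow> v \<in> A \<Longrightarrow> colour F M G u = colour F M G v"
    and "u \<in> middles n \<union> lowers n \<Longrightarrow> u \<notin> \<Union>(relabel_up \<beta>) \<Longrightarrow> colour F M G u = M 0"
proof -
  have eq: "colour F M G (upper_to_middle v) = colour M (\<lambda>_. False) G v"
    if "v \<in> uppers n \<union> lowers n" for v
    using that by auto
  have in_\<beta>: "w \<in> uppers n \<union> lowers n" if "w \<in> C" "C \<in> \<beta>" for w C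
    using rook_partitionsD(1)[OF assms(1)] that by blast
  show "colour F M G u = colour F M G v" if A: "A \<in> relabel_up \<beta>" and uv: "u \<in> A" "v \<in> A"
  proof -
    obtain B where B: "B \<in> \<beta>" "A = upper_to_middle ` B" using A by (auto simp: relabel_up_def)
    then obtain u' v' where u'v': "u' \<in> B" "v' \<in> B" and "u = upper_to_middle u'" "v = upper_to_middle v'"
      using uv by blast
    then show ?thesis
      using eq[OF in_\<beta>[OF u'v'(1) B(1)]] eq[OF in_\<beta>[OF u'v'(2) B(1)]]
        colourings_sameD[OF assms(2) B(1) u'v'] by simp
  qed
  show "colour F M G u = M 0" if u: "u \<in> middles n \<union> lowers n" "u \<notin> \<Union>(relabel_up \<beta>)"
  proof -
    have "middles n \<union> lowers n = upper_to_middle ` (uppers n \<union> lowers n)"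
      by (simp add: image_Un image_image)
    then obtain u' where u': "u' \<in> uppers n \<union> lowers n" "u = upper_to_middle u'"
      using u(1) by blast
    then have "u' \<notin> \<Union>\<beta>" using u(2) by (auto simp: relabel_up_def)
    then show ?thesis using eq[OF u'(1)] colourings_dotD[OF assms(2) u'(1)] u'(2) by simp
  qed
qed

text \<open>A common middle colouring \<open>M\<close> glues the two colourings into one of the
  three-layered product graph. It is constant along edges and gives every white vertex the colour of
  0.\<close>

lemma relcomp_subset_colourings:
  assumes "\<alpha> \<in> rook_partitions n" "\<beta> \<in> rook_partitions n"
  shows "colourings n \<alpha> O colourings n \<beta> \<subseteq> colourings n (rook_product n \<alpha> \<beta>)"
proof clarify
  fix F M G assume FM: "(F, M) \<in> colourings n \<alpha>" and MG: "(M, G) \<in> colourings n \<beta>"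
  have outside: "F x = G x" "F x = M x" if "x \<notin> {1..n}" for x
    using FM MG that unfolding colourings_def by blast+
  have zero: "M 0 = F 0" using outside(2)[of 0] by simp
  have adj: "colour F M G u = colour F M G v" if "(u, v) \<in> adjacent \<alpha> \<beta>" for u v
    using that colourings_relabel_down(1)[OF assms(1) FM] colourings_relabel_up(1)[OF assms(2) MG]
    unfolding adjacent_def by blast
  have conn: "colour F M G u = colour F M G v" if "(u, v) \<in> (adjacent \<alpha> \<beta>)\<^sup>*" for u v
    using that by (induction rule: rtrancl_induct) (use adj in auto)
  have white: "colour F M G u = F 0" if "u \<in> white n \<alpha> \<beta>" for u
    using that colourings_relabel_down(2)[OF assms(1) FM] colourings_relabel_up(2)[OF assms(2) MG] zero
    unfolding white_def by blast
  have eq: "colour F (\<lambda>_. False) G v = colour F M G v" if "v \<in> uppers n \<union> lowers n" for v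
    using that by auto
  define V where "V = (uppers n \<union> lowers n) - product_dots n \<alpha> \<beta>"
  have prod: "rook_product n \<alpha> \<beta> = {{y \<in> V. (x, y) \<in> (adjacent \<alpha> \<beta>)\<^sup>*} | x. x \<in> V}"
    by (simp add: rook_product_def V_def)
  have VU: "v \<in> uppers n \<union> lowers n" if "v \<in> V" for v using that unfolding V_def by blast
  have same: "colour F (\<lambda>_. False) G u = colour F (\<lambda>_. False) G v"
    if A: "A \<in> rook_product n \<alpha> \<beta>" and uv: "u \<in> A" "v \<in> A" for A u v
  proof -
    obtain x where x: "A = {y \<in> V. (x, y) \<in> (adjacent \<alpha> \<beta>)\<^sup>*}" using A prod by blast
    have "colour F M G x = colour F M G u" "colour F M G x = colour F M G v"
      using uv unfolding x by (simp_all only: mem_Collect_eq conn)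
    moreover have "u \<in> V" "v \<in> V" using uv x by auto
    ultimately show ?thesis using eq VU by simp
  qed
  have dots: "colour F (\<lambda>_. False) G u = F 0"
    if u: "u \<in> uppers n \<union> lowers n" "u \<notin> \<Union>(rook_product n \<alpha> \<beta>)" for u
  proof -
    have "u \<notin> V" using u(2) unfolding prod by blast
    then have "u \<in> product_dots n \<alpha> \<beta>" using u(1) unfolding V_def by blast
    then obtain w where "w \<in> white n \<alpha> \<beta>" "(u, w) \<in> (adjacent \<alpha> \<beta>)\<^sup>*"
      by (auto simp: product_dots_def)
    then show ?thesis using conn white eq[OF u(1)] by metis
  qed
  show "(F, G) \<in> colourings n (rook_product n \<alpha> \<beta>)"
    unfolding colourings_def compatible_def mem_Collect_eq prod.case
    using same dots outside(1) by blast
qed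

text \<open>Here the middle colouring must be found. Each component of the product graph that
  touches the outer layers inherits their colour, which is unambiguous because the outer points of a
  component form a block or are all dots.\<close>

lemma colourings_subset_relcomp:
  assumes "\<alpha> \<in> rook_partitions n" "\<beta> \<in> rook_partitions n"
  shows "colourings n (rook_product n \<alpha> \<beta>) \<subseteq> colourings n \<alpha> O colourings n \<beta>"
proof clarify
  fix F G assume FG: "(F, G) \<in> colourings n (rook_product n \<alpha> \<beta>)"
  define V where "V = (uppers n \<union> lowers n) - product_dots n \<alpha> \<beta>"
  have prod: "rook_product n \<alpha> \<beta> = {{y \<in> V. (x, y) \<in> (adjacent \<alpha> \<beta>)\<^sup>*} | x. x \<in> V}"
    by (simp add: rook_product_def V_def)
  define \<phi> where "\<phi> = colour F (\<lambda>_. False) G"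
  define reaches_white where "reaches_white v \<longleftrightarrow> (\<exists>w\<in>white n \<alpha> \<beta>. (v, w) \<in> (adjacent \<alpha> \<beta>)\<^sup>*)" for v
  \<comment> \<open>Components reaching a white vertex take the colour of 0. A component that
    contains neither a white nor an outer vertex is unconstrained; the existential gives it
    \<open>False\<close>.\<close>
  define \<chi> where "\<chi> v = (if reaches_white v then F 0 else
      (\<exists>u \<in> uppers n \<union> lowers n. (v, u) \<in> (adjacent \<alpha> \<beta>)\<^sup>* \<and> \<phi> u))" for v
  have conn: "\<chi> u = \<chi> v" if uv: "(u, v) \<in> (adjacent \<alpha> \<beta>)\<^sup>*" for u v
  proof -
    have "(u, w) \<in> (adjacent \<alpha> \<beta>)\<^sup>* \<longleftrightarrow> (v, w) \<in> (adjacent \<alpha> \<beta>)\<^sup>*" for w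
      using rtrancl_trans[OF uv] rtrancl_trans[OF connected_sym[OF uv]] by blast
    then show ?thesis by (simp add: \<chi>_def reaches_white_def)
  qed
  have outer: "\<chi> u = \<phi> u" if u: "u \<in> uppers n \<union> lowers n" for u
  proof (cases "reaches_white u")
    case True
    then have "u \<in> product_dots n \<alpha> \<beta>" using u by (auto simp: product_dots_def reaches_white_def)
    then have "u \<notin> \<Union>(rook_product n \<alpha> \<beta>)" unfolding prod V_def by auto
    then show ?thesis using colourings_dotD[OF FG u] True by (simp add: \<chi>_def \<phi>_def)
  next
    case False
    have same: "\<phi> v = \<phi> u" if v: "v \<in> uppers n \<union> lowers n" "(u, v) \<in> (adjacent \<alpha> \<beta>)\<^sup>*" for v
    proof -
      have "\<not> reaches_white v"
        using False v(2) rtrancl_trans[OF v(2)] unfolding reaches_white_def by blast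
      then have "u \<in> V" "v \<in> V"
        using False u v(1) by (auto simp: V_def product_dots_def reaches_white_def)
      then have "{y \<in> V. (u, y) \<in> (adjacent \<alpha> \<beta>)\<^sup>*} \<in> rook_product n \<alpha> \<beta>" unfolding prod by blast
      then show ?thesis
        unfolding \<phi>_def by (rule colourings_sameD[OF FG]) (use \<open>u \<in> V\<close> \<open>v \<in> V\<close> v in auto)
    qed
    have "\<chi> u \<longleftrightarrow> (\<exists>w \<in> uppers n \<union> lowers n. (u, w) \<in> (adjacent \<alpha> \<beta>)\<^sup>* \<and> \<phi> w)"
      using False by (simp add: \<chi>_def)
    also have "\<dots> \<longleftrightarrow> \<phi> u" using same u rtrancl.rtrancl_refl[of u "adjacent \<alpha> \<beta>"] by blast
    finally show ?thesis .
  qed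
  have white: "\<chi> u = F 0" if "u \<in> white n \<alpha> \<beta>" for u
    using that by (auto simp: \<chi>_def reaches_white_def)
  have outside: "F x = G x" if "x \<notin> {1..n}" for x
    using FG that unfolding colourings_def by blast
  \<comment> \<open>Copying \<open>F\<close> off \<open>{1..n}\<close> gives
    \<open>M 0 = F 0\<close>, the colour that the dots of \<open>\<beta>\<close> have to
    take.\<close>
  define M where "M i = (if i \<in> {1..n} then \<chi> (Middle i) else F i)" for i
  have F: "F i = \<chi> (Upper i)" "G i = \<chi> (Lower i)" if "i \<in> {1..n}" for i
    using outer that by (simp_all add: \<phi>_def)
  have down: "colour F (\<lambda>_. False) M v = \<chi> (lower_to_middle v)" if "v \<in> uppers n \<union> lowers n" for v
    using that F by (auto simp: M_def)
  have up: "colour M (\<lambda>_. False) G v = \<chi> (upper_to_middle v)" if "v \<in> uppers n \<union> lowers n" for v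
    using that F by (auto simp: M_def)
  have adj: "\<chi> u = \<chi> v" if "A \<in> relabel_down \<alpha> \<union> relabel_up \<beta>" "u \<in> A" "v \<in> A" for A u v
    using that by (intro conn r_into_rtrancl) (auto simp: adjacent_def)
  have "(F, M) \<in> colourings n \<alpha>"
  proof -
    have in_\<alpha>: "w \<in> uppers n \<union> lowers n" if "w \<in> C" "C \<in> \<alpha>" for w C
      using rook_partitionsD(1)[OF assms(1)] that by blast
    have "colour F (\<lambda>_. False) M u = colour F (\<lambda>_. False) M v" if A: "A \<in> \<alpha>" "u \<in> A" "v \<in> A" for A u v
      unfolding down[OF in_\<alpha>[OF A(2,1)]] down[OF in_\<alpha>[OF A(3,1)]]
      using A by (intro adj[of "lower_to_middle ` A"]) (auto simp: relabel_down_def)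
    moreover have "colour F (\<lambda>_. False) M u = F 0"
      if u: "u \<in> uppers n \<union> lowers n" "u \<notin> \<Union>\<alpha>" for u
    proof -
      have "lower_to_middle u \<notin> \<Union>(relabel_down \<alpha>)"
      proof
        assume "lower_to_middle u \<in> \<Union>(relabel_down \<alpha>)"
        then obtain C w where w: "C \<in> \<alpha>" "w \<in> C" "lower_to_middle u = lower_to_middle w"
          by (auto simp: relabel_down_def)
        have "u = w" using w(3) in_\<alpha>[OF w(2,1)] u(1) by auto
        then show False using u(2) w by blast
      qed
      then have "lower_to_middle u \<in> white n \<alpha> \<beta>" using u(1) unfolding white_def by auto
      then show ?thesis unfolding down[OF u(1)] by (rule white)
    qed
    moreover have "F x = M x" if "x \<notin> {1..n}" for x unfolding M_def if_not_P[OF that] ..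
    ultimately show ?thesis unfolding colourings_def compatible_def mem_Collect_eq prod.case by blast
  qed
  moreover have "(M, G) \<in> colourings n \<beta>"
  proof -
    have in_\<beta>: "w \<in> uppers n \<union> lowers n" if "w \<in> C" "C \<in> \<beta>" for w C
      using rook_partitionsD(1)[OF assms(2)] that by blast
    have "colour M (\<lambda>_. False) G u = colour M (\<lambda>_. False) G v" if A: "A \<in> \<beta>" "u \<in> A" "v \<in> A" for A u v
      unfolding up[OF in_\<beta>[OF A(2,1)]] up[OF in_\<beta>[OF A(3,1)]]
      using A by (intro adj[of "upper_to_middle ` A"]) (auto simp: relabel_up_def)
    moreover have "colour M (\<lambda>_. False) G u = M 0"
      if u: "u \<in> uppers n \<union> lowers n" "u \<notin> \<Union>\<beta>" for u
    proof -
      have "upper_to_middle u \<notin> \<Union>(relabel_up \<beta>)"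
      proof
        assume "upper_to_middle u \<in> \<Union>(relabel_up \<beta>)"
        then obtain C w where w: "C \<in> \<beta>" "w \<in> C" "upper_to_middle u = upper_to_middle w"
          by (auto simp: relabel_up_def)
        have "u = w" using w(3) in_\<beta>[OF w(2,1)] u(1) by auto
        then show False using u(2) w by blast
      qed
      then have "upper_to_middle u \<in> white n \<alpha> \<beta>" using u(1) unfolding white_def by auto
      then have "\<chi> (upper_to_middle u) = F 0" by (rule white)
      then show ?thesis unfolding up[OF u(1)] by (simp add: M_def)
    qed
    moreover have "M x = G x" if "x \<notin> {1..n}" for x unfolding M_def if_not_P[OF that] by (rule outside[OF that])
    ultimately show ?thesis unfolding colourings_def compatible_def mem_Collect_eq prod.case by blast
  qed
  ultimately show "(F, G) \<in> colourings n \<alpha> O colourings n \<beta>" by blast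
qed

lemma colourings_product:
  assumes "\<alpha> \<in> rook_partitions n" "\<beta> \<in> rook_partitions n"
  shows "colourings n (rook_product n \<alpha> \<beta>) = colourings n \<alpha> O colourings n \<beta>"
  using relcomp_subset_colourings[OF assms] colourings_subset_relcomp[OF assms] by blast

section \<open>The relations of the generators, and soundness of the presentation\<close>

definition perm_rel :: "(nat \<Rightarrow> nat) \<Rightarrow> ((nat \<Rightarrow> bool) \<times> (nat \<Rightarrow> bool)) set" where
  "perm_rel \<pi> = {(F, G). \<forall>x. F x = G (\<pi> x)}"

definition free_rel :: "nat \<Rightarrow> ((nat \<Rightarrow> bool) \<times> (nat \<Rightarrow> bool)) set" where
  "free_rel x = {(F, G). \<forall>y. y \<noteq> x \<longrightarrow> F y = G y}"

definition eq_rel :: "nat \<Rightarrow> nat \<Rightarrow> ((nat \<Rightarrow> bool) \<times> (nat \<Rightarrow> bool)) set" where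
  "eq_rel x y = {(F, G). F = G \<and> F x = F y}"

lemma perm_rel_comp: "perm_rel \<pi> O perm_rel \<rho> = perm_rel (\<lambda>x. \<rho> (\<pi> x))"
proof -
  have "(F, H) \<in> perm_rel \<pi> O perm_rel \<rho>" if "(F, H) \<in> perm_rel (\<lambda>x. \<rho> (\<pi> x))" for F H
    using that by (intro relcompI[of F "\<lambda>x. H (\<rho> x)"]) (auto simp: perm_rel_def)
  then show ?thesis by (auto simp: perm_rel_def)
qed

lemma perm_rel_id: "perm_rel (\<lambda>x. x) = Id"
  by (auto simp: perm_rel_def)

lemma perm_rel_conj_iff:
  assumes "\<And>z. \<rho> (\<pi> z) = z" "\<And>z. \<pi> (\<rho> z) = z"
  shows "perm_rel \<pi> O X O perm_rel \<rho> = {(F, G). (\<lambda>z. F (\<rho> z), \<lambda>z. G (\<rho> z)) \<in> X}"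
proof -
  have *: "A = (\<lambda>z. F (\<rho> z))" if "(F, A) \<in> perm_rel \<pi>" for F A
    using that assms(2) by (auto simp: perm_rel_def fun_eq_iff)
  have "B = (\<lambda>z. G (\<rho> z))" if "(B, G) \<in> perm_rel \<rho>" for G B
    using that by (auto simp: perm_rel_def)
  with * have "perm_rel \<pi> O X O perm_rel \<rho> \<subseteq> {(F, G). (\<lambda>z. F (\<rho> z), \<lambda>z. G (\<rho> z)) \<in> X}" by blast
  moreover have "(F, G) \<in> perm_rel \<pi> O X O perm_rel \<rho>" if "(\<lambda>z. F (\<rho> z), \<lambda>z. G (\<rho> z)) \<in> X" for F G
    by (intro relcompI[OF _ relcompI[OF that]]) (simp_all add: perm_rel_def assms)
  ultimately show ?thesis by blast
qed

lemma perm_rel_free: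
  assumes "\<And>z. \<rho> (\<pi> z) = z" "\<And>z. \<pi> (\<rho> z) = z"
  shows "perm_rel \<pi> O free_rel x O perm_rel \<rho> = free_rel (\<rho> x)"
  unfolding perm_rel_conj_iff[OF assms] free_rel_def
proof (intro Collect_cong, clarify)
  fix F G :: "nat \<Rightarrow> bool"
  have "(\<forall>y. y \<noteq> x \<longrightarrow> F (\<rho> y) = G (\<rho> y)) \<longleftrightarrow> (\<forall>y. y \<noteq> \<rho> x \<longrightarrow> F y = G y)"
    using assms by metis
  then show "((\<lambda>z. F (\<rho> z), \<lambda>z. G (\<rho> z)) \<in> {(F, G). \<forall>y. y \<noteq> x \<longrightarrow> F y = G y}) \<longleftrightarrow>
      (\<forall>y. y \<noteq> \<rho> x \<longrightarrow> F y = G y)" by simp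
qed

lemma perm_rel_eq:
  assumes "\<And>z. \<rho> (\<pi> z) = z" "\<And>z. \<pi> (\<rho> z) = z"
  shows "perm_rel \<pi> O eq_rel x y O perm_rel \<rho> = eq_rel (\<rho> x) (\<rho> y)"
proof -
  have "(\<lambda>z. F (\<rho> z)) = (\<lambda>z. G (\<rho> z)) \<longleftrightarrow> F = G" for F G :: "nat \<Rightarrow> bool"
    using assms(1) by (metis ext)
  then show ?thesis unfolding perm_rel_conj_iff[OF assms] eq_rel_def by auto
qed

lemma perm_rel_perm:
  assumes "\<And>z. \<rho> (\<pi> z) = z" "\<And>z. \<pi> (\<rho> z) = z"
  shows "perm_rel \<pi> O perm_rel (transpose a b) O perm_rel \<rho> = perm_rel (transpose (\<rho> a) (\<rho> b))"
proof -
  have "\<rho> (transpose a b (\<pi> z)) = transpose (\<rho> a) (\<rho> b) z" for z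
    using assms by (metis transpose_def)
  then show ?thesis unfolding perm_rel_comp by simp
qed

lemma free_rel_laws:
  "free_rel x O free_rel x = free_rel x"
  "x \<noteq> y \<Longrightarrow> free_rel x O eq_rel x y O free_rel x = free_rel x"
  "x \<noteq> y \<Longrightarrow> eq_rel x y O free_rel x O eq_rel x y = eq_rel x y"
  "x \<noteq> y \<Longrightarrow> x \<noteq> z \<Longrightarrow> free_rel x O eq_rel y z = eq_rel y z O free_rel x"
proof -
  show "free_rel x O free_rel x = free_rel x" by (auto simp: free_rel_def)
  \<comment> \<open>In between, \<open>x\<close> is recoloured like \<open>y\<close>; the link is
    then satisfied, and the second freeing of \<open>x\<close> forgets the change.\<close>
  have "(F, G) \<in> free_rel x O eq_rel x y O free_rel x" if "x \<noteq> y" "(F, G) \<in> free_rel x" for F G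
    using that by (intro relcompI[of F "F(x := F y)"] relcompI[of "F(x := F y)" "F(x := F y)"])
      (auto simp: free_rel_def eq_rel_def)
  then show "free_rel x O eq_rel x y O free_rel x = free_rel x" if "x \<noteq> y"
    using that by (auto simp: free_rel_def eq_rel_def)
  have eqI: "F = G" if "\<forall>z. z \<noteq> x \<longrightarrow> F z = G z" "F x = F y" "G x = G y" "x \<noteq> y" for F G :: "nat \<Rightarrow> bool"
  proof
    fix z show "F z = G z" using that by (cases "z = x") auto
  qed
  show "eq_rel x y O free_rel x O eq_rel x y = eq_rel x y" if "x \<noteq> y"
  proof (intro equalityI subrelI)
    fix F G assume "(F, G) \<in> eq_rel x y O free_rel x O eq_rel x y"
    then have "\<forall>z. z \<noteq> x \<longrightarrow> F z = G z" "F x = F y" "G x = G y"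
      by (auto simp: free_rel_def eq_rel_def)
    then show "(F, G) \<in> eq_rel x y" using eqI that by (simp add: eq_rel_def)
  next
    fix F G assume "(F, G) \<in> eq_rel x y"
    then show "(F, G) \<in> eq_rel x y O free_rel x O eq_rel x y"
      by (intro relcompI[of F F] relcompI[of F G]) (auto simp: free_rel_def eq_rel_def)
  qed
  show "free_rel x O eq_rel y z = eq_rel y z O free_rel x" if "x \<noteq> y" "x \<noteq> z"
  proof (intro equalityI subrelI)
    fix F G assume "(F, G) \<in> free_rel x O eq_rel y z"
    then show "(F, G) \<in> eq_rel y z O free_rel x"
      using that by (intro relcompI[of F F]) (auto simp: free_rel_def eq_rel_def)
  next
    fix F G assume "(F, G) \<in> eq_rel y z O free_rel x"
    then show "(F, G) \<in> free_rel x O eq_rel y z"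
      using that by (intro relcompI[of F G]) (auto simp: free_rel_def eq_rel_def)
  qed
qed

lemma eq_rel_sym: "eq_rel x y = eq_rel y x"
  by (auto simp: eq_rel_def)

lemma eq_rel_commute: "eq_rel x y O eq_rel z w = eq_rel z w O eq_rel x y"
  by (auto simp: eq_rel_def)

primrec letter_rel :: "nat \<Rightarrow> letter \<Rightarrow> ((nat \<Rightarrow> bool) \<times> (nat \<Rightarrow> bool)) set" where
  "letter_rel n Gs = perm_rel (transpose 1 2)"
| "letter_rel n Gc = perm_rel (rotation n)"
| "letter_rel n Ge = free_rel 1"
| "letter_rel n Gq = eq_rel 1 2"
| "letter_rel n Go = eq_rel 0 1"

primrec word_rel :: "nat \<Rightarrow> letter list \<Rightarrow> ((nat \<Rightarrow> bool) \<times> (nat \<Rightarrow> bool)) set" where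
  "word_rel n [] = Id"
| "word_rel n (a # w) = letter_rel n a O word_rel n w"

lemma word_rel_append: "word_rel n (u @ v) = word_rel n u O word_rel n v"
  by (induction u) (auto simp: O_assoc)

lemma word_rel_power:
  "word_rel n w = perm_rel \<pi> \<Longrightarrow> word_rel n (w \<up> k) = perm_rel (\<pi> ^^ k)"
proof (induction k)
  case 0
  then show ?case by (simp add: word_power_def perm_rel_id[symmetric] id_def)
next
  case (Suc k)
  have "word_rel n (w \<up> Suc k) = word_rel n w O word_rel n (w \<up> k)"
    by (simp add: word_power_def word_rel_append)
  also have "\<dots> = perm_rel (\<lambda>x. (\<pi> ^^ k) (\<pi> x))" using Suc by (simp add: perm_rel_comp)
  finally show ?case unfolding funpow_Suc_right comp_def .
qed

lemma rotation_power_apply: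
  "1 \<le> n \<Longrightarrow> k \<le> n \<Longrightarrow> (rotation n ^^ k) x = (if x \<in> {1..n} then if k < x then x - k else x + n - k else x)"
proof (induction k)
  case (Suc k)
  then show ?case by (auto simp: rotation_apply)
qed auto

lemma rotation_power_inverse:
  assumes "1 \<le> n" "k + l = n"
  shows "(rotation n ^^ k) ((rotation n ^^ l) x) = x"
proof -
  have "(rotation n ^^ k) ((rotation n ^^ l) x) = (rotation n ^^ n) x"
    unfolding assms(2)[symmetric] funpow_add by simp
  then show ?thesis using assms(1) by (simp add: rotation_power_apply)
qed

lemma word_rel_rotation_power: "word_rel n ([Gc] \<up> k) = perm_rel (rotation n ^^ k)"
  by (rule word_rel_power) simp

lemma rotation_power_cancel:
  assumes "1 \<le> n" "k \<le> n"
  shows "(rotation n ^^ (n - k)) ((rotation n ^^ k) z) = z" "(rotation n ^^ k) ((rotation n ^^ (n - k)) z) = z"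
  using assms rotation_power_inverse[of n "n - k" k] rotation_power_inverse[of n k "n - k"]
  by simp_all

lemma word_rel_adjacent:
  assumes "k + 2 \<le> n"
  shows "word_rel n ([Gc] \<up> k @ [Gs] @ [Gc] \<up> (n - k)) = perm_rel (transpose (k + 1) (k + 2))"
proof -
  have n: "1 \<le> n" "k \<le> n" using assms by auto
  have vals: "(rotation n ^^ (n - k)) 1 = k + 1" "(rotation n ^^ (n - k)) 2 = k + 2"
    using assms by (auto simp: rotation_power_apply)
  have "word_rel n ([Gc] \<up> k @ [Gs] @ [Gc] \<up> (n - k)) =
      perm_rel (rotation n ^^ k) O perm_rel (transpose 1 2) O perm_rel (rotation n ^^ (n - k))"
    by (simp add: word_rel_append word_rel_rotation_power)
  also have "\<dots> = perm_rel (transpose ((rotation n ^^ (n - k)) 1) ((rotation n ^^ (n - k)) 2))"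
    using rotation_power_cancel[OF n] by (intro perm_rel_perm)
  finally show ?thesis unfolding vals .
qed

lemma perm_rel_comp_assoc: "perm_rel \<pi> O perm_rel \<rho> O X = perm_rel (\<lambda>x. \<rho> (\<pi> x)) O X"
  unfolding perm_rel_comp[symmetric] by (simp only: O_assoc)

lemma swap_12_laws:
  defines "\<tau> \<equiv> transpose 1 (2::nat)"
  shows "perm_rel \<tau> O free_rel 1 O perm_rel \<tau> O free_rel 1 = free_rel 1 O perm_rel \<tau> O free_rel 1"
    "free_rel 1 O perm_rel \<tau> O free_rel 1 O perm_rel \<tau> = free_rel 1 O perm_rel \<tau> O free_rel 1"
    "perm_rel \<tau> O eq_rel 0 1 O perm_rel \<tau> O eq_rel 0 1 = eq_rel 0 1 O perm_rel \<tau> O eq_rel 0 1"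
    "eq_rel 0 1 O perm_rel \<tau> O eq_rel 0 1 O perm_rel \<tau> = eq_rel 0 1 O perm_rel \<tau> O eq_rel 0 1"
    "eq_rel 0 1 O perm_rel \<tau> O eq_rel 0 1 = eq_rel 0 1 O eq_rel 1 2"
    "perm_rel \<tau> O eq_rel 0 1 O perm_rel \<tau> = eq_rel 0 2"
    "eq_rel 1 2 O perm_rel \<tau> = eq_rel 1 2" "perm_rel \<tau> O eq_rel 1 2 = eq_rel 1 2"
proof -
  have \<tau>: "\<tau> (\<tau> z) = z" for z by (simp add: \<tau>_def)
  have vals: "\<tau> 0 = 0" "\<tau> 1 = 2" "\<tau> 2 = 1" by (simp_all add: \<tau>_def transpose_def)
  have free: "perm_rel \<tau> O free_rel 1 O perm_rel \<tau> = free_rel 2"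
    unfolding perm_rel_free[where \<pi> = \<tau> and \<rho> = \<tau>, OF \<tau> \<tau>] vals ..
  show eq: "perm_rel \<tau> O eq_rel 0 1 O perm_rel \<tau> = eq_rel 0 2"
    unfolding perm_rel_eq[where \<pi> = \<tau> and \<rho> = \<tau>, OF \<tau> \<tau>] vals ..
  \<comment> \<open>The common value of all products that cut both 1 and 2.\<close>
  define D where "D = {(F::nat \<Rightarrow> bool, G). \<forall>y. y \<noteq> 1 \<and> y \<noteq> 2 \<longrightarrow> F y = G y}"
  have "(F, G) \<in> free_rel 2 O free_rel 1" if "(F, G) \<in> D" for F G
    using that by (intro relcompI[of F "F(2 := G 2)"]) (auto simp: D_def free_rel_def)
  moreover have "free_rel 2 O free_rel 1 \<subseteq> D" by (auto simp: D_def free_rel_def)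
  ultimately have D1: "free_rel 2 O free_rel 1 = D" by (intro equalityI subrelI) blast+
  have "(F, G) \<in> free_rel 1 O free_rel 2" if "(F, G) \<in> D" for F G
    using that by (intro relcompI[of F "F(1 := G 1)"]) (auto simp: D_def free_rel_def)
  moreover have "free_rel 1 O free_rel 2 \<subseteq> D" by (auto simp: D_def free_rel_def)
  ultimately have D2: "free_rel 1 O free_rel 2 = D" by (intro equalityI subrelI) blast+
  \<comment> \<open>The swap sits between two free choices at 1. The left one must anticipate
    \<open>G 2\<close> and the right one must record \<open>F 2\<close>, since these are the values
    that cross.\<close>
  have "(F, G) \<in> free_rel 1 O perm_rel \<tau> O free_rel 1" if "(F, G) \<in> D" for F G
    using that
    by (intro relcompI[of F "F(1 := G 2)"] relcompI[of "F(1 := G 2)" "G(1 := F 2)"])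
      (auto simp: D_def free_rel_def perm_rel_def \<tau>_def transpose_def)
  moreover have "(F, G) \<in> D" if FG: "(F, G) \<in> free_rel 1 O perm_rel \<tau> O free_rel 1" for F G
  proof -
    obtain A B where "(F, A) \<in> free_rel 1" "(A, B) \<in> perm_rel \<tau>" "(B, G) \<in> free_rel 1"
      using FG by blast
    moreover have "\<tau> y = y" if "y \<noteq> 1" "y \<noteq> 2" for y using that by (simp add: \<tau>_def transpose_def)
    ultimately show ?thesis by (simp add: D_def free_rel_def perm_rel_def)
  qed
  ultimately have D3: "free_rel 1 O perm_rel \<tau> O free_rel 1 = D" by (intro equalityI subrelI)
  have "perm_rel \<tau> O free_rel 1 O perm_rel \<tau> O free_rel 1 = free_rel 2 O free_rel 1"
    unfolding free[symmetric] by (simp only: O_assoc)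
  then show "perm_rel \<tau> O free_rel 1 O perm_rel \<tau> O free_rel 1 = free_rel 1 O perm_rel \<tau> O free_rel 1"
    unfolding D1 D3 .
  show "free_rel 1 O perm_rel \<tau> O free_rel 1 O perm_rel \<tau> = free_rel 1 O perm_rel \<tau> O free_rel 1"
    unfolding free D2 D3 ..
  \<comment> \<open>The common value of all products that join 0, 1 and 2.\<close>
  define M where "M = {(F::nat \<Rightarrow> bool, G). F = G \<and> F 0 = F 1 \<and> F 0 = F 2}"
  have M1: "eq_rel 0 2 O eq_rel 0 1 = M" "eq_rel 0 1 O eq_rel 0 2 = M" "eq_rel 0 1 O eq_rel 1 2 = M"
    by (auto simp: M_def eq_rel_def)
  have \<tau>eq: "\<tau> y = y" if "y \<noteq> 1" "y \<noteq> 2" for y using that by (simp add: \<tau>_def transpose_def)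
  have swap: "F = G" if F: "\<forall>y. F y = G (\<tau> y)" "F 1 = F 2" for F G :: "nat \<Rightarrow> bool"
  proof
    fix y
    consider "y = 1" | "y = 2" | "\<tau> y = y" using \<tau>eq by blast
    then show "F y = G y" using F vals by cases metis+
  qed
  have swap': "F y = F (\<tau> y)" if F: "F 1 = F 2" for F :: "nat \<Rightarrow> bool" and y
  proof -
    consider "y = 1" | "y = 2" | "\<tau> y = y" using \<tau>eq by blast
    then show ?thesis using F vals by cases metis+
  qed
  have M2: "eq_rel 0 1 O perm_rel \<tau> O eq_rel 0 1 = M"
  proof (intro equalityI subrelI)
    fix F G assume "(F, G) \<in> eq_rel 0 1 O perm_rel \<tau> O eq_rel 0 1"
    then have FG: "\<forall>y. F y = G (\<tau> y)" "F 0 = F 1" "G 0 = G 1"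
      by (auto simp: eq_rel_def perm_rel_def)
    then have "F 1 = F 2" using FG(1)[rule_format, of 0] FG(1)[rule_format, of 2] vals by simp
    moreover from this have "F = G" by (rule swap[OF FG(1)])
    ultimately show "(F, G) \<in> M" unfolding M_def using FG(2) by simp
  next
    fix F G assume "(F, G) \<in> M"
    then have FG: "F = G" "F 0 = F 1" "F 1 = F 2" by (auto simp: M_def)
    have "(F, F) \<in> perm_rel \<tau>" unfolding perm_rel_def using swap'[OF FG(3)] by blast
    moreover have "(F, F) \<in> eq_rel 0 1" using FG(2) by (simp add: eq_rel_def)
    ultimately show "(F, G) \<in> eq_rel 0 1 O perm_rel \<tau> O eq_rel 0 1"
      unfolding FG(1)[symmetric] by blast
  qed
  have "perm_rel \<tau> O eq_rel 0 1 O perm_rel \<tau> O eq_rel 0 1 = eq_rel 0 2 O eq_rel 0 1"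
    unfolding eq[symmetric] by (simp only: O_assoc)
  then show "perm_rel \<tau> O eq_rel 0 1 O perm_rel \<tau> O eq_rel 0 1 = eq_rel 0 1 O perm_rel \<tau> O eq_rel 0 1"
    unfolding M1 M2 .
  show "eq_rel 0 1 O perm_rel \<tau> O eq_rel 0 1 O perm_rel \<tau> = eq_rel 0 1 O perm_rel \<tau> O eq_rel 0 1"
    unfolding eq M1 M2 ..
  show "eq_rel 0 1 O perm_rel \<tau> O eq_rel 0 1 = eq_rel 0 1 O eq_rel 1 2" unfolding M1 M2 ..
  have fix_F: "(F, F) \<in> perm_rel \<tau>" if "F 1 = F 2" for F
    unfolding perm_rel_def using swap'[OF that] by blast
  have eq_perm: "F = G" if "(F, G) \<in> perm_rel \<tau>" "F 1 = F 2" for F G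
    using swap that unfolding perm_rel_def by blast
  have eq_perm': "F = G" if "(F, G) \<in> perm_rel \<tau>" "G 1 = G 2" for F G
  proof (rule eq_perm[OF that(1)])
    have "F 1 = G 2" "F 2 = G 1" using that(1) vals unfolding perm_rel_def by force+
    then show "F 1 = F 2" using that(2) by simp
  qed
  show "eq_rel 1 2 O perm_rel \<tau> = eq_rel 1 2"
    using fix_F eq_perm unfolding eq_rel_def by blast
  show "perm_rel \<tau> O eq_rel 1 2 = eq_rel 1 2"
    using fix_F eq_perm' unfolding eq_rel_def by blast
qed

text \<open>One step sends 2 to \<open>n\<close> and lowers every point of \<open>{3..n}\<close>;
  the closed formula records for each point whether it has already wrapped around. At
  \<open>k = n - 1\<close> it is the identity.\<close>

lemma sc_power_apply:
  assumes "2 \<le> n" "k \<le> n - 1"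
  shows "((\<lambda>x. rotation n (transpose 1 2 x)) ^^ k) x =
    (if x \<in> {2..n} then if k + 1 < x then x - k else x + (n - 1) - k else x)"
proof -
  define f where "f x = rotation n (transpose 1 2 x)" for x
  have step: "f y = (if y = 2 then n else if y \<in> {3..n} then y - 1 else y)" for y
    using assms(1) by (auto simp: f_def rotation_apply transpose_def)
  have "(f ^^ k) x = (if x \<in> {2..n} then if k + 1 < x then x - k else x + (n - 1) - k else x)"
    using assms(2)
  proof (induction k)
    case (Suc k)
    have IH: "(f ^^ Suc k) x = f (if x \<in> {2..n} then if k + 1 < x then x - k else x + (n - 1) - k else x)"
      using Suc by simp
    consider "x \<notin> {2..n}" | "x \<in> {2..n}" "Suc k + 1 < x" | "x \<in> {2..n}" "x = k + 2"
      | "x \<in> {2..n}" "x \<le> k + 1"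
      by linarith
    then show ?case
    proof cases
      case 1
      then have h: "x \<noteq> 2" "x \<notin> {3..n}" using assms(1) by auto
      have "f x = x" unfolding step if_not_P[OF h(1)] if_not_P[OF h(2)] ..
      then show ?thesis unfolding IH if_not_P[OF 1] .
    next
      case 2
      then have h: "x - k \<noteq> 2" "x - k \<in> {3..n}" "k + 1 < x" by auto
      have "(f ^^ Suc k) x = x - k - 1"
        unfolding IH if_P[OF 2(1)] if_P[OF h(3)] step[of "x - k"] if_not_P[OF h(1)] if_P[OF h(2)] ..
      then show ?thesis unfolding if_P[OF 2(1)] if_P[OF 2(2)] by linarith
    next
      case 3
      then have h: "k + 1 < x" "x - k = 2" "\<not> Suc k + 1 < x" by auto
      have "(f ^^ Suc k) x = n"
        unfolding IH if_P[OF 3(1)] if_P[OF h(1)] h(2) step[of 2] by simp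
      then show ?thesis unfolding if_P[OF 3(1)] if_not_P[OF h(3)] using 3 by simp
    next
      case 4
      then have h: "x + (n - 1) - k \<noteq> 2" "x + (n - 1) - k \<in> {3..n}" "\<not> k + 1 < x" "\<not> Suc k + 1 < x"
        using Suc.prems by auto
      have "(f ^^ Suc k) x = x + (n - 1) - k - 1"
        unfolding IH if_P[OF 4(1)] if_not_P[OF h(3)] step[of "x + (n - 1) - k"] if_not_P[OF h(1)] if_P[OF h(2)] ..
      then show ?thesis unfolding if_P[OF 4(1)] if_not_P[OF h(4)] by linarith
    qed
  next
    case 0
    then show ?case by (simp only: funpow_0) auto
  qed
  then show ?thesis unfolding f_def .
qed

lemma rel_chain_eq:
  assumes "(u, v) \<in> rel_chain ws" "\<forall>w\<in>set ws. f w = f (hd ws)"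
  shows "f u = f v"
proof -
  have "u \<in> set ws" "v \<in> set (tl ws)"
    using assms(1) unfolding rel_chain_def by (auto dest: set_zip_leftD set_zip_rightD)
  then have "u \<in> set ws" "v \<in> set ws" by (cases ws; simp)+
  then show ?thesis using assms(2) by metis
qed

lemma relations_sound:
  assumes n: "3 \<le> n" and uv: "(u, v) \<in> rook_relations n"
  shows "word_rel n u = word_rel n v"
proof -
  define \<tau> where "\<tau> = transpose 1 (2::nat)"
  define a where "a = rotation n"
  define a' where "a' = rotation n ^^ (n - 1)"
  define b where "b = rotation n ^^ 2"
  define b' where "b' = rotation n ^^ (n - 2)"
  have inverse: "\<tau> (\<tau> x) = x" "a (a' x) = x" "a' (a x) = x" "b (b' x) = x" "b' (b x) = x" for x
    using n rotation_power_inverse[of n 1 "n - 1" x] rotation_power_inverse[of n "n - 1" 1 x]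
      rotation_power_inverse[of n 2 "n - 2" x] rotation_power_inverse[of n "n - 2" 2 x]
    by (simp_all add: \<tau>_def a_def a'_def b_def b'_def)
  \<comment> \<open>Conjugating \<open>free_rel\<close> or \<open>eq_rel\<close> only moves the
    points in its index, so each conjugation relation is checked by following one or two points
    through these tables.\<close>
  have vals: "a 0 = 0" "a' 0 = 0" "b' 0 = 0" "\<tau> 0 = 0" "\<tau> 1 = 2" "\<tau> 2 = 1" "\<tau> 3 = 3" "\<tau> n = n"
    "a 1 = n" "a 2 = 1" "a 3 = 2" "a' 1 = 2" "a' 2 = 3" "a' n = 1" "b' 1 = 3"
    using n by (simp_all add: \<tau>_def a_def a'_def b'_def rotation_apply rotation_power_apply transpose_def)
  \<comment> \<open>\<open>b\<close> sends 1 and 2 to \<open>n - 1\<close> and \<open>n\<close>. For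
    \<open>n \<ge> 4\<close> both lie outside \<open>{1, 2}\<close> and are fixed by the swap,
    whereas for \<open>n = 3\<close> the value \<open>b 1 = 2\<close> is moved.\<close>
  have b_vals: "\<tau> (b 1) = b 1" "\<tau> (b 2) = b 2" if "4 \<le> n"
  proof -
    have "n - 1 \<noteq> 1" "n - 1 \<noteq> 2" using that by auto
    then show "\<tau> (b 1) = b 1" "\<tau> (b 2) = b 2"
      using that by (simp_all add: \<tau>_def b_def rotation_power_apply transpose_def)
  qed
  have words: "word_rel n [Gs] = perm_rel \<tau>" "word_rel n [Gc] = perm_rel a" "word_rel n [Ge] = free_rel 1"
    "word_rel n [Gq] = eq_rel 1 2" "word_rel n [Go] = eq_rel 0 1"
    "word_rel n ([Gc] \<up> (n - 1)) = perm_rel a'" "word_rel n ([Gc] \<up> 2) = perm_rel b"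
    "word_rel n ([Gc] \<up> (n - 2)) = perm_rel b'"
    unfolding word_rel_rotation_power by (simp_all add: \<tau>_def a_def a'_def b_def b'_def)
  note W = word_rel_append words O_assoc perm_rel_comp perm_rel_comp_assoc
  have square: "word_rel n (w \<up> 2) = word_rel n w O word_rel n w" for w
    by (simp add: word_power_def numeral_2_eq_2 word_rel_append)
  have free: "perm_rel \<pi> O free_rel x O perm_rel \<rho> = free_rel y"
    if "\<And>z. \<rho> (\<pi> z) = z" "\<And>z. \<pi> (\<rho> z) = z" "\<rho> x = y" for \<pi> \<rho> x y
    using perm_rel_free[OF that(1,2)] that(3) by simp
  have eq: "perm_rel \<pi> O eq_rel x y O perm_rel \<rho> = eq_rel x' y'"
    if "\<And>z. \<rho> (\<pi> z) = z" "\<And>z. \<pi> (\<rho> z) = z" "\<rho> x = x'" "\<rho> y = y'" for \<pi> \<rho> x y x' y'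
    using perm_rel_eq[OF that(1,2)] that(3,4) by simp
  have c1: "word_rel n ([Gc] \<up> n) = Id"
  proof -
    have "rotation n ^^ n = (\<lambda>x. x)" using n by (auto simp: rotation_power_apply)
    then show ?thesis unfolding word_rel_rotation_power by (simp only: perm_rel_id)
  qed
  have c2: "word_rel n (([Gs] @ [Gc]) \<up> (n - 1)) = Id"
  proof -
    have "word_rel n ([Gs] @ [Gc]) = perm_rel (\<lambda>x. rotation n (transpose 1 2 x))"
      unfolding W by (simp only: \<tau>_def a_def)
    from word_rel_power[OF this] have "word_rel n (([Gs] @ [Gc]) \<up> (n - 1)) =
        perm_rel ((\<lambda>x. rotation n (transpose 1 2 x)) ^^ (n - 1))" .
    also have "(\<lambda>x. rotation n (transpose 1 2 x)) ^^ (n - 1) = (\<lambda>x. x)"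
    proof
      fix x
      show "((\<lambda>x. rotation n (transpose 1 2 x)) ^^ (n - 1)) x = x"
        using n sc_power_apply[of n "n - 1" x] by (simp split: if_splits)
    qed
    finally show ?thesis by (simp only: perm_rel_id)
  qed
  have c3: "word_rel n ([Gs] \<up> 2) = Id"
    unfolding square W inverse by (rule perm_rel_id)
  have c4: "word_rel n (([Gc] \<up> i @ [Gs] @ [Gc] \<up> (n - i) @ [Gs]) \<up> 2) = Id" if i: "2 \<le> i" "2 * i \<le> n" for i
  proof -
    have "word_rel n ([Gc] \<up> i @ [Gs] @ [Gc] \<up> (n - i) @ [Gs]) =
        word_rel n ([Gc] \<up> i @ [Gs] @ [Gc] \<up> (n - i)) O word_rel n [Gs]"
      by (simp only: word_rel_append O_assoc)
    also have "\<dots> = perm_rel (\<lambda>x. \<tau> (transpose (i + 1) (i + 2) x))"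
      using word_rel_adjacent[of i n] i unfolding words by (simp add: perm_rel_comp)
    finally have "word_rel n (([Gc] \<up> i @ [Gs] @ [Gc] \<up> (n - i) @ [Gs]) \<up> 2) =
        perm_rel (\<lambda>x. \<tau> (transpose (i + 1) (i + 2) (\<tau> (transpose (i + 1) (i + 2) x))))"
      unfolding square by (simp only: perm_rel_comp)
    also have "(\<lambda>x. \<tau> (transpose (i + 1) (i + 2) (\<tau> (transpose (i + 1) (i + 2) x)))) = (\<lambda>x. x)"
      using i by (auto simp: fun_eq_iff \<tau>_def transpose_def)
    finally show ?thesis by (simp only: perm_rel_id)
  qed
  have e: "word_rel n ([Ge] \<up> 2) = free_rel 1" "word_rel n ([Ge] @ [Gq] @ [Ge]) = free_rel 1"
    "word_rel n ([Ge] @ [Go] @ [Ge]) = free_rel 1"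
    unfolding square W eq_rel_sym[of 0 1] by (simp_all add: free_rel_laws)
  have e': "word_rel n ([Gs] @ [Gc] @ [Ge] @ [Gc] \<up> (n - 1) @ [Gs]) = free_rel 1"
    "word_rel n ([Gc] @ [Gs] @ [Gc] \<up> (n - 1) @ [Ge] @ [Gc] @ [Gs] @ [Gc] \<up> (n - 1)) = free_rel 1"
    unfolding W by (rule free; simp only: inverse vals)+
  have r: "word_rel n ([Go] \<up> 2) = eq_rel 0 1" "word_rel n ([Go] @ [Ge] @ [Go]) = eq_rel 0 1"
    unfolding square W eq_rel_sym[of 0 1] by (simp_all add: free_rel_laws) (auto simp: eq_rel_def)
  have r': "word_rel n ([Gs] @ [Gc] @ [Go] @ [Gc] \<up> (n - 1) @ [Gs]) = eq_rel 0 1"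
    "word_rel n ([Gc] @ [Gs] @ [Gc] \<up> (n - 1) @ [Go] @ [Gc] @ [Gs] @ [Gc] \<up> (n - 1)) = eq_rel 0 1"
    unfolding W by (rule eq; simp only: inverse vals)+
  have q: "word_rel n ([Gq] \<up> 2) = eq_rel 1 2" "word_rel n ([Gq] @ [Ge] @ [Gq]) = eq_rel 1 2"
    "word_rel n ([Gq] @ [Gs]) = eq_rel 1 2" "word_rel n ([Gs] @ [Gq]) = eq_rel 1 2"
    unfolding square W \<tau>_def using swap_12_laws(7,8) by (simp_all add: free_rel_laws) (auto simp: eq_rel_def)
  have q': "word_rel n ([Gc] \<up> (n - 1) @ [Gs] @ [Gc] @ [Gs] @ [Gc] \<up> (n - 1) @ [Gq] @
      [Gc] @ [Gs] @ [Gc] \<up> (n - 1) @ [Gs] @ [Gc]) = eq_rel 1 2"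
    unfolding W by (rule eq; simp only: inverse vals)
  have q'': "word_rel n ([Gc] \<up> 2 @ [Gs] @ [Gc] \<up> (n - 2) @ [Gq] @ [Gc] \<up> 2 @ [Gs] @ [Gc] \<up> (n - 2)) = eq_rel 1 2"
    if "4 \<le> n"
    unfolding W using b_vals[OF that] by (intro eq) (simp_all only: inverse)
  have es: "word_rel n ([Gs] @ [Ge] @ [Gs] @ [Ge]) = word_rel n ([Ge] @ [Gs] @ [Ge])"
    "word_rel n ([Ge] @ [Gs] @ [Ge] @ [Gs]) = word_rel n ([Ge] @ [Gs] @ [Ge])"
    unfolding word_rel_append words \<tau>_def by (rule swap_12_laws)+
  have rs: "word_rel n ([Gs] @ [Go] @ [Gs] @ [Go]) = word_rel n ([Go] @ [Gs] @ [Go])"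
    "word_rel n ([Go] @ [Gs] @ [Go] @ [Gs]) = word_rel n ([Go] @ [Gs] @ [Go])"
    "word_rel n ([Go] @ [Gs] @ [Go]) = word_rel n ([Go] @ [Gq])"
    unfolding word_rel_append words \<tau>_def by (rule swap_12_laws)+
  have rq: "word_rel n ([Go] @ [Gq]) = word_rel n ([Gq] @ [Go])"
    unfolding word_rel_append words by (rule eq_rel_commute)
  have cj: "perm_rel a O eq_rel x y O perm_rel a' = eq_rel (a' x) (a' y)"
    "perm_rel b O eq_rel x y O perm_rel b' = eq_rel (b' x) (b' y)"
    "perm_rel b O free_rel x O perm_rel b' = free_rel (b' x)" for x y
    by (rule eq free; simp only: inverse)+
  have cj': "perm_rel a O eq_rel x y O perm_rel a' O X = eq_rel (a' x) (a' y) O X"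
    "perm_rel b O eq_rel x y O perm_rel b' O X = eq_rel (b' x) (b' y) O X"
    "perm_rel b O free_rel x O perm_rel b' O X = free_rel (b' x) O X" for x y X
    unfolding cj[symmetric] by (simp_all only: O_assoc)
  have comm: "word_rel n ([Gq] @ [Gc] @ [Gq] @ [Gc] \<up> (n - 1)) = word_rel n ([Gc] @ [Gq] @ [Gc] \<up> (n - 1) @ [Gq])"
    "word_rel n ([Gq] @ [Gc] \<up> 2 @ [Gq] @ [Gc] \<up> (n - 2)) = word_rel n ([Gc] \<up> 2 @ [Gq] @ [Gc] \<up> (n - 2) @ [Gq])"
    "word_rel n ([Gq] @ [Gc] \<up> 2 @ [Go] @ [Gc] \<up> (n - 2)) = word_rel n ([Gc] \<up> 2 @ [Go] @ [Gc] \<up> (n - 2) @ [Gq])"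
    unfolding word_rel_append words cj cj' by (rule eq_rel_commute)+
  have qe: "word_rel n ([Gq] @ [Gc] \<up> 2 @ [Ge] @ [Gc] \<up> (n - 2)) = word_rel n ([Gc] \<up> 2 @ [Ge] @ [Gc] \<up> (n - 2) @ [Gq])"
    unfolding word_rel_append words cj cj' vals by (rule free_rel_laws(4)[symmetric]) simp_all
  have er: "word_rel n ([Ge] @ [Gs] @ [Go] @ [Gs]) = word_rel n ([Gs] @ [Go] @ [Gs] @ [Ge])"
  proof -
    have "word_rel n ([Gs] @ [Go] @ [Gs] @ [Ge]) = (perm_rel \<tau> O eq_rel 0 1 O perm_rel \<tau>) O free_rel 1"
      unfolding word_rel_append words by (simp only: O_assoc)
    also have "\<dots> = free_rel 1 O (perm_rel \<tau> O eq_rel 0 1 O perm_rel \<tau>)"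
      unfolding \<tau>_def swap_12_laws(6) by (rule free_rel_laws(4)[symmetric]) simp_all
    finally show ?thesis unfolding word_rel_append words by simp
  qed
  have c4': "word_rel n (([Gc] \<up> i @ [Gs] @ [Gc] \<up> (n - i) @ [Gs]) \<up> 2) = Id"
    if "i \<in> {i. 2 \<le> i \<and> 2 * i \<le> n}" for i
    using c4 that by blast
  note eqs = list.set ball_simps(5,7) list.sel(1) simp_thms word_rel.simps(1) words c1 c2 c3 c4' e e' r r' q q'
    es rs rq comm qe er
  show ?thesis
  proof (cases "4 \<le> n")
    case True
    show ?thesis using uv unfolding rook_relations_def Let_def if_P[OF True]
      by (elim UnE UN_E) (erule rel_chain_eq[where f = "word_rel n"], (simp only: eqs q''[OF True])?)+
  next
    case False
    show ?thesis using uv unfolding rook_relations_def Let_def if_not_P[OF False] Un_empty_right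
      by (elim UnE UN_E) (erule rel_chain_eq[where f = "word_rel n"], (simp only: eqs)?)+
  qed
qed

section \<open>Colourings of the generating rook partitions\<close>

lemma ball_vertical_blocks: "(\<forall>A\<in>vertical_blocks J. Q A) \<longleftrightarrow> (\<forall>j\<in>J. Q {Upper j, Lower j})"
  unfolding vertical_blocks_def by blast

lemma Union_vertical_blocks: "\<Union>(vertical_blocks J) = Upper ` J \<union> Lower ` J"
  unfolding vertical_blocks_def by blast

lemma constant_on_pair: "(\<forall>u\<in>{a, b}. \<forall>v\<in>{a, b}. f u = f v) \<longleftrightarrow> f a = f b"
  by auto

lemma constant_on_singleton: "(\<forall>u\<in>{a}. \<forall>v\<in>{a}. f u = f v) \<longleftrightarrow> True"
  by auto

lemma constant_on_quadruple:
  "(\<forall>u\<in>{a, b, c, d}. \<forall>v\<in>{a, b, c, d}. f u = f v) \<longleftrightarrow> f a = f b \<and> f a = f c \<and> f a = f d"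
  by auto

lemma vertical_blocks_in_rook_partitions:
  assumes "J \<subseteq> {1..n}"
  shows "vertical_blocks J \<in> rook_partitions n"
  using assms unfolding rook_partitions_def disjoint_def vertical_blocks_def by blast

lemma rook_partitions_Un:
  assumes "\<alpha> \<in> rook_partitions n" "\<beta> \<in> rook_partitions n" "\<Union>\<alpha> \<inter> \<Union>\<beta> = {}"
  shows "\<alpha> \<union> \<beta> \<in> rook_partitions n"
  using assms unfolding rook_partitions_def by (auto intro: disjoint_union)

lemma s_bar_in_rook_partitions:
  assumes "1 \<le> i" "i < n"
  shows "s_bar n i \<in> rook_partitions n"
  unfolding s_bar_def
proof (rule rook_partitions_Un)
  show "{{Upper i, Lower (i + 1)}, {Upper (i + 1), Lower i}} \<in> rook_partitions n"
    using assms unfolding rook_partitions_def disjoint_def by auto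
  show "vertical_blocks ({1..n} - {i, i + 1}) \<in> rook_partitions n"
    by (rule vertical_blocks_in_rook_partitions) blast
qed (auto simp: Union_vertical_blocks)

lemma e_bar1_in_rook_partitions: "1 \<le> n \<Longrightarrow> e_bar1 n \<in> rook_partitions n"
  unfolding e_bar1_def
proof (rule rook_partitions_Un)
  assume "1 \<le> n"
  then show "{{Upper 1}, {Lower 1}} \<in> rook_partitions n"
    unfolding rook_partitions_def disjoint_def by auto
  show "vertical_blocks ({1..n} - {1}) \<in> rook_partitions n"
    by (rule vertical_blocks_in_rook_partitions) blast
qed (auto simp: Union_vertical_blocks)

lemma q_bar1_in_rook_partitions: "2 \<le> n \<Longrightarrow> q_bar1 n \<in> rook_partitions n"
  unfolding q_bar1_def
proof (rule rook_partitions_Un)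
  assume "2 \<le> n"
  then show "{{Upper 1, Upper 2, Lower 1, Lower 2}} \<in> rook_partitions n"
    unfolding rook_partitions_def disjoint_def by auto
  show "vertical_blocks {3..n} \<in> rook_partitions n"
    by (rule vertical_blocks_in_rook_partitions) auto
qed (auto simp: Union_vertical_blocks)

lemma o_bar1_in_rook_partitions: "o_bar1 n \<in> rook_partitions n"
  unfolding o_bar1_def by (rule vertical_blocks_in_rook_partitions) blast

lemma colourings_iff:
  "(F, G) \<in> colourings n \<alpha> \<longleftrightarrow>
    (\<forall>A\<in>\<alpha>. \<forall>u\<in>A. \<forall>v\<in>A. colour F (\<lambda>_. False) G u = colour F (\<lambda>_. False) G v) \<and>
    (\<forall>u \<in> (uppers n \<union> lowers n) - \<Union>\<alpha>. colour F (\<lambda>_. False) G u = F 0) \<and>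
    (\<forall>x. x \<notin> {1..n} \<longrightarrow> F x = G x)"
  by (simp only: colourings_def compatible_def mem_Collect_eq prod.case conj_assoc)

text \<open>This and the similar equivalences below have on their left the literal form that the
  colouring conditions of a generator take after simplification, and on their right the body of its
  relation.\<close>

lemma agree_iff: "(\<forall>j\<in>A. f j = g j) \<and> (\<forall>x. x \<notin> A \<longrightarrow> f x = g x) \<longleftrightarrow> f = g"
  by (metis ext)

lemma agree_off_iff:
  "a \<in> A \<Longrightarrow> (\<forall>j\<in>A - {a}. f j = g j) \<and> (\<forall>x. x \<notin> A \<longrightarrow> f x = g x) \<longleftrightarrow> (\<forall>x. x \<noteq> a \<longrightarrow> f x = g x)"
  by auto

lemma agree_o_iff:
  fixes f g :: "nat \<Rightarrow> 'b"
  shows "(\<forall>j\<in>{1..n} - {1}. f j = g j) \<and> (f 1 = f 0 \<and> g 1 = f 0) \<and> (\<forall>x. x \<notin> {1..n} \<longrightarrow> f x = g x) \<longleftrightarrow>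
    f = g \<and> f 0 = f 1"
proof
  assume h: "(\<forall>j\<in>{1..n} - {1}. f j = g j) \<and> (f 1 = f 0 \<and> g 1 = f 0) \<and> (\<forall>x. x \<notin> {1..n} \<longrightarrow> f x = g x)"
  have "f = g"
  proof
    fix y
    consider "y \<in> {1..n} - {1}" | "y = 1" | "y \<notin> {1..n}" by blast
    then show "f y = g y" using h by cases metis+
  qed
  with h show "f = g \<and> f 0 = f 1" by metis
qed auto

lemma agree_q_iff:
  fixes f g :: "nat \<Rightarrow> 'b"
  shows "(f 1 = f 2 \<and> f 1 = g 1 \<and> f 1 = g 2) \<and> (\<forall>j\<in>{3..n}. f j = g j) \<and> (\<forall>x. x \<notin> {1..n} \<longrightarrow> f x = g x) \<longleftrightarrow>
    f = g \<and> f 1 = f 2"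
proof
  assume h: "(f 1 = f 2 \<and> f 1 = g 1 \<and> f 1 = g 2) \<and> (\<forall>j\<in>{3..n}. f j = g j) \<and> (\<forall>x. x \<notin> {1..n} \<longrightarrow> f x = g x)"
  have "f = g"
  proof
    fix y
    consider "y \<in> {3..n}" | "y = 1" | "y = 2" | "y \<notin> {1..n}" by fastforce
    then show "f y = g y" using h by cases metis+
  qed
  with h show "f = g \<and> f 1 = f 2" by metis
qed auto

lemma agree_swap_iff:
  fixes f g :: "nat \<Rightarrow> 'b"
  assumes "1 \<le> i" "i < n"
  shows "f i = g (i + 1) \<and> f (i + 1) = g i \<and> (\<forall>j\<in>{1..n} - {i, i + 1}. f j = g j) \<and>
    (\<forall>x. x \<notin> {1..n} \<longrightarrow> f x = g x) \<longleftrightarrow> (\<forall>x. f x = g (transpose i (Suc i) x))" (is "?L \<longleftrightarrow> ?R")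
proof
  assume h: ?L
  show ?R
  proof
    fix x
    consider "x = i" | "x = i + 1" | "x \<noteq> i" "x \<noteq> i + 1" "f x = g x" using h by blast
    then show "f x = g (transpose i (Suc i) x)" by cases (use h in simp_all)
  qed
next
  assume h: ?R
  have gen: "f x = g x" if "x \<noteq> i" "x \<noteq> i + 1" for x
    using h[rule_format, of x] that by simp
  have swap: "f i = g (i + 1)" "f (i + 1) = g i"
    using h[rule_format, of i] h[rule_format, of "i + 1"] by simp_all
  show ?L
  proof (intro conjI swap ballI allI impI)
    show "f x = g x" if "x \<in> {1..n} - {i, i + 1}" for x using that by (intro gen) auto
    show "f x = g x" if "x \<notin> {1..n}" for x using that assms by (intro gen) auto
  qed
qed

lemma ball_insert_block: "(\<forall>A\<in>insert (B :: 'b set) \<B>. Q A) \<longleftrightarrow> Q B \<and> (\<forall>A\<in>\<B>. Q A)"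
  by simp

lemma ball_pair_const: "(\<forall>u\<in>{a, b}. f u = z) \<longleftrightarrow> f a = z \<and> f b = z"
  by simp

lemmas block_simps = ball_Un ball_vertical_blocks ball_simps(5) ball_insert_block ball_pair_const constant_on_pair constant_on_singleton
  constant_on_quadruple colour.simps Diff_cancel simp_thms conj_assoc

lemma colourings_identity: "colourings n (vertical_blocks {1..n}) = Id"
proof -
  have "(F, G) \<in> colourings n (vertical_blocks {1..n}) \<longleftrightarrow> F = G" for F G
    unfolding agree_iff[of "{1..n}" F G, symmetric]
    by (simp only: colourings_iff Union_vertical_blocks block_simps)
  then show ?thesis by auto
qed

lemma colourings_s_bar:
  assumes "1 \<le> i" "i < n"
  shows "colourings n (s_bar n i) = perm_rel (transpose i (Suc i))"
proof -
  have U: "\<Union>(s_bar n i) = uppers n \<union> lowers n"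
    unfolding s_bar_def Union_Un_distrib Union_vertical_blocks using assms by auto
  have "(F, G) \<in> colourings n (s_bar n i) \<longleftrightarrow> (\<forall>x. F x = G (transpose i (Suc i) x))" for F G
    unfolding agree_swap_iff[OF assms, symmetric]
    by (simp only: colourings_iff U) (simp only: s_bar_def block_simps)
  then show ?thesis unfolding perm_rel_def by auto
qed

lemma colourings_e_bar1:
  assumes "1 \<le> n"
  shows "colourings n (e_bar1 n) = free_rel 1"
proof -
  have U: "\<Union>(e_bar1 n) = uppers n \<union> lowers n"
    unfolding e_bar1_def Union_Un_distrib Union_vertical_blocks using assms by auto
  have one: "1 \<in> {1..n}" using assms by simp
  have "(F, G) \<in> colourings n (e_bar1 n) \<longleftrightarrow> (\<forall>x. x \<noteq> 1 \<longrightarrow> F x = G x)" for F G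
    unfolding agree_off_iff[OF one, symmetric]
    by (simp only: colourings_iff U) (simp only: e_bar1_def block_simps)
  then show ?thesis unfolding free_rel_def by auto
qed

lemma colourings_q_bar1:
  assumes "2 \<le> n"
  shows "colourings n (q_bar1 n) = eq_rel 1 2"
proof -
  have U: "\<Union>(q_bar1 n) = uppers n \<union> lowers n"
  proof -
    have "{1..n} = {1, 2} \<union> {3..n}" using assms by auto
    then show ?thesis
      unfolding q_bar1_def Union_Un_distrib Union_vertical_blocks by (simp only: image_Un) auto
  qed
  have "(F, G) \<in> colourings n (q_bar1 n) \<longleftrightarrow> F = G \<and> F 1 = F 2" for F G
    unfolding agree_q_iff[of F G n, symmetric]
    by (simp only: colourings_iff U) (simp only: q_bar1_def block_simps)
  then show ?thesis unfolding eq_rel_def by auto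
qed

lemma colourings_o_bar1:
  assumes "1 \<le> n"
  shows "colourings n (o_bar1 n) = eq_rel 0 1"
proof -
  have U: "(uppers n \<union> lowers n) - \<Union>(o_bar1 n) = {Upper 1, Lower 1}"
    unfolding o_bar1_def Union_vertical_blocks using assms by auto
  have "(F, G) \<in> colourings n (o_bar1 n) \<longleftrightarrow> F = G \<and> F 0 = F 1" for F G
    unfolding agree_o_iff[of n F G, symmetric]
    by (simp only: colourings_iff U) (simp only: o_bar1_def block_simps)
  then show ?thesis unfolding eq_rel_def by auto
qed

text \<open>The colourings embed rook partitions into binary relations with composition, so
  associativity and the unit laws are inherited; no paths in iterated product graphs are
  needed.\<close>

lemma monoid_rook_monoid: "monoid (rook_monoid n)"
proof
  fix \<alpha> \<beta> \<gamma>
  assume "\<alpha> \<in> carrier (rook_monoid n)" "\<beta> \<in> carrier (rook_monoid n)" "\<gamma> \<in> carrier (rook_monoid n)"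
  then have \<alpha>: "\<alpha> \<in> rook_partitions n" and \<beta>: "\<beta> \<in> rook_partitions n" and \<gamma>: "\<gamma> \<in> rook_partitions n"
    by (simp_all add: rook_monoid_def)
  have "rook_product n (rook_product n \<alpha> \<beta>) \<gamma> = rook_product n \<alpha> (rook_product n \<beta> \<gamma>)"
    by (rule colourings_inj[OF rook_product_closed rook_product_closed])
      (simp only: colourings_product \<alpha> \<beta> \<gamma> rook_product_closed O_assoc)
  then show "\<alpha> \<otimes>\<^bsub>rook_monoid n\<^esub> \<beta> \<otimes>\<^bsub>rook_monoid n\<^esub> \<gamma> = \<alpha> \<otimes>\<^bsub>rook_monoid n\<^esub> (\<beta> \<otimes>\<^bsub>rook_monoid n\<^esub> \<gamma>)"
    by (simp add: rook_monoid_def)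
next
  have one: "vertical_blocks {1..n} \<in> rook_partitions n"
    by (rule vertical_blocks_in_rook_partitions) blast
  then show "\<one>\<^bsub>rook_monoid n\<^esub> \<in> carrier (rook_monoid n)" by (simp add: rook_monoid_def)
  fix \<alpha> assume "\<alpha> \<in> carrier (rook_monoid n)"
  then have \<alpha>: "\<alpha> \<in> rook_partitions n" by (simp add: rook_monoid_def)
  have "rook_product n (vertical_blocks {1..n}) \<alpha> = \<alpha>"
    by (rule colourings_inj[OF rook_product_closed \<alpha>])
      (simp only: colourings_product[OF one \<alpha>] colourings_identity Id_O_R)
  then show "\<one>\<^bsub>rook_monoid n\<^esub> \<otimes>\<^bsub>rook_monoid n\<^esub> \<alpha> = \<alpha>" by (simp add: rook_monoid_def)
  have "rook_product n \<alpha> (vertical_blocks {1..n}) = \<alpha>"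
    by (rule colourings_inj[OF rook_product_closed \<alpha>])
      (simp only: colourings_product[OF \<alpha> one] colourings_identity R_O_Id)
  then show "\<alpha> \<otimes>\<^bsub>rook_monoid n\<^esub> \<one>\<^bsub>rook_monoid n\<^esub> = \<alpha>" by (simp add: rook_monoid_def)
qed (simp add: rook_monoid_def rook_product_closed)

lemma prod_list_colourings:
  assumes "set \<alpha>s \<subseteq> rook_partitions n"
  shows "monoid_prod_list (rook_monoid n) \<alpha>s \<in> rook_partitions n \<and>
    colourings n (monoid_prod_list (rook_monoid n) \<alpha>s) = foldr (O) (map (colourings n) \<alpha>s) Id"
  using assms
proof (induction \<alpha>s)
  case Nil
  have "vertical_blocks {1..n} \<in> rook_partitions n"
    by (rule vertical_blocks_in_rook_partitions) blast
  then show ?case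
    using colourings_identity[of n] by (simp add: monoid_prod_list_def rook_monoid_def)
next
  case (Cons \<alpha> \<alpha>s)
  have eq: "monoid_prod_list (rook_monoid n) (\<alpha> # \<alpha>s) =
      rook_product n \<alpha> (monoid_prod_list (rook_monoid n) \<alpha>s)"
    by (simp add: monoid_prod_list_def rook_monoid_def)
  have "\<alpha> \<in> rook_partitions n" "set \<alpha>s \<subseteq> rook_partitions n" using Cons.prems by auto
  then show ?case unfolding eq using Cons.IH colourings_product[of \<alpha> n] rook_product_closed by simp
qed

lemma letter_image:
  assumes "3 \<le> n"
  shows "letter_image n a \<in> rook_partitions n" "colourings n (letter_image n a) = letter_rel n a"
proof -
  have c: "monoid_prod_list (rook_monoid n) (map (s_bar n) [1..<n]) \<in> rook_partitions n \<and>
    colourings n (monoid_prod_list (rook_monoid n) (map (s_bar n) [1..<n])) = perm_rel (rotation n)"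
  proof -
    have "foldr (O) (map (colourings n) (map (s_bar n) w)) Id = perm_rel (word_perm w)"
      if "set w \<subseteq> {1..<n}" for w
      using that
    proof (induction w)
      case Nil
      then show ?case using perm_rel_id by (simp add: id_def)
    next
      case (Cons i w)
      have "colourings n (s_bar n i) = perm_rel (transpose i (Suc i))"
        using Cons.prems by (intro colourings_s_bar) auto
      then show ?case using Cons by (simp add: perm_rel_comp comp_def)
    qed
    moreover have "set (map (s_bar n) [1..<n]) \<subseteq> rook_partitions n"
      using s_bar_in_rook_partitions by auto
    ultimately show ?thesis
      using prod_list_colourings[of "map (s_bar n) [1..<n]" n] unfolding rotation_def by simp
  qed
  have s: "s_bar n 1 \<in> rook_partitions n" "colourings n (s_bar n 1) = perm_rel (transpose 1 2)"
    using s_bar_in_rook_partitions[of 1 n] colourings_s_bar[of 1 n] assms by (simp_all add: numeral_2_eq_2)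
  show "letter_image n a \<in> rook_partitions n"
    using assms c s e_bar1_in_rook_partitions[of n] q_bar1_in_rook_partitions[of n] o_bar1_in_rook_partitions[of n]
    by (cases a) simp_all
  show "colourings n (letter_image n a) = letter_rel n a"
    using assms c s colourings_e_bar1[of n] colourings_q_bar1[of n] colourings_o_bar1[of n]
    by (cases a) simp_all
qed

lemma zeta_colourings:
  assumes "3 \<le> n"
  shows "zeta n w \<in> rook_partitions n" "colourings n (zeta n w) = word_rel n w"
proof -
  have "set (map (letter_image n) w) \<subseteq> rook_partitions n" using letter_image[OF assms] by auto
  from prod_list_colourings[OF this]
  have "zeta n w \<in> rook_partitions n \<and>
      colourings n (zeta n w) = foldr (O) (map (colourings n) (map (letter_image n) w)) Id"
    unfolding zeta_def .
  moreover have "foldr (O) (map (colourings n) (map (letter_image n) w)) Id = word_rel n w"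
    by (induction w) (simp_all add: letter_image[OF assms])
  ultimately show "zeta n w \<in> rook_partitions n" "colourings n (zeta n w) = word_rel n w" by simp_all
qed

lemma zeta_eq_iff:
  assumes "3 \<le> n"
  shows "zeta n u = zeta n v \<longleftrightarrow> word_rel n u = word_rel n v"
  using zeta_colourings[OF assms] colourings_inj by metis

lemma zeta_append:
  assumes "3 \<le> n"
  shows "zeta n (u @ v) = rook_product n (zeta n u) (zeta n v)"
  by (rule colourings_inj[OF zeta_colourings(1)[OF assms] rook_product_closed])
    (simp only: colourings_product zeta_colourings[OF assms] word_rel_append)

section \<open>Words for normal forms\<close>

definition adjacent_word :: "nat \<Rightarrow> nat \<Rightarrow> letter list" where
  "adjacent_word n k = [Gc] \<up> k @ [Gs] @ [Gc] \<up> (n - k)"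

definition P_word :: "nat \<Rightarrow> (nat \<Rightarrow> nat) \<Rightarrow> letter list" where
  "P_word n \<pi> = concat (map (\<lambda>i. adjacent_word n (i - 1)) (perm_word n \<pi>))"

definition conj_word :: "nat \<Rightarrow> letter list \<Rightarrow> (nat \<Rightarrow> nat) \<Rightarrow> letter list" where
  "conj_word n w \<pi> = P_word n (inv_into UNIV \<pi>) @ w @ P_word n \<pi>"

definition E_word :: "nat \<Rightarrow> nat \<Rightarrow> letter list" where
  "E_word n x = conj_word n [Ge] (transpose 1 x)"

definition K_word :: "nat \<Rightarrow> nat \<Rightarrow> nat \<Rightarrow> letter list" where
  "K_word n x y = (if x = y then [] else if x = 0 then conj_word n [Go] (transpose 1 y)
     else if y = 0 then conj_word n [Go] (transpose 1 x) else conj_word n [Gq] (pair_perm n x y))"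

text \<open>The list is picked by the same \<open>SOME\<close> term as in \<open>big\<close>, so the
  value of the word is literally the corresponding product.\<close>

definition big_word :: "('i \<Rightarrow> letter list) \<Rightarrow> 'i set \<Rightarrow> letter list" where
  "big_word f A = concat (map f (SOME xs. set xs = A))"

text \<open>The element \<open>N\<close> spelled out in the generators. It links the two sides: its
  value in a monoid satisfying the relations is \<open>N\<close>, and its relation is
  \<open>nf_rel\<close>.\<close>

definition N_word :: "nat \<Rightarrow> (nat \<times> nat) set \<Rightarrow> nat set \<Rightarrow> (nat \<Rightarrow> nat) \<Rightarrow> (nat \<times> nat) set \<Rightarrow> letter list" where
  "N_word n R A \<pi> R' = big_word (\<lambda>(x, y). K_word n x y) R @ big_word (E_word n) A @ P_word n \<pi> @
     big_word (\<lambda>(x, y). K_word n x y) R'"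

lemma set_SOME_list: "finite A \<Longrightarrow> set (SOME xs. set xs = A) = A"
  by (rule someI_ex) (rule finite_list)

definition word_value :: "(letter \<Rightarrow> 'a::monoid_mult) \<Rightarrow> letter list \<Rightarrow> 'a" where
  "word_value g w = prod_list (map g w)"

lemma word_value_simps [simp]: "word_value g [] = 1" "word_value g (a # w) = g a * word_value g w"
  "word_value g (u @ v) = word_value g u * word_value g v"
  by (simp_all add: word_value_def)

lemma word_value_concat: "word_value g (concat ws) = prod_list (map (word_value g) ws)"
  by (induction ws) simp_all

lemma word_value_power: "word_value g (w \<up> k) = word_value g w ^ k"
  by (induction k) (simp_all add: word_power_def)

lemma word_value_N_word:
  assumes gens: "rook_generators n (g Gs) (g Gc) (g Ge) (g Gq) (g Go)" and ok: "nf_ok n R A \<pi> R'"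
  shows "word_value g (N_word n R A \<pi> R') =
    rook_generators.N n (g Gs) (g Gc) (g Ge) (g Gq) (g Go) R A \<pi> R'"
proof -
  interpret X: rook_generators n "g Gs" "g Gc" "g Ge" "g Gq" "g Go" by fact
  have adjacent: "word_value g (adjacent_word n k) = X.t k" if "k \<le> n" for k
    unfolding X.t_eq[OF that] adjacent_word_def by (simp add: word_value_power mult.assoc)
  have P: "word_value g (P_word n \<sigma>) = X.P \<sigma>" if "\<sigma> permutes {1..n}" for \<sigma>
  proof -
    have "map (word_value g) (map (\<lambda>i. adjacent_word n (i - 1)) w) = map X.adj w"
      if "set w \<subseteq> {1..<n}" for w
    proof (unfold map_map, rule map_cong[OF refl])
      fix i assume "i \<in> set w"
      then have "i \<in> {1..<n}" using that by blast
      then have "i - 1 \<le> n" by auto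
      then show "(word_value g \<circ> (\<lambda>i. adjacent_word n (i - 1))) i = X.adj i"
        unfolding comp_def X.adj_def by (rule adjacent)
    qed
    from this[OF perm_word(1)[OF that]] show ?thesis
      unfolding P_word_def word_value_concat X.P_def X.prod_def by (simp only:)
  qed
  have conj: "word_value g (conj_word n w \<sigma>) = X.conj (word_value g w) \<sigma>"
    if "\<sigma> permutes {1..n}" for w \<sigma>
    unfolding conj_word_def X.conj_def
    by (simp only: word_value_simps P[OF that] P[OF permutes_inv[OF that]] mult.assoc)
  have letter: "word_value g [a] = g a" for a by simp
  have E: "word_value g (E_word n x) = X.E x" if "x \<in> {1..n}" for x
    unfolding E_word_def X.E_def conj[OF X.swap_1_permutes[OF that]] letter ..
  have K: "word_value g (K_word n x y) = X.K x y" if "x \<le> n" "y \<le> n" for x y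
  proof -
    consider "x = y" | "x \<noteq> y" "x = 0" "y \<in> {1..n}" | "x \<noteq> y" "x \<noteq> 0" "y = 0" "x \<in> {1..n}"
      | "x \<noteq> y" "x \<noteq> 0" "y \<noteq> 0" "x \<in> {1..n}" "y \<in> {1..n}"
      using \<open>x \<le> n\<close> \<open>y \<le> n\<close> by fastforce
    then show ?thesis
    proof cases
      case 1
      then show ?thesis unfolding K_word_def X.K_def by simp
    next
      case 2
      then show ?thesis unfolding K_word_def X.K_def
        using conj[OF X.swap_1_permutes[OF 2(3)], of "[Go]"] letter[of Go] by simp
    next
      case 3
      then show ?thesis unfolding K_word_def X.K_def
        using conj[OF X.swap_1_permutes[OF 3(4)], of "[Go]"] letter[of Go] by simp
    next
      case 4
      then show ?thesis unfolding K_word_def X.K_def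
        using conj[OF pair_perm(1)[OF 4(4,5,1)], of "[Gq]"] letter[of Gq] by simp
    qed
  qed
  have bigK: "word_value g (big_word (\<lambda>(x, y). K_word n x y) Q) = X.KK.big Q"
    if Q: "Q \<subseteq> {..n} \<times> {..n}" for Q
  proof -
    have "set (SOME xs. set xs = Q) \<subseteq> {..n} \<times> {..n}"
      using Q set_SOME_list[OF finite_subset[OF Q]] by simp
    then have "map (word_value g) (map (\<lambda>(x, y). K_word n x y) (SOME xs. set xs = Q)) =
        map (\<lambda>(x, y). X.K x y) (SOME xs. set xs = Q)"
      unfolding map_map using K by (intro map_cong) auto
    then show ?thesis unfolding big_word_def word_value_concat X.KK.big_def by (simp only:)
  qed
  have bigE: "word_value g (big_word (E_word n) B) = X.EE.big B" if B: "B \<subseteq> {1..n}" for B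
  proof -
    have "set (SOME xs. set xs = B) \<subseteq> {1..n}"
      using B set_SOME_list[OF finite_subset[OF B]] by simp
    then have "map (word_value g) (map (E_word n) (SOME xs. set xs = B)) =
        map X.E (SOME xs. set xs = B)"
      unfolding map_map using E by (intro map_cong) auto
    then show ?thesis unfolding big_word_def word_value_concat X.EE.big_def by (simp only:)
  qed
  show ?thesis using ok unfolding nf_ok_def N_word_def X.N_def
    by (simp only: word_value_simps bigK bigE P mult.assoc)
qed

section \<open>The relation of a normal form, and how it determines the form\<close>

definition class_function :: "(nat \<times> nat) set \<Rightarrow> (nat \<Rightarrow> 'b) \<Rightarrow> bool" where
  "class_function R F \<longleftrightarrow> (\<forall>(x, y)\<in>R. F x = F y)"

definition nf_rel :: "(nat \<times> nat) set \<Rightarrow> nat set \<Rightarrow> (nat \<Rightarrow> nat) \<Rightarrow> (nat \<times> nat) set \<Rightarrow>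
    ((nat \<Rightarrow> bool) \<times> (nat \<Rightarrow> bool)) set" where
  "nf_rel R A \<pi> R' = {(F, G). class_function R F \<and> (\<forall>x. x \<notin> A \<longrightarrow> F x = G (\<pi> x)) \<and> class_function R' G}"

lemma word_rel_P_word:
  assumes "\<pi> permutes {1..n}"
  shows "word_rel n (P_word n \<pi>) = perm_rel \<pi>"
proof -
  have "word_rel n (concat (map (\<lambda>i. adjacent_word n (i - 1)) w)) = perm_rel (word_perm w)"
    if "set w \<subseteq> {1..<n}" for w
    using that
  proof (induction w)
    case Nil
    show ?case using perm_rel_id by (simp add: id_def)
  next
    case (Cons i w)
    then have i: "i - 1 + 2 \<le> n" "i - 1 + 1 = i" "i - 1 + 2 = Suc i" by auto
    have "word_rel n (adjacent_word n (i - 1)) = perm_rel (transpose i (Suc i))"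
      using word_rel_adjacent[OF i(1)] unfolding adjacent_word_def i .
    moreover have "word_rel n (concat (map (\<lambda>i. adjacent_word n (i - 1)) w)) = perm_rel (word_perm w)"
      using Cons by simp
    ultimately show ?case by (simp add: word_rel_append perm_rel_comp comp_def)
  qed
  from this[OF perm_word(1)[OF assms]] show ?thesis
    unfolding P_word_def perm_word(2)[OF assms] .
qed

lemma word_rel_letter: "word_rel n [a] = letter_rel n a"
  by simp

lemma word_rel_E_word:
  assumes "x \<in> {1..n}"
  shows "word_rel n (E_word n x) = free_rel x"
proof -
  have \<pi>: "transpose 1 x permutes {1..n}" using assms by (intro permutes_swap_id) auto
  show ?thesis
    unfolding E_word_def conj_word_def word_rel_append word_rel_letter letter_rel.simps
      word_rel_P_word[OF \<pi>] word_rel_P_word[OF permutes_inv[OF \<pi>]]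
      perm_rel_free[where \<rho> = "transpose 1 x" and \<pi> = "inv_into UNIV (transpose 1 x)",
        OF permutes_inverses[OF \<pi>]] transpose_apply_first ..
qed

lemma word_rel_K_word:
  assumes "x \<le> n" "y \<le> n"
  shows "word_rel n (K_word n x y) = eq_rel x y"
proof -
  have zero: "word_rel n (conj_word n [Go] (transpose 1 z)) = eq_rel 0 z" if "z \<in> {1..n}" for z
  proof -
    have \<pi>: "transpose 1 z permutes {1..n}" using that by (intro permutes_swap_id) auto
    show ?thesis
      unfolding conj_word_def word_rel_append word_rel_letter letter_rel.simps
        word_rel_P_word[OF \<pi>] word_rel_P_word[OF permutes_inv[OF \<pi>]]
        perm_rel_eq[where \<rho> = "transpose 1 z" and \<pi> = "inv_into UNIV (transpose 1 z)",
          OF permutes_inverses[OF \<pi>]] transpose_apply_first permutes_0[OF \<pi>] ..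
  qed
  consider "x = y" | "x \<noteq> y" "x = 0" "y \<in> {1..n}" | "x \<noteq> y" "x \<noteq> 0" "y = 0" "x \<in> {1..n}"
    | "x \<noteq> y" "x \<noteq> 0" "y \<noteq> 0" "x \<in> {1..n}" "y \<in> {1..n}"
    using assms by fastforce
  then show ?thesis
  proof cases
    case 1
    then show ?thesis by (auto simp: K_word_def eq_rel_def)
  next
    case 2
    then show ?thesis using zero[OF 2(3)] by (simp add: K_word_def)
  next
    case 3
    then show ?thesis using zero[OF 3(4)] eq_rel_sym[of 0 x] by (simp add: K_word_def)
  next
    case 4
    note pp = pair_perm[OF 4(4,5,1)]
    have "word_rel n (conj_word n [Gq] (pair_perm n x y)) = eq_rel (pair_perm n x y 1) (pair_perm n x y 2)"
      unfolding conj_word_def word_rel_append word_rel_letter letter_rel.simps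
        word_rel_P_word[OF pp(1)] word_rel_P_word[OF permutes_inv[OF pp(1)]]
      by (rule perm_rel_eq[OF permutes_inverses[OF pp(1)]])
    then show ?thesis using 4 unfolding pp(2,3) by (simp add: K_word_def)
  qed
qed

lemma word_rel_big_K:
  assumes "R \<subseteq> {..n} \<times> {..n}"
  shows "word_rel n (big_word (\<lambda>(x, y). K_word n x y) R) = {(F, G). F = G \<and> class_function R F}"
proof -
  have list: "word_rel n (concat (map (\<lambda>(x, y). K_word n x y) xs)) = {(F, G). F = G \<and> class_function (set xs) F}"
    if "set xs \<subseteq> {..n} \<times> {..n}" for xs
    using that
  proof (induction xs)
    case Nil
    then show ?case by (auto simp: class_function_def)
  next
    case (Cons p xs)
    obtain x y where p: "p = (x, y)" by fastforce
    have IH: "word_rel n (concat (map (\<lambda>(x, y). K_word n x y) xs)) = {(F, G). F = G \<and> class_function (set xs) F}"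
      using Cons by simp
    have "word_rel n (K_word n x y) = eq_rel x y" using Cons.prems p by (intro word_rel_K_word) auto
    then have "word_rel n (concat (map (\<lambda>(x, y). K_word n x y) (p # xs))) =
        eq_rel x y O {(F, G). F = G \<and> class_function (set xs) F}"
      by (simp add: p word_rel_append IH)
    also have "\<dots> = {(F, G). F = G \<and> class_function (set (p # xs)) F}"
      unfolding eq_rel_def class_function_def p by auto
    finally show ?case .
  qed
  show ?thesis unfolding big_word_def
    using list[of "SOME xs. set xs = R"] set_SOME_list[OF finite_subset[OF assms]] assms by simp
qed

lemma word_rel_big_E:
  assumes "A \<subseteq> {1..n}"
  shows "word_rel n (big_word (E_word n) A) = {(F, G). \<forall>x. x \<notin> A \<longrightarrow> F x = G x}"
proof -
  have list: "word_rel n (concat (map (E_word n) xs)) = {(F, G). \<forall>x. x \<notin> set xs \<longrightarrow> F x = G x}"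
    if "set xs \<subseteq> {1..n}" for xs
    using that
  proof (induction xs)
    case Nil
    then show ?case by (auto simp: fun_eq_iff)
  next
    case (Cons x xs)
    have "word_rel n (concat (map (E_word n) (x # xs))) =
        free_rel x O {(F, G). \<forall>x. x \<notin> set xs \<longrightarrow> F x = G x}"
      using Cons word_rel_E_word[of x n] by (simp add: word_rel_append)
    also have "\<dots> = {(F, G). \<forall>y. y \<notin> set (x # xs) \<longrightarrow> F y = G y}"
    proof (intro equalityI subrelI)
      fix F G :: "nat \<Rightarrow> bool" assume "(F, G) \<in> free_rel x O {(F, G). \<forall>x. x \<notin> set xs \<longrightarrow> F x = G x}"
      then show "(F, G) \<in> {(F, G). \<forall>y. y \<notin> set (x # xs) \<longrightarrow> F y = G y}"
        by (auto simp: free_rel_def)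
    next
      fix F G :: "nat \<Rightarrow> bool" assume FG: "(F, G) \<in> {(F, G). \<forall>y. y \<notin> set (x # xs) \<longrightarrow> F y = G y}"
      have "(F, F(x := G x)) \<in> free_rel x" by (simp add: free_rel_def)
      moreover have "(F(x := G x), G) \<in> {(F, G). \<forall>x. x \<notin> set xs \<longrightarrow> F x = G x}"
        using FG by simp
      ultimately show "(F, G) \<in> free_rel x O {(F, G). \<forall>x. x \<notin> set xs \<longrightarrow> F x = G x}" by (rule relcompI)
    qed
    finally show ?case .
  qed
  show ?thesis unfolding big_word_def
    using list[of "SOME xs. set xs = A"] set_SOME_list[OF finite_subset[OF assms]] assms by simp
qed

lemma word_rel_N_word:
  assumes "nf_ok n R A \<pi> R'"
  shows "word_rel n (N_word n R A \<pi> R') = nf_rel R A \<pi> R'"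
proof -
  have ok: "R \<subseteq> {..n} \<times> {..n}" "A \<subseteq> {1..n}" "\<pi> permutes {1..n}" "R' \<subseteq> {..n} \<times> {..n}"
    using assms by (simp_all add: nf_ok_def)
  have eq: "word_rel n (N_word n R A \<pi> R') = {(F, G). F = G \<and> class_function R F} O
      {(F, G). \<forall>x. x \<notin> A \<longrightarrow> F x = G x} O perm_rel \<pi> O {(F, G). F = G \<and> class_function R' F}"
    unfolding N_word_def word_rel_append word_rel_big_K[OF ok(1)] word_rel_big_E[OF ok(2)]
      word_rel_P_word[OF ok(3)] word_rel_big_K[OF ok(4)] ..
  show ?thesis unfolding eq
  proof (intro equalityI subrelI)
    fix F G :: "nat \<Rightarrow> bool" assume "(F, G) \<in> nf_rel R A \<pi> R'"
    then have FG: "class_function R F" "\<forall>x. x \<notin> A \<longrightarrow> F x = G (\<pi> x)" "class_function R' G"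
      unfolding nf_rel_def by blast+
    have "(F, F) \<in> {(F, G). F = G \<and> class_function R F}" using FG(1) by simp
    moreover have "(F, \<lambda>x. G (\<pi> x)) \<in> {(F, G). \<forall>x. x \<notin> A \<longrightarrow> F x = G x}" using FG(2) by simp
    moreover have "(\<lambda>x. G (\<pi> x), G) \<in> perm_rel \<pi>" by (simp add: perm_rel_def)
    moreover have "(G, G) \<in> {(F, G). F = G \<and> class_function R' F}" using FG(3) by simp
    ultimately show "(F, G) \<in> {(F, G). F = G \<and> class_function R F} O
      {(F, G). \<forall>x. x \<notin> A \<longrightarrow> F x = G x} O perm_rel \<pi> O {(F, G). F = G \<and> class_function R' F}"
      by (meson relcompI)
  next
    fix F G :: "nat \<Rightarrow> bool" assume "(F, G) \<in> {(F, G). F = G \<and> class_function R F} O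
      {(F, G). \<forall>x. x \<notin> A \<longrightarrow> F x = G x} O perm_rel \<pi> O {(F, G). F = G \<and> class_function R' F}"
    then show "(F, G) \<in> nf_rel R A \<pi> R'" unfolding nf_rel_def perm_rel_def by auto
  qed
qed

lemma class_function_cl: "class_function R F \<Longrightarrow> (a, b) \<in> cl R \<Longrightarrow> F a = F b"
proof -
  assume R: "class_function R F" and ab: "(a, b) \<in> cl R"
  have "cl R \<subseteq> {(x, y). F x = F y}"
    by (rule cl_least) (use R in \<open>auto simp: class_function_def\<close>)
  then show ?thesis using ab by blast
qed

lemma class_functionI:
  assumes "\<And>x y. (x, y) \<in> cl R \<Longrightarrow> F x \<Longrightarrow> F y"
  shows "class_function R F"
proof -
  have "F x = F y" if "(x, y) \<in> R" for x y
    using assms[OF cl_base[OF that]] assms[OF cl_sym[OF cl_base[OF that]]] by blast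
  then show ?thesis unfolding class_function_def by auto
qed

lemma class_function_cl_class: "class_function R (\<lambda>z. (a, z) \<in> cl R)"
  by (rule class_functionI) (rule cl_trans)

lemma class_function_matching:
  shows "class_function R' (\<lambda>z. (a, z) \<in> matching R A \<pi> R')"
    and "class_function R (\<lambda>z. (z, b) \<in> matching R A \<pi> R')"
proof (rule_tac [!] class_functionI)
  fix x y assume "(x, y) \<in> cl R'" "(a, x) \<in> matching R A \<pi> R'"
  then obtain z where z: "z \<notin> A" "(a, z) \<in> cl R" "(\<pi> z, x) \<in> cl R'" "(x, y) \<in> cl R'"
    by (auto simp: matching_def)
  then show "(a, y) \<in> matching R A \<pi> R'"
    using cl_trans[OF z(3,4)] by (auto simp: matching_def)
next
  fix x y assume "(x, y) \<in> cl R" "(x, b) \<in> matching R A \<pi> R'"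
  then obtain z where z: "z \<notin> A" "(x, z) \<in> cl R" "(\<pi> z, b) \<in> cl R'" "(y, x) \<in> cl R"
    using cl_sym[of x y R] by (auto simp: matching_def)
  then show "(y, b) \<in> matching R A \<pi> R'"
    using cl_trans[OF z(4,2)] by (auto simp: matching_def)
qed

text \<open>A test pair: colour the upper class of \<open>a\<close> and everything matched with it
  below. Properness ensures that a strand ending in a coloured lower class starts in the class of
  \<open>a\<close>.\<close>

lemma nf_rel_upper_class:
  assumes "proper n R A \<pi> R'"
  shows "(\<lambda>z. (a, z) \<in> cl R, \<lambda>z. (a, z) \<in> matching R A \<pi> R') \<in> nf_rel R A \<pi> R'"
proof -
  have "(a, x) \<in> cl R \<longleftrightarrow> (a, \<pi> x) \<in> matching R A \<pi> R'" if "x \<notin> A" for x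
  proof
    assume "(a, x) \<in> cl R"
    then show "(a, \<pi> x) \<in> matching R A \<pi> R'" using that by (auto simp: matching_def)
  next
    assume "(a, \<pi> x) \<in> matching R A \<pi> R'"
    then obtain z where "z \<notin> A" "(a, z) \<in> cl R" "(\<pi> z, \<pi> x) \<in> cl R'" by (auto simp: matching_def)
    then show "(a, x) \<in> cl R" using proper_inj[OF assms _ that, of z] by blast
  qed
  then show ?thesis
    unfolding nf_rel_def using class_function_cl_class class_function_matching(1) by blast
qed

lemma nf_rel_lower_class:
  assumes "proper n R A \<pi> R'"
  shows "(\<lambda>z. (z, b) \<in> matching R A \<pi> R', \<lambda>z. (b, z) \<in> cl R') \<in> nf_rel R A \<pi> R'"
proof -
  have "(x, b) \<in> matching R A \<pi> R' \<longleftrightarrow> (b, \<pi> x) \<in> cl R'" if "x \<notin> A" for x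
  proof
    assume "(b, \<pi> x) \<in> cl R'"
    then show "(x, b) \<in> matching R A \<pi> R'" using that cl_sym[of b "\<pi> x" R'] by (auto simp: matching_def)
  next
    assume "(x, b) \<in> matching R A \<pi> R'"
    then obtain z where z: "z \<notin> A" "(x, z) \<in> cl R" "(\<pi> z, b) \<in> cl R'" by (auto simp: matching_def)
    then have "x = z" using proper_inj[OF assms that, of z] by blast
    then show "(b, \<pi> x) \<in> cl R'" using cl_sym[OF z(3)] by simp
  qed
  then show ?thesis
    unfolding nf_rel_def using class_function_cl_class class_function_matching(2) by blast
qed

text \<open>The test pairs of one form belong to the relation of the other, so the classes of the
  first are unions of classes of the second and conversely. The upper test pair, followed along a
  strand, also compares the matchings.\<close>

lemma nf_rel_determines:
  assumes "proper n R A \<pi> R'" "proper n Q B \<rho> Q'" "nf_rel R A \<pi> R' = nf_rel Q B \<rho> Q'"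
  shows "cl R = cl Q" "cl R' = cl Q'" "matching R A \<pi> R' = matching Q B \<rho> Q'"
proof -
  have upper: "cl R \<subseteq> cl Q" if "proper n Q B \<rho> Q'" "nf_rel R A \<pi> R' = nf_rel Q B \<rho> Q'" for R A \<pi> R' Q B \<rho> Q'
  proof (rule subrelI)
    fix a b assume ab: "(a, b) \<in> cl R"
    have "class_function R (\<lambda>z. (a, z) \<in> cl Q)"
      using nf_rel_upper_class[OF that(1), of a] unfolding that(2)[symmetric] unfolding nf_rel_def by blast
    from class_function_cl[OF this ab] show "(a, b) \<in> cl Q" by simp
  qed
  have lower: "cl R' \<subseteq> cl Q'" if "proper n Q B \<rho> Q'" "nf_rel R A \<pi> R' = nf_rel Q B \<rho> Q'" for R A \<pi> R' Q B \<rho> Q'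
  proof (rule subrelI)
    fix a b assume ab: "(a, b) \<in> cl R'"
    have "class_function R' (\<lambda>z. (a, z) \<in> cl Q')"
      using nf_rel_lower_class[OF that(1), of a] unfolding that(2)[symmetric] unfolding nf_rel_def by blast
    from class_function_cl[OF this ab] show "(a, b) \<in> cl Q'" by simp
  qed
  have match: "matching R A \<pi> R' \<subseteq> matching Q B \<rho> Q'"
    if "proper n Q B \<rho> Q'" "nf_rel R A \<pi> R' = nf_rel Q B \<rho> Q'" for R A \<pi> R' Q B \<rho> Q'
  proof (rule subrelI)
    fix a b assume "(a, b) \<in> matching R A \<pi> R'"
    then obtain x where x: "x \<notin> A" "(a, x) \<in> cl R" "(\<pi> x, b) \<in> cl R'" by (auto simp: matching_def)
    define F where "F z \<longleftrightarrow> (a, z) \<in> cl Q" for z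
    define G where "G z \<longleftrightarrow> (a, z) \<in> matching Q B \<rho> Q'" for z
    have "(F, G) \<in> nf_rel R A \<pi> R'"
      using nf_rel_upper_class[OF that(1), of a] unfolding that(2) F_def G_def .
    then have "class_function R F" "F x = G (\<pi> x)" "class_function R' G" using x(1) unfolding nf_rel_def by blast+
    then have "F a = G b" using class_function_cl[OF _ x(2), of F] class_function_cl[OF _ x(3), of G] by simp
    then show "(a, b) \<in> matching Q B \<rho> Q'" unfolding F_def G_def by simp
  qed
  show "cl R = cl Q" using upper[OF assms(2,3)] upper[OF assms(1) assms(3)[symmetric]] by blast
  show "cl R' = cl Q'" using lower[OF assms(2,3)] lower[OF assms(1) assms(3)[symmetric]] by blast
  show "matching R A \<pi> R' = matching Q B \<rho> Q'"
    using match[OF assms(2,3)] match[OF assms(1) assms(3)[symmetric]] by blast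
qed

text \<open>The kernels are the traces of the blocks on the two layers, with each dot linked to 0.
  Every block meeting both layers contributes one strand between an arbitrarily chosen upper and
  lower point.\<close>

lemma ex_nf_rel:
  assumes \<alpha>: "\<alpha> \<in> rook_partitions n"
  shows "\<exists>R A \<pi> R'. nf_ok n R A \<pi> R' \<and> nf_rel R A \<pi> R' = colourings n \<alpha>"
proof -
  define R where "R = {(x, y). x \<in> {1..n} \<and> y \<in> {1..n} \<and> (\<exists>B\<in>\<alpha>. Upper x \<in> B \<and> Upper y \<in> B)} \<union>
      {(x, y). x = 0 \<and> y \<in> {1..n} \<and> Upper y \<notin> \<Union>\<alpha>}"
  define R' where "R' = {(x, y). x \<in> {1..n} \<and> y \<in> {1..n} \<and> (\<exists>B\<in>\<alpha>. Lower x \<in> B \<and> Lower y \<in> B)} \<union>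
      {(x, y). x = 0 \<and> y \<in> {1..n} \<and> Lower y \<notin> \<Union>\<alpha>}"
  define X where "X = {B \<in> \<alpha>. (\<exists>i. Upper i \<in> B) \<and> (\<exists>j. Lower j \<in> B)}"
  define up where "up B = (SOME i. Upper i \<in> B)" for B
  define lo where "lo B = (SOME j. Lower j \<in> B)" for B
  have X: "B \<in> \<alpha>" "Upper (up B) \<in> B" "Lower (lo B) \<in> B" if "B \<in> X" for B
    using that someI_ex[of "\<lambda>i. Upper i \<in> B"] someI_ex[of "\<lambda>j. Lower j \<in> B"]
    unfolding X_def up_def lo_def by blast+
  have vertex: "v \<in> uppers n \<union> lowers n" if "v \<in> B" "B \<in> \<alpha>" for v B
    using rook_partitionsD(1)[OF \<alpha>] that by blast
  have U: "i \<in> {1..n}" if "Upper i \<in> B" "B \<in> \<alpha>" for i B using vertex[OF that] by auto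
  have L: "i \<in> {1..n}" if "Lower i \<in> B" "B \<in> \<alpha>" for i B using vertex[OF that] by auto
  have up_inj: "inj_on up X"
    using X rook_partitionsD(3)[OF \<alpha>] by (intro inj_onI) metis
  have lo_inj: "inj_on lo X"
    using X rook_partitionsD(3)[OF \<alpha>] by (intro inj_onI) metis
  define f where "f = lo \<circ> inv_into X up"
  have f: "f (up B) = lo B" if "B \<in> X" for B using that up_inj by (simp add: f_def)
  have "inj_on f (up ` X)"
    using f lo_inj by (auto simp: inj_on_def)
  moreover have "up ` X \<subseteq> {1..n}" "f ` up ` X \<subseteq> {1..n}" using X U L f by fastforce+
  ultimately obtain \<pi> where \<pi>: "\<pi> permutes {1..n}" "\<forall>x\<in>up ` X. \<pi> x = f x"
    using extend_to_permutation[of "{1..n}" f "up ` X"] by auto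
  \<comment> \<open>Only the chosen representatives stay in the domain; the arbitrary values of the
    extension \<open>\<pi>\<close> elsewhere on \<open>{1..n}\<close> are thereby cut off.\<close>
  define A where "A = {1..n} - up ` X"
  have \<pi>_up: "\<pi> (up B) = lo B" "up B \<notin> A" if "B \<in> X" for B
    using \<pi>(2) f that by (auto simp: A_def)
  have not_A: "(\<exists>B\<in>X. x = up B) \<or> x \<notin> {1..n} \<and> \<pi> x = x" if "x \<notin> A" for x
    using that permutes_not_in[OF \<pi>(1)] unfolding A_def by blast
  have "nf_ok n R A \<pi> R'"
    unfolding nf_ok_def using \<pi>(1) by (auto simp: R_def R'_def A_def)
  moreover have "nf_rel R A \<pi> R' = colourings n \<alpha>"
  proof (intro equalityI subrelI)
    fix F G :: "nat \<Rightarrow> bool" assume "(F, G) \<in> nf_rel R A \<pi> R'"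
    then have R: "\<And>x y. (x, y) \<in> R \<Longrightarrow> F x = F y" and R': "\<And>x y. (x, y) \<in> R' \<Longrightarrow> G x = G y"
      and FG: "\<And>x. x \<notin> A \<Longrightarrow> F x = G (\<pi> x)"
      unfolding nf_rel_def class_function_def by blast+
    have outside: "F x = G x" if "x \<notin> {1..n}" for x
    proof -
      have "x \<notin> A" using that unfolding A_def by blast
      from FG[OF this] show ?thesis unfolding permutes_not_in[OF \<pi>(1) that] .
    qed
    have uu: "F i = F j" if "Upper i \<in> B" "Upper j \<in> B" "B \<in> \<alpha>" for i j B
      by (rule R) (use that U in \<open>auto simp: R_def\<close>)
    have ll: "G i = G j" if "Lower i \<in> B" "Lower j \<in> B" "B \<in> \<alpha>" for i j B
      by (rule R') (use that L in \<open>auto simp: R'_def\<close>)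
    have ul: "F i = G j" if ij: "Upper i \<in> B" "Lower j \<in> B" "B \<in> \<alpha>" for i j B
    proof -
      have B: "B \<in> X" using ij by (auto simp: X_def)
      have "F i = F (up B)" using uu[OF ij(1) X(2)[OF B] ij(3)] .
      also have "\<dots> = G (lo B)" using FG[OF \<pi>_up(2)[OF B]] unfolding \<pi>_up(1)[OF B] .
      also have "\<dots> = G j" using ll[OF X(3)[OF B] ij(2,3)] .
      finally show ?thesis .
    qed
    show "(F, G) \<in> colourings n \<alpha>"
      unfolding colourings_iff
    proof (intro conjI ballI allI impI outside)
      fix B u v assume B: "B \<in> \<alpha>" and uv: "u \<in> B" "v \<in> B"
      consider i j where "u = Upper i" "v = Upper j" | i j where "u = Upper i" "v = Lower j"
        | i j where "u = Lower i" "v = Upper j" | i j where "u = Lower i" "v = Lower j"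
        using vertex[OF uv(1) B] vertex[OF uv(2) B] by blast
      then show "colour F (\<lambda>_. False) G u = colour F (\<lambda>_. False) G v"
      proof cases
        case (1 i j)
        then show ?thesis using uu[OF uv[unfolded 1] B] by simp
      next
        case (2 i j)
        then show ?thesis using ul[OF uv[unfolded 2] B] by simp
      next
        case (3 i j)
        then show ?thesis using ul[OF uv(2,1)[unfolded 3] B] by simp
      next
        case (4 i j)
        then show ?thesis using ll[OF uv[unfolded 4] B] by simp
      qed
    next
      fix u assume u: "u \<in> uppers n \<union> lowers n - \<Union>\<alpha>"
      then consider i where "u = Upper i" "i \<in> {1..n}" "Upper i \<notin> \<Union>\<alpha>"
        | i where "u = Lower i" "i \<in> {1..n}" "Lower i \<notin> \<Union>\<alpha>"
        by blast
      then show "colour F (\<lambda>_. False) G u = F 0"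
      proof cases
        case 1
        then have "F 0 = F i" by (intro R) (simp add: R_def)
        then show ?thesis using 1 by simp
      next
        case 2
        then have "G 0 = G i" by (intro R') (simp add: R'_def)
        then show ?thesis using 2 outside[of 0] by simp
      qed
    qed
  next
    fix F G :: "nat \<Rightarrow> bool" assume FG: "(F, G) \<in> colourings n \<alpha>"
    have outside: "F x = G x" if "x \<notin> {1..n}" for x using FG that unfolding colourings_iff by blast
    have "F x = F y" if "(x, y) \<in> R" for x y
    proof -
      consider B where "B \<in> \<alpha>" "Upper x \<in> B" "Upper y \<in> B" | "x = 0" "y \<in> {1..n}" "Upper y \<notin> \<Union>\<alpha>"
        using \<open>(x, y) \<in> R\<close> unfolding R_def by blast
      then show ?thesis
      proof cases
        case 1
        then show ?thesis using colourings_sameD[OF FG 1] by simp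
      next
        case 2
        then show ?thesis using colourings_dotD[OF FG _ 2(3)] by simp
      qed
    qed
    moreover have "G x = G y" if "(x, y) \<in> R'" for x y
    proof -
      consider B where "B \<in> \<alpha>" "Lower x \<in> B" "Lower y \<in> B" | "x = 0" "y \<in> {1..n}" "Lower y \<notin> \<Union>\<alpha>"
        using \<open>(x, y) \<in> R'\<close> unfolding R'_def by blast
      then show ?thesis
      proof cases
        case 1
        then show ?thesis using colourings_sameD[OF FG 1] by simp
      next
        case 2
        then show ?thesis using colourings_dotD[OF FG _ 2(3)] outside[of 0] by simp
      qed
    qed
    moreover have "F x = G (\<pi> x)" if "x \<notin> A" for x
      using not_A[OF that]
    proof
      assume "\<exists>B\<in>X. x = up B"
      then obtain B where B: "B \<in> X" "x = up B" by blast
      then show ?thesis using colourings_sameD[OF FG X[OF B(1)]] \<pi>_up(1)[OF B(1)] by simp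
    next
      assume "x \<notin> {1..n} \<and> \<pi> x = x"
      then show ?thesis using outside by metis
    qed
    ultimately show "(F, G) \<in> nf_rel R A \<pi> R'"
      unfolding nf_rel_def class_function_def by blast
  qed
  ultimately show ?thesis by blast
qed

lemma zeta_surj:
  assumes "3 \<le> n"
  shows "range (zeta n) = rook_partitions n"
proof (intro equalityI subsetI)
  fix \<alpha> assume \<alpha>: "\<alpha> \<in> rook_partitions n"
  then obtain R A \<pi> R' where nf: "nf_ok n R A \<pi> R'" "nf_rel R A \<pi> R' = colourings n \<alpha>"
    using ex_nf_rel by blast
  have "zeta n (N_word n R A \<pi> R') = \<alpha>"
    by (rule colourings_inj[OF zeta_colourings(1)[OF assms] \<alpha>])
      (simp only: zeta_colourings(2)[OF assms] word_rel_N_word[OF nf(1)] nf(2))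
  then show "\<alpha> \<in> range (zeta n)" by blast
qed (use zeta_colourings(1)[OF assms] in blast)

section \<open>Congruences containing the relations\<close>

definition word_congruence :: "(letter list \<times> letter list) set \<Rightarrow> bool" where
  "word_congruence H \<longleftrightarrow> equiv UNIV H \<and>
     (\<forall>u v u' v'. (u, v) \<in> H \<longrightarrow> (u', v') \<in> H \<longrightarrow> (u @ u', v @ v') \<in> H)"

lemma lists_letters: "lists {Gs, Gc, Ge, Gq, Go} = UNIV"
proof -
  have "{Gs, Gc, Ge, Gq, Go} = UNIV" using letter.exhaust by blast
  then show ?thesis by simp
qed

lemma monoid_congruence_iff:
  "monoid_congruence (free_monoid {Gs, Gc, Ge, Gq, Go}) = word_congruence"
  unfolding monoid_congruence_def word_congruence_def free_monoid_def lists_letters by (simp add: fun_eq_iff)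

text \<open>The right regular action on congruence classes. It is the identity on all other sets, so that
  it is an action of the free monoid on a full type.\<close>

definition class_action :: "(letter list \<times> letter list) set \<Rightarrow> letter \<Rightarrow> letter list set endo" where
  "class_action H a = Endo (\<lambda>C. if \<exists>v. C = H `` {v} then {z. \<exists>v\<in>C. (v @ [a], z) \<in> H} else C)"

context
  fixes H :: "(letter list \<times> letter list) set"
  assumes H: "word_congruence H"
begin

lemma H_equiv: "equiv UNIV H"
  using H by (simp add: word_congruence_def)

lemma H_append: "(u, v) \<in> H \<Longrightarrow> (u', v') \<in> H \<Longrightarrow> (u @ u', v @ v') \<in> H"
  using H unfolding word_congruence_def by blast

lemma H_refl: "(u, u) \<in> H"
  using H_equiv by (simp add: equiv_def refl_on_def)

lemma H_class_eq: "H `` {u} = H `` {v} \<longleftrightarrow> (u, v) \<in> H"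
  using eq_equiv_class_iff[OF H_equiv] by simp

lemma class_action_class: "app (class_action H a) (H `` {v}) = H `` {v @ [a]}"
proof -
  have "{z. \<exists>w\<in>H `` {v}. (w @ [a], z) \<in> H} = H `` {v @ [a]}"
  proof (intro equalityI subsetI)
    fix z assume "z \<in> {z. \<exists>w\<in>H `` {v}. (w @ [a], z) \<in> H}"
    then obtain w where w: "(v, w) \<in> H" "(w @ [a], z) \<in> H" by blast
    have "H `` {v @ [a]} = H `` {w @ [a]}" "H `` {w @ [a]} = H `` {z}"
      unfolding H_class_eq using H_append[OF w(1) H_refl] w(2) by blast+
    then show "z \<in> H `` {v @ [a]}" using H_refl[of z] by blast
  next
    fix z assume "z \<in> H `` {v @ [a]}"
    then show "z \<in> {z. \<exists>w\<in>H `` {v}. (w @ [a], z) \<in> H}" using H_refl[of v] by blast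
  qed
  moreover have "\<exists>w. H `` {v} = H `` {w}" by blast
  ultimately show ?thesis unfolding class_action_def by (simp only: endo.sel if_True)
qed

lemma word_action_class: "app (word_value (class_action H) w) (H `` {v}) = H `` {v @ w}"
proof (induction w arbitrary: v)
  case Nil
  show ?case by (simp add: one_endo_def)
next
  case (Cons a w)
  have "app (word_value (class_action H) (a # w)) (H `` {v}) =
      app (word_value (class_action H) w) (app (class_action H a) (H `` {v}))"
    by (simp add: times_endo_def)
  also have "\<dots> = H `` {v @ a # w}" unfolding class_action_class Cons.IH by simp
  finally show ?case .
qed

lemma word_action_non_class:
  assumes "\<nexists>v. C = H `` {v}"
  shows "app (word_value (class_action H) w) C = C"
proof (induction w)
  case Nil
  show ?case by (simp add: one_endo_def)
next
  case (Cons a w)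
  have "app (class_action H a) C = C" using assms unfolding class_action_def by (simp only: endo.sel if_False)
  then show ?case using Cons by (simp add: times_endo_def)
qed

text \<open>The action is faithful on classes because the class of the empty word is sent to the
  class of the acting word.\<close>

lemma word_action_eq_iff: "word_value (class_action H) u = word_value (class_action H) v \<longleftrightarrow> (u, v) \<in> H"
proof
  assume "word_value (class_action H) u = word_value (class_action H) v"
  then have "H `` {[] @ u} = H `` {[] @ v}" unfolding word_action_class[symmetric] by simp
  then show "(u, v) \<in> H" unfolding H_class_eq by simp
next
  assume uv: "(u, v) \<in> H"
  have "app (word_value (class_action H) u) C = app (word_value (class_action H) v) C" for C
  proof (cases "\<exists>w. C = H `` {w}")
    case True
    then obtain w where C: "C = H `` {w}" by blast
    show ?thesis unfolding C word_action_class H_class_eq by (rule H_append[OF H_refl uv])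
  next
    case False
    then show ?thesis using word_action_non_class by metis
  qed
  then show "word_value (class_action H) u = word_value (class_action H) v"
    by (intro endo.expand ext)
qed

end

text \<open>A chain relates only neighbouring words, whereas the axioms of the locale compare
  arbitrary members; so all values along a chain are first shown equal.\<close>

lemma rook_generatorsI:
  assumes n: "3 \<le> n" and rel: "\<And>u v. (u, v) \<in> rook_relations n \<Longrightarrow> word_value g u = word_value g v"
  shows "rook_generators n (g Gs) (g Gc) (g Ge) (g Gq) (g Go)"
proof -
  have chain: "word_value g u = word_value g v"
    if "rel_chain ws \<subseteq> rook_relations n" "u \<in> set ws" "v \<in> set ws" for ws u v
  proof -
    have "word_value g w = word_value g (hd ws)" if "rel_chain ws \<subseteq> rook_relations n" "w \<in> set ws" for w ws
      using that
    proof (induction ws rule: induct_list012)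
      case (3 x y zs)
      have sub: "rel_chain (y # zs) \<subseteq> rook_relations n" and xy: "(x, y) \<in> rook_relations n"
        using "3.prems"(1) by (auto simp: rel_chain_def)
      show ?case
        using "3.IH"(2)[OF sub] rel[OF xy] "3.prems"(2) by auto
    qed auto
    then show ?thesis using that by metis
  qed
  note R = rook_relations_def Let_def
  have c1: "rel_chain [[Gc] \<up> n, ([Gs] @ [Gc]) \<up> (n - 1), [Gs] \<up> 2, []] \<subseteq> rook_relations n"
    unfolding R by blast
  have c2: "rel_chain [([Gc] \<up> i @ [Gs] @ [Gc] \<up> (n - i) @ [Gs]) \<up> 2, []] \<subseteq> rook_relations n"
    if "2 \<le> i" "2 * i \<le> n" for i
    using that unfolding R by blast
  have c3: "rel_chain [[Ge] \<up> 2, [Ge], [Ge] @ [Gq] @ [Ge], [Ge] @ [Go] @ [Ge],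
      [Gs] @ [Gc] @ [Ge] @ [Gc] \<up> (n - 1) @ [Gs],
      [Gc] @ [Gs] @ [Gc] \<up> (n - 1) @ [Ge] @ [Gc] @ [Gs] @ [Gc] \<up> (n - 1)] \<subseteq> rook_relations n"
    unfolding R by blast
  have c4: "rel_chain [[Gq] \<up> 2, [Gq], [Gq] @ [Ge] @ [Gq], [Gq] @ [Gs], [Gs] @ [Gq],
      [Gc] \<up> (n - 1) @ [Gs] @ [Gc] @ [Gs] @ [Gc] \<up> (n - 1) @ [Gq] @
        [Gc] @ [Gs] @ [Gc] \<up> (n - 1) @ [Gs] @ [Gc]] \<subseteq> rook_relations n"
    unfolding R by blast
  have c5: "rel_chain [[Gq], [Gc] \<up> 2 @ [Gs] @ [Gc] \<up> (n - 2) @ [Gq] @ [Gc] \<up> 2 @ [Gs] @ [Gc] \<up> (n - 2)]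
      \<subseteq> rook_relations n" if "4 \<le> n"
    unfolding R if_P[OF that] by blast
  have c6: "rel_chain [[Gs] @ [Ge] @ [Gs] @ [Ge], [Ge] @ [Gs] @ [Ge] @ [Gs], [Ge] @ [Gs] @ [Ge]] \<subseteq> rook_relations n"
    unfolding R by blast
  have c7: "rel_chain [[Gq] @ [Gc] @ [Gq] @ [Gc] \<up> (n - 1), [Gc] @ [Gq] @ [Gc] \<up> (n - 1) @ [Gq]] \<subseteq> rook_relations n"
    unfolding R by blast
  have c8: "rel_chain [[Gq] @ [Gc] \<up> 2 @ [Gq] @ [Gc] \<up> (n - 2), [Gc] \<up> 2 @ [Gq] @ [Gc] \<up> (n - 2) @ [Gq]] \<subseteq> rook_relations n"
    unfolding R by blast
  have c9: "rel_chain [[Gq] @ [Gc] \<up> 2 @ [Ge] @ [Gc] \<up> (n - 2), [Gc] \<up> 2 @ [Ge] @ [Gc] \<up> (n - 2) @ [Gq]] \<subseteq> rook_relations n"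
    unfolding R by blast
  have c10: "rel_chain [[Go] \<up> 2, [Go], [Go] @ [Ge] @ [Go],
      [Gs] @ [Gc] @ [Go] @ [Gc] \<up> (n - 1) @ [Gs],
      [Gc] @ [Gs] @ [Gc] \<up> (n - 1) @ [Go] @ [Gc] @ [Gs] @ [Gc] \<up> (n - 1)] \<subseteq> rook_relations n"
    unfolding R by blast
  have c11: "rel_chain [[Gs] @ [Go] @ [Gs] @ [Go], [Go] @ [Gs] @ [Go] @ [Gs], [Go] @ [Gs] @ [Go],
      [Go] @ [Gq], [Gq] @ [Go]] \<subseteq> rook_relations n"
    unfolding R by blast
  have c12: "rel_chain [[Gq] @ [Gc] \<up> 2 @ [Go] @ [Gc] \<up> (n - 2), [Gc] \<up> 2 @ [Go] @ [Gc] \<up> (n - 2) @ [Gq]] \<subseteq> rook_relations n"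
    unfolding R by blast
  have c13: "rel_chain [[Ge] @ [Gs] @ [Go] @ [Gs], [Gs] @ [Go] @ [Gs] @ [Ge]] \<subseteq> rook_relations n"
    unfolding R by blast
  have letter: "word_value g [a] = g a" for a by simp
  have cons: "list_all (\<lambda>w. word_value g w = word_value g v) ws" if "rel_chain ws \<subseteq> rook_relations n" "v \<in> set ws" for ws v
    using chain[OF that(1) _ that(2)] by (simp add: list_all_iff)
  note simps = list.pred_inject simp_thms word_value_simps(1,3) letter word_value_power power2_eq_square mult.assoc
  note l1 = cons[OF c1, where v = "[]"] and l2 = cons[OF c2, where v = "[]"] and l3 = cons[OF c3, where v = "[Ge]"]
    and l4 = cons[OF c4, where v = "[Gq]"] and l5 = cons[OF c5, where v = "[Gq]"] and l6 = cons[OF c6, where v = "[Ge] @ [Gs] @ [Ge]"]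
    and l7 = cons[OF c7, where v = "[Gc] @ [Gq] @ [Gc] \<up> (n - 1) @ [Gq]"]
    and l8 = cons[OF c8, where v = "[Gc] \<up> 2 @ [Gq] @ [Gc] \<up> (n - 2) @ [Gq]"]
    and l9 = cons[OF c9, where v = "[Gc] \<up> 2 @ [Ge] @ [Gc] \<up> (n - 2) @ [Gq]"]
    and l10 = cons[OF c10, where v = "[Go]"] and l11 = cons[OF c11, where v = "[Go] @ [Gs] @ [Go]"]
    and l12 = cons[OF c12, where v = "[Gc] \<up> 2 @ [Go] @ [Gc] \<up> (n - 2) @ [Gq]"]
    and l13 = cons[OF c13, where v = "[Gs] @ [Go] @ [Gs] @ [Ge]"]
  note member = list.set insert_iff simp_thms
  note L1 = l1[unfolded simps member] and L3 = l3[unfolded simps member] and L4 = l4[unfolded simps member]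
    and L6 = l6[unfolded simps member] and L7 = l7[unfolded simps member] and L8 = l8[unfolded simps member]
    and L9 = l9[unfolded simps member] and L10 = l10[unfolded simps member] and L11 = l11[unfolded simps member]
    and L12 = l12[unfolded simps member] and L13 = l13[unfolded simps member]
    and L2 = l2[unfolded simps member] and L5 = l5[unfolded simps member]
  show ?thesis
    unfolding rook_generators_def power2_eq_square mult.assoc
    by (intro conjI allI impI;
        (rule n | simp only: L1 L2 L3 L4 L5 L6 L7 L8 L9 L10 L11 L12 L13))
qed

text \<open>Intersecting with the kernel of \<^const>\<open>zeta\<close> makes the normal form of a word valid in both
  monoids at once.\<close>

lemma kernel_subset_congruence:
  assumes n: "3 \<le> n" and H: "word_congruence H" and R: "rook_relations n \<subseteq> H"
    and uv: "zeta n u = zeta n v"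
  shows "(u, v) \<in> H"
proof -
  define H' where "H' = H \<inter> {(u, v). word_rel n u = word_rel n v}"
  have H': "word_congruence H'"
    unfolding word_congruence_def
  proof (intro conjI allI impI)
    have "equiv UNIV H" using H by (simp add: word_congruence_def)
    then have equiv: "refl_on UNIV H" "sym H" "trans H" by (simp_all add: equiv_def)
    have "refl_on UNIV H'" using equiv(1) by (simp add: H'_def refl_on_def)
    moreover have "sym H'"
      unfolding H'_def by (intro symI) (simp add: symD[OF equiv(2)])
    moreover have "trans H'"
    proof (rule transI)
      fix u v w assume uv: "(u, v) \<in> H'" and vw: "(v, w) \<in> H'"
      then have "(u, w) \<in> H" using transD[OF equiv(3), of u v w] by (simp add: H'_def)
      then show "(u, w) \<in> H'" using uv vw by (simp add: H'_def)
    qed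
    ultimately show "equiv UNIV H'" by (simp add: equiv_def)
    fix u v u' v' assume uv: "(u, v) \<in> H'" "(u', v') \<in> H'"
    then have "(u, v) \<in> H" "(u', v') \<in> H" by (simp_all add: H'_def)
    then have "(u @ u', v @ v') \<in> H" using H unfolding word_congruence_def by blast
    then show "(u @ u', v @ v') \<in> H'" using uv by (simp add: H'_def word_rel_append)
  qed
  define g where "g = class_action H'"
  have eq_iff: "word_value g u = word_value g v \<longleftrightarrow> (u, v) \<in> H'" for u v
    unfolding g_def by (rule word_action_eq_iff[OF H'])
  have gens: "rook_generators n (g Gs) (g Gc) (g Ge) (g Gq) (g Go)"
  proof (rule rook_generatorsI[OF n])
    fix u v assume "(u, v) \<in> rook_relations n"
    then have "(u, v) \<in> H'" using R relations_sound[OF n] unfolding H'_def by blast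
    then show "word_value g u = word_value g v" unfolding eq_iff .
  qed
  interpret X: rook_generators n "g Gs" "g Gc" "g Ge" "g Gq" "g Go" by (rule gens)
  have normal: "X.is_normal (word_value g w)" for w
  proof (induction w rule: rev_induct)
    case Nil
    show ?case using X.is_normal_1 by simp
  next
    case (snoc a w)
    then show ?case using X.is_normal_generators[OF snoc] by (cases a) simp_all
  qed
  have nf: "\<exists>R A \<pi> R'. proper n R A \<pi> R' \<and> word_value g w = X.N R A \<pi> R' \<and> word_rel n w = nf_rel R A \<pi> R'" for w
  proof -
    obtain R A \<pi> R' where "nf_ok n R A \<pi> R'" "word_value g w = X.N R A \<pi> R'"
      using normal[of w] unfolding X.is_normal_def by blast
    then obtain Q B Q' where Q: "proper n Q B \<pi> Q'" "word_value g w = X.N Q B \<pi> Q'"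
      using X.N_proper by metis
    have ok: "nf_ok n Q B \<pi> Q'" using Q(1) by (simp add: proper_def)
    \<comment> \<open>The word and its normal form have the same value, so they are related by
      \<open>H'\<close>; since \<open>H'\<close> refines the kernel, they also have the same
      relation. This makes the calculated data readable from the rook partition of
      \<open>w\<close>.\<close>
    have "(w, N_word n Q B \<pi> Q') \<in> H'"
      unfolding eq_iff[symmetric] Q(2) word_value_N_word[OF gens ok] ..
    then have "word_rel n w = nf_rel Q B \<pi> Q'"
      unfolding H'_def using word_rel_N_word[OF ok] by simp
    then show ?thesis using Q by blast
  qed
  obtain R A \<pi> R' where 1: "proper n R A \<pi> R'" "word_value g u = X.N R A \<pi> R'" "word_rel n u = nf_rel R A \<pi> R'"
    using nf by blast
  obtain Q B \<rho> Q' where 2: "proper n Q B \<rho> Q'" "word_value g v = X.N Q B \<rho> Q'" "word_rel n v = nf_rel Q B \<rho> Q'"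
    using nf by blast
  have "nf_rel R A \<pi> R' = nf_rel Q B \<rho> Q'"
    using uv unfolding zeta_eq_iff[OF n] 1(3) 2(3) .
  from X.N_unique[OF 1(1) 2(1) nf_rel_determines[OF 1(1) 2(1) this]]
  have "word_value g u = word_value g v" unfolding 1(2) 2(2) .
  then show ?thesis unfolding eq_iff H'_def by simp
qed

theorem theorem4p12:
  fixes n :: nat
  assumes "n \<ge> 3"
  shows "has_monoid_presentation (rook_monoid n) {Gs, Gc, Ge, Gq, Go} (rook_relations n) (zeta n)"
proof -
  let ?K = "{(u, v). zeta n u = zeta n v}"
  have carrier: "carrier (rook_monoid n) = rook_partitions n" by (simp add: rook_monoid_def)
  have hom: "zeta n \<in> monoid_hom (free_monoid {Gs, Gc, Ge, Gq, Go}) (rook_monoid n)"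
    unfolding monoid_hom_def hom_def free_monoid_def
    using zeta_append[OF assms] zeta_colourings(1)[OF assms]
    by (simp add: rook_monoid_def zeta_def monoid_prod_list_def)
  have kernel: "monoid_kernel (free_monoid {Gs, Gc, Ge, Gq, Go}) (zeta n) = ?K"
    unfolding monoid_kernel_def free_monoid_def lists_letters by simp
  have "word_congruence ?K"
    unfolding word_congruence_def equiv_def refl_on_def sym_def trans_def
    by (auto simp: zeta_append[OF assms])
  moreover have "rook_relations n \<subseteq> ?K"
    using relations_sound[OF assms] zeta_eq_iff[OF assms] by auto
  ultimately have "word_congruence hull rook_relations n \<subseteq> ?K" by (intro hull_minimal)
  \<comment> \<open>The hull is the intersection of all congruences containing the relations, so the
    kernel is compared with each of them and the hull need not be shown to be a congruence.\<close>
  moreover have "?K \<subseteq> word_congruence hull rook_relations n"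
    unfolding hull_def using kernel_subset_congruence[OF assms] by blast
  ultimately have hull: "?K = word_congruence hull rook_relations n" by blast
  show ?thesis
    unfolding has_monoid_presentation_def kernel monoid_congruence_iff lists_letters carrier zeta_surj[OF assms]
    using monoid_rook_monoid hom hull by simp
qed

end
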